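(* Let $K$ be the $2$-uniform tiling of the plane whose vertex types are $[3^6]$ and $[3^2,4^1,3^1,4^1]$. If $X$ is a map on the torus that is a quotient $X=K/\Gamma$ of $K$, then the vertices of $X$ form at most $4$ orbits under ${\rm Aut}(X)$.
   Context: A map is a polyhedral map: a cellular embedding of a connected graph in a closed surface such that the intersection of any two distinct faces is empty, a single vertex, or a single edge. For a vertex $u$, the faces containing $u$ form a cyclic sequence (the face-cycle at $u$); if this cyclic sequence consists of consecutive blocks of $n_1$ $p_1$-gons, then $n_2$ $p_2$-gons, ..., then $n_k$ $p_k$-gons, with cyclically consecutive $p_i$ distinct, then $u$ is said to have type $[p_1^{n_1},\dots,p_k^{n_k}]$ (defined up to cyclic shift and reversal). A $2$-uniform tiling is an edge-to-edge tiling of the Euclidean plane $\mathbb{R}^2$ by regular polygons whose symmetry group has exactly two orbits on the set of vertices; viewed as a map on the plane, its vertices have (at most) two types, listed as $[W;Z]$. (Up to isomorphism there are exactly $20$ such tilings; there is exactly one with the vertex types named in the claim.) For a map $K$ on the plane, a quotient of $K$ on the torus is a map $X$ on the torus together with a polyhedral covering map $\eta:K\to X$ with $X=K/\Gamma$, where $\Gamma\le {\rm Aut}(K)$ is a subgroup acting without fixed vertices, edges or faces and $K/\Gamma$ is homeomorphic to the torus. ${\rm Aut}(X)$ denotes the automorphism group of the map $X$, acting on its vertex set $V(X)$. *)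

theory Defs
  imports "HOL-Analysis.Analysis"
begin

text \<open>A tile is represented by its set of vertices. The regular n-gon with centre c,
  circumradius r and phase th has vertices c + r cis(th + 2 pi k / n), k < n.\<close>

definition regpoly_vtx :: "complex \<Rightarrow> real \<Rightarrow> nat \<Rightarrow> real \<Rightarrow> nat \<Rightarrow> complex" where
  "regpoly_vtx c r n th k = c + complex_of_real r * cis (th + 2 * pi * real k / real n)"

definition regpoly :: "complex \<Rightarrow> real \<Rightarrow> nat \<Rightarrow> real \<Rightarrow> complex set" where
  "regpoly c r n th = {regpoly_vtx c r n th k | k. k < n}"

definition is_regular_polygon :: "complex set \<Rightarrow> bool" where
  "is_regular_polygon P \<longleftrightarrow> (\<exists>c r n th. r > 0 \<and> n \<ge> 3 \<and> P = regpoly c r n th)"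

definition poly_edge :: "complex set \<Rightarrow> complex set \<Rightarrow> bool" where
  "poly_edge P e \<longleftrightarrow> (\<exists>c r n th k. r > 0 \<and> n \<ge> 3 \<and> P = regpoly c r n th \<and> k < n \<and>
      e = {regpoly_vtx c r n th k, regpoly_vtx c r n th (Suc k)})"

definition e2e_regular_tiling :: "complex set set \<Rightarrow> bool" where
  "e2e_regular_tiling T \<longleftrightarrow>
     (\<forall>P\<in>T. is_regular_polygon P) \<and>
     (\<Union>P\<in>T. convex hull P) = UNIV \<and>
     (\<forall>S. compact S \<longrightarrow> finite {P\<in>T. convex hull P \<inter> S \<noteq> {}}) \<and>
     (\<forall>P\<in>T. \<forall>Q\<in>T. P \<noteq> Q \<longrightarrow>
        interior (convex hull P) \<inter> interior (convex hull Q) = {} \<and>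
        (convex hull P \<inter> convex hull Q = {} \<or>
         (\<exists>v. v \<in> P \<and> v \<in> Q \<and> convex hull P \<inter> convex hull Q = {v}) \<or>
         (\<exists>a b. poly_edge P {a, b} \<and> poly_edge Q {a, b} \<and>
                convex hull P \<inter> convex hull Q = closed_segment a b)))"

definition tvertices :: "complex set set \<Rightarrow> complex set" where
  "tvertices T = \<Union> T"

definition tedges :: "complex set set \<Rightarrow> complex set set" where
  "tedges T = {e. \<exists>P\<in>T. poly_edge P e}"

definition tiling_symmetry :: "complex set set \<Rightarrow> (complex \<Rightarrow> complex) \<Rightarrow> bool" where
  "tiling_symmetry T f \<longleftrightarrow> (\<forall>x y. dist (f x) (f y) = dist x y) \<and> (\<lambda>P. f ` P) ` T = T"

definition sym_vertex_orbits :: "complex set set \<Rightarrow> complex set set" where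
  "sym_vertex_orbits T = (\<lambda>u. {f u | f. tiling_symmetry T f}) ` tvertices T"

definition two_uniform_tiling :: "complex set set \<Rightarrow> bool" where
  "two_uniform_tiling T \<longleftrightarrow> e2e_regular_tiling T \<and> card (sym_vertex_orbits T) = 2"

text \<open>Vertex type: the face-cycle at u, written out as the cyclic sequence of the
  numbers of sides of the faces around u (the block notation [p1^n1,...,pk^nk]
  expanded), up to cyclic shift and reversal.\<close>
definition has_vertex_type :: "complex set set \<Rightarrow> complex \<Rightarrow> nat list \<Rightarrow> bool" where
  "has_vertex_type T u L \<longleftrightarrow> u \<in> tvertices T \<and>
     (\<exists>ts. distinct ts \<and> set ts = {P\<in>T. u \<in> P} \<and>
        (\<forall>i < length ts. \<exists>e. u \<in> e \<and> poly_edge (ts ! i) e \<and>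
                                  poly_edge (ts ! ((Suc i) mod length ts)) e) \<and>
        (\<exists>k. map card ts = rotate k L \<or> map card ts = rotate k (rev L)))"

text \<open>A map given by its vertex set, edges (as vertex sets) and faces (as vertex sets).\<close>
type_synonym 'v pmap = "'v set \<times> 'v set set \<times> 'v set set"

definition map_aut :: "'v pmap \<Rightarrow> ('v \<Rightarrow> 'v) \<Rightarrow> bool" where
  "map_aut M \<sigma> \<longleftrightarrow> (case M of (V, E, F) \<Rightarrow>
      bij_betw \<sigma> V V \<and> (\<lambda>e. \<sigma> ` e) ` E = E \<and> (\<lambda>f. \<sigma> ` f) ` F = F)"

definition aut_vertex_orbits :: "'v pmap \<Rightarrow> 'v set set" where
  "aut_vertex_orbits M = (\<lambda>u. {\<sigma> u | \<sigma>. map_aut M \<sigma>}) ` fst M"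

definition polyhedral :: "'v pmap \<Rightarrow> bool" where
  "polyhedral M \<longleftrightarrow> (case M of (V, E, F) \<Rightarrow>
     (\<forall>f1\<in>F. \<forall>f2\<in>F. f1 \<noteq> f2 \<longrightarrow>
        f1 \<inter> f2 = {} \<or> (\<exists>v. f1 \<inter> f2 = {v}) \<or> f1 \<inter> f2 \<in> E))"

definition tiling_map :: "complex set set \<Rightarrow> complex pmap" where
  "tiling_map T = (tvertices T, tedges T, T)"

text \<open>Gamma is a subgroup of Aut(K); its elements are taken to be the identity
  outside the vertex set, so that they are determined by their action on V(K).\<close>
definition aut_subgroup :: "complex set set \<Rightarrow> (complex \<Rightarrow> complex) set \<Rightarrow> bool" where
  "aut_subgroup T G \<longleftrightarrow>
     (\<forall>\<sigma>\<in>G. map_aut (tiling_map T) \<sigma> \<and> (\<forall>x. x \<notin> tvertices T \<longrightarrow> \<sigma> x = x)) \<and>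
     id \<in> G \<and> (\<forall>\<sigma>\<in>G. \<forall>\<tau>\<in>G. \<sigma> \<circ> \<tau> \<in> G) \<and> (\<forall>\<sigma>\<in>G. \<exists>\<tau>\<in>G. \<tau> \<circ> \<sigma> = id)"

definition acts_freely :: "complex set set \<Rightarrow> (complex \<Rightarrow> complex) set \<Rightarrow> bool" where
  "acts_freely T G \<longleftrightarrow> (\<forall>\<sigma>\<in>G. \<sigma> \<noteq> id \<longrightarrow>
      (\<forall>v\<in>tvertices T. \<sigma> v \<noteq> v) \<and> (\<forall>e\<in>tedges T. \<sigma> ` e \<noteq> e) \<and> (\<forall>P\<in>T. \<sigma> ` P \<noteq> P))"

text \<open>The induced action on the realisation |K| = plane: on each tile, an automorphism acts
  by the (unique) affine map extending its action on the vertices of that tile.\<close>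
definition quot_rel :: "complex set set \<Rightarrow> (complex \<Rightarrow> complex) set \<Rightarrow> complex \<Rightarrow> complex \<Rightarrow> bool" where
  "quot_rel T G x y \<longleftrightarrow> (\<exists>\<sigma>\<in>G. \<exists>P\<in>T. x \<in> convex hull P \<and>
      (\<exists>f b. linear f \<and> (\<forall>v\<in>P. \<sigma> v = f v + b) \<and> y = f x + b))"

definition torus :: "(complex \<times> complex) set" where
  "torus = {(z, w). cmod z = 1 \<and> cmod w = 1}"

text \<open>|K|/Gamma is homeomorphic to the torus: there is a quotient map from the plane onto
  the torus whose fibres are exactly the Gamma-classes.\<close>
definition quotient_is_torus :: "complex set set \<Rightarrow> (complex \<Rightarrow> complex) set \<Rightarrow> bool" where
  "quotient_is_torus T G \<longleftrightarrow> (\<exists>q. quotient_map euclidean (top_of_set torus) q \<and>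
      (\<forall>x y. q x = q y \<longleftrightarrow> quot_rel T G x y))"

definition orb :: "(complex \<Rightarrow> complex) set \<Rightarrow> complex \<Rightarrow> complex set" where
  "orb G v = {\<sigma> v | \<sigma>. \<sigma> \<in> G}"

definition quotient_map_K :: "complex set set \<Rightarrow> (complex \<Rightarrow> complex) set \<Rightarrow> complex set pmap" where
  "quotient_map_K T G = (orb G ` tvertices T, (\<lambda>e. orb G ` e) ` tedges T, (\<lambda>P. orb G ` P) ` T)"

text \<open>X is a quotient of K on the torus: Gamma a subgroup of Aut(K) acting without fixed
  vertices, edges or faces, |K|/Gamma a torus, X = K/Gamma a (polyhedral) map and the
  natural projection eta a polyhedral covering (injective on each face).\<close>
definition torus_quotient :: "complex set set \<Rightarrow> (complex \<Rightarrow> complex) set \<Rightarrow> bool" where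
  "torus_quotient T G \<longleftrightarrow> aut_subgroup T G \<and> acts_freely T G \<and> quotient_is_torus T G \<and>
      polyhedral (quotient_map_K T G) \<and> (\<forall>P\<in>T. inj_on (orb G) P)"

end

(* At a vertex of type B = [3^2,4,3,4] only the edge between the two consecutive triangles lies on
   no square, so it is the only edge which can lead to a vertex of type A = [3^6]. Since the
   symmetries have two vertex orbits, every B has exactly one A neighbour and every A is the centre of
   a hexagon of six B vertices; crossing a square one finds the next such hexagon. Hence the tiling
   is invariant under a lattice of translations and under the half-turn about an A vertex, and these
   have four orbits on the vertices (the A's and three pairs of opposite B's).

   Automorphisms of the map are restrictions of isometries. Freeness excludes rotations from Gamma,
   because an isometry with a fixed point fixes a cell. The plane is the universal covering of
   the torus via both the quotient by Gamma and the standard exponential covering, which makes Gamma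
   abelian; an abelian group containing a glide reflection preserves the distance to its axis, an
   unbounded function, contradicting compactness. So Gamma consists of translations, it is
   normalised by lattice translations and half-turns, and these descend to the quotient. *)
theory Submission
  imports Defs
begin

subsection \<open>Regular triangles and squares in the plane\<close>


text \<open>The hypotheses speak of combinatorial automorphisms and of a purely topological torus;
  both must become plane geometry. A tile is pinned down by a vertex and the direction of an edge
  with the tile on its left, and each side of an edge carries at most one tile. So the tiles at a
  vertex are explicit multiples of one vector by powers of a twelfth root of unity, and adjacency
  becomes polynomial identities in that root. Symmetries preserve the number of tiles at a vertex,
  six or five, so each type is a single orbit; one tile with vertices of both types, found by
  connectedness, can then be transported everywhere. A hexagon has sixfold symmetry, but a rotation
  by 60 degrees need not normalise Gamma. Conjugation by a translation or a half-turn sends each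
  translation to itself or its inverse, whatever Gamma is; hence 1 + 6/2 = 4. The obstacle is the
  Klein bottle: glide reflections also act freely with compact quotient, and only the commutative
  fundamental group of the torus excludes them.\<close>

text \<open>nu = cis (pi / 6); all edge directions of the tiling differ by powers of nu.\<close>
definition nu :: complex where "nu = Complex (sqrt 3 / 2) (1 / 2)"

lemma nu_sq: "nu ^ 2 = Complex (1/2) (sqrt 3 / 2)"
  by (simp add: nu_def power2_eq_square complex_eq_iff)

lemma nu_3: "nu ^ 3 = \<i>"
proof -
  have "nu ^ 3 = nu * nu ^ 2" by (simp add: power3_eq_cube power2_eq_square)
  then show ?thesis by (simp add: nu_sq) (simp add: nu_def complex_eq_iff)
qed

lemma nu_4: "nu ^ 4 = nu ^ 2 - 1"
proof -
  have "nu ^ 4 = nu ^ 2 * nu ^ 2" by (simp flip: power_add)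
  then show ?thesis by (simp add: nu_sq) (simp add: complex_eq_iff)
qed

lemma nu_6: "nu ^ 6 = -1"
proof -
  have "nu ^ 6 = nu ^ 3 * nu ^ 3" by (simp flip: power_add)
  then show ?thesis by (simp add: nu_3)
qed

lemma nu_5: "nu ^ 5 = nu ^ 3 - nu"
proof -
  have "nu ^ 5 = nu * nu ^ 4" by (simp flip: power_Suc)
  then show ?thesis unfolding nu_4 by (simp add: algebra_simps power3_eq_cube power2_eq_square)
qed

lemma nu_add6: "nu ^ (6 + k) = - (nu ^ k)"
  unfolding power_add nu_6 by simp

lemma nu_7: "nu ^ 7 = - nu" using nu_add6[of 1] by simp
lemma nu_8: "nu ^ 8 = - (nu ^ 2)" using nu_add6[of 2] by simp
lemma nu_9: "nu ^ 9 = - (nu ^ 3)" using nu_add6[of 3] by simp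
lemma nu_10: "nu ^ 10 = 1 - nu ^ 2" using nu_add6[of 4] by (simp add: nu_4)
lemma nu_11: "nu ^ 11 = nu - nu ^ 3" using nu_add6[of 5] by (simp add: nu_5)
lemma nu_12: "nu ^ 12 = 1" using nu_add6[of 6] by (simp add: nu_6)

lemmas nu_red = nu_4 nu_5 nu_6 nu_7 nu_8 nu_9 nu_10 nu_11 nu_12

lemma nu_neq_0: "nu \<noteq> 0" by (simp add: nu_def complex_eq_iff)

lemma norm_nu: "cmod nu = 1"
  by (simp add: nu_def cmod_def power2_eq_square)

lemma norm_nu_power [simp]: "cmod (nu ^ k) = 1"
  by (simp add: norm_power norm_nu)

text \<open>Counterclockwise turn through the interior angle, 60 or 90 degrees. Every
  \<open>n\<close> other than 3 counts as a square, which saves side conditions;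
  \<open>corner\<close> follows the same convention.\<close>

definition rot :: "nat \<Rightarrow> complex" where "rot n = (if n = 3 then nu ^ 2 else nu ^ 3)"

text \<open>The regular triangle (n = 3) or square (otherwise) lying to the left of the edge from
  a to a + x.\<close>
definition corner :: "nat \<Rightarrow> complex \<Rightarrow> complex \<Rightarrow> complex set" where
  "corner n a x = (if n = 3 then {a, a + x, a + x * nu ^ 2}
                   else {a, a + x, a + x * nu ^ 3, a + x * (1 + nu ^ 3)})"

text \<open>Running counterclockwise round the tile, the last edge leads from
  \<open>a + x * rot n\<close> back to \<open>a\<close> and again has the tile on its left.\<close>

lemma corner_flip: "corner n (a + x * rot n) (- (x * rot n)) = corner n a x"
proof (cases "n = 3")
  case True
  have "a + x * nu^2 - x * nu^2 * nu^2 = a + x"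
  proof -
    have "nu^2 * nu^2 = nu^2 - 1" using nu_4 by (simp flip: power_add)
    then have "x * nu^2 * nu^2 = x * (nu^2 - 1)" by (simp add: mult.assoc)
    then show ?thesis by (simp add: algebra_simps)
  qed
  with True show ?thesis by (auto simp: corner_def rot_def)
next
  case False
  have "a + x * \<i> - x * \<i> * \<i> = a + x * (1 + \<i>)" "a + x * \<i> - x * \<i> * (1 + \<i>) = a + x"
    by (simp_all add: algebra_simps)
  with False show ?thesis by (auto simp: corner_def rot_def nu_3)
qed

lemma cis_pi_thirds: "cis (pi / 3) = nu ^ 2"
  by (simp add: nu_sq complex_eq_iff cos_60 sin_60)

lemma cis_third: "cis (2 * pi / 3) = nu ^ 4"
proof -
  have "cis (2 * pi / 3) = cis (pi / 3) * cis (pi / 3)" by (simp add: cis_mult)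
  then show ?thesis by (simp add: cis_pi_thirds flip: power_add)
qed

lemma cis_fourth: "cis (2 * pi / 4) = nu ^ 3"
  by (simp add: nu_3 complex_eq_iff)

lemma regpoly_vtx_eq:
  "regpoly_vtx c r n th k = c + (complex_of_real r * cis th) * cis (2 * pi / real n) ^ k"
proof -
  have "cis (th + 2 * pi * real k / real n) = cis th * cis (real k * (2 * pi / real n))"
    unfolding cis_mult by (simp add: algebra_simps)
  also have "cis (real k * (2 * pi / real n)) = cis (2 * pi / real n) ^ k"
    using Complex.DeMoivre by metis
  finally show ?thesis by (simp add: regpoly_vtx_def mult.assoc)
qed

text \<open>Makes the number of sides a property of the point set: the witnesses hidden in
  \<open>is_regular_polygon\<close> and \<open>poly_edge\<close> may differ, but \<open>n\<close> is
  always the cardinality.\<close>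

lemma card_regpoly:
  assumes "r > 0" "n \<ge> 3" shows "card (regpoly c r n th) = n"
proof -
  have "bij_betw (\<lambda>k. cis (2 * pi * real k / real n)) {..<n} {z. z ^ n = 1}"
    using assms Complex.bij_betw_roots_unity[of n] by linarith
  then have i: "inj_on (\<lambda>k. cis (2 * pi * real k / real n)) {..<n}" by (rule bij_betw_imp_inj_on)
  have "inj_on (regpoly_vtx c r n th) {..<n}"
  proof (rule inj_onI)
    fix j k assume "j \<in> {..<n}" "k \<in> {..<n}" "regpoly_vtx c r n th j = regpoly_vtx c r n th k"
    moreover from this assms have "cis (2 * pi * real j / real n) = cis (2 * pi * real k / real n)"
      by (simp add: regpoly_vtx_def flip: cis_mult)
    ultimately show "j = k" using i by (auto dest: inj_onD)
  qed
  moreover have "regpoly c r n th = regpoly_vtx c r n th ` {..<n}" by (auto simp: regpoly_def)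
  ultimately show ?thesis by (simp add: card_image)
qed

lemma set_less_3: "{f k | k. k < (3::nat)} = {f 0, f 1, f 2}"
proof -
  have "(k < 3) = (k = 0 \<or> k = 1 \<or> k = 2)" for k :: nat by auto
  then show ?thesis by auto
qed

lemma set_less_4: "{f k | k. k < (4::nat)} = {f 0, f 1, f 2, f 3}"
proof -
  have "(k < 4) = (k = 0 \<or> k = 1 \<or> k = 2 \<or> k = 3)" for k :: nat by auto
  then show ?thesis by auto
qed

text \<open>Vertices are numbered counterclockwise, so the polygon lies to the left of the edge from
  vertex \<open>k\<close> to vertex \<open>Suc k\<close>.\<close>

lemma regpoly_corner:
  assumes "r > 0" "n = 3 \<or> n = 4" "k < n"
  shows "regpoly c r n th =
    corner n (regpoly_vtx c r n th k) (regpoly_vtx c r n th (Suc k) - regpoly_vtx c r n th k)"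
    "regpoly_vtx c r n th (Suc k) \<noteq> regpoly_vtx c r n th k"
proof -
  define w where "w = (complex_of_real r * cis th) * cis (2 * pi / real n) ^ k"
  have w0: "w \<noteq> 0" using assms(1) by (simp add: w_def)
  have v: "regpoly_vtx c r n th k = c + w" "regpoly_vtx c r n th (Suc k) = c + w * cis (2 * pi / real n)"
    by (simp_all add: regpoly_vtx_eq w_def algebra_simps)
  have "regpoly c r n th = corner n (regpoly_vtx c r n th k) (regpoly_vtx c r n th (Suc k) - regpoly_vtx c r n th k)
    \<and> regpoly_vtx c r n th (Suc k) \<noteq> regpoly_vtx c r n th k"
  proof (cases "n = 3")
    case True
    define W where "W = complex_of_real r * cis th"
    have p: "regpoly_vtx c r n th j = c + W * (nu^4)^j" for j
      using True by (simp add: regpoly_vtx_eq W_def cis_third)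
    have R: "regpoly c r n th = {c + W, c + W * nu^4, c + W * nu^8}"
      unfolding regpoly_def True set_less_3 unfolding p[unfolded True] by (simp flip: power_mult)
    have wW: "w = W * (nu^4)^k" using True by (simp add: w_def W_def cis_third)
    have k: "k = 0 \<or> k = 1 \<or> k = 2" using assms True by auto
    have 1: "regpoly c r n th = {c + w, c + w * nu^4, c + w * nu^8}"
    proof -
      have e: "W * nu ^ 4 * nu ^ 4 = W * nu ^ 8" "W * nu ^ 4 * nu ^ 8 = W"
        "W * nu ^ 8 * nu ^ 4 = W" "W * nu ^ 8 * nu ^ 8 = W * nu ^ 4"
        using power_add[of nu 12 4] by (simp_all add: nu_12 mult.assoc flip: power_add)
      have "w = W \<or> w = W * nu ^ 4 \<or> w = W * nu ^ 8"
        using k unfolding wW by (auto simp flip: power_mult)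
      then show ?thesis unfolding R by (elim disjE) (simp_all only: e insert_commute)
    qed
    have 2: "w * nu ^ 4 \<noteq> w"
    proof -
      have "nu ^ 4 \<noteq> 1" by (simp add: nu_4 nu_sq complex_eq_iff)
      then show ?thesis using w0 by simp
    qed
    have "c + w + (w * nu^4 - w) * nu^2 = c + w * nu^8"
    proof -
      have "(nu^4 - 1) * nu^2 = nu^8 - 1" by (simp add: nu_4 nu_8 nu_sq complex_eq_iff)
      then have "(w * nu^4 - w) * nu^2 = w * (nu^8 - 1)" by algebra
      then show ?thesis by (simp add: algebra_simps)
    qed
    moreover have "cis (2 * pi / real n) = nu ^ 4" using True cis_third by simp
    ultimately show ?thesis using 1 2 True unfolding v by (simp add: corner_def add.assoc)
  next
    case False
    then have n: "n = 4" using assms by auto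
    define W where "W = complex_of_real r * cis th"
    have p: "regpoly_vtx c r n th j = c + W * \<i>^j" for j
      using n cis_fourth by (simp add: regpoly_vtx_eq W_def nu_3)
    have R: "regpoly c r n th = {c + W, c + W * \<i>, c - W, c - W * \<i>}"
      unfolding regpoly_def n set_less_4 unfolding p[unfolded n]
      by (simp add: power2_eq_square power3_eq_cube)
    have wW: "w = W * \<i>^k" using n cis_fourth by (simp add: w_def W_def nu_3)
    have k: "k = 0 \<or> k = 1 \<or> k = 2 \<or> k = 3" using assms n by auto
    have 1: "regpoly c r n th = {c + w, c + w * \<i>, c - w, c - w * \<i>}"
      using k unfolding wW R
      by (elim disjE) (auto simp: power2_eq_square power3_eq_cube mult.assoc)
    have 2: "w * \<i> \<noteq> w"
      using w0 by simp
    have "c + w + (w * \<i> - w) * \<i> = c - w * \<i>" "c + w + (w * \<i> - w) * (1 + \<i>) = c - w"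
      by (simp_all add: algebra_simps)
    note 3 = this
    have c: "cis (2 * pi / real n) = \<i>" using n cis_fourth nu_3 by simp
    have "corner n (c + w) (w * \<i> - w) = {c + w, c + w + (w * \<i> - w), c - w * \<i>, c - w}"
      unfolding corner_def n nu_3 3 by simp
    then have "corner n (c + w) (c + w * \<i> - (c + w)) = {c + w, c + w * \<i>, c - w * \<i>, c - w}"
      by simp
    also have "\<dots> = regpoly c r n th" unfolding 1 by (simp add: insert_commute)
    finally show ?thesis using 2 unfolding v c by simp
  qed
  then show "regpoly c r n th =
    corner n (regpoly_vtx c r n th k) (regpoly_vtx c r n th (Suc k) - regpoly_vtx c r n th k)"
    "regpoly_vtx c r n th (Suc k) \<noteq> regpoly_vtx c r n th k" by auto
qed

text \<open>An edge given as a set has lost its orientation; the tile lies to the left of one of the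
  two orientations.\<close>

lemma edge_corner:
  assumes "poly_edge P {a, b}" "card P = n" "n = 3 \<or> n = 4"
  shows "a \<noteq> b" "P = corner n a (b - a) \<or> P = corner n b (a - b)"
proof -
  obtain c r m th k where m: "r > 0" "m \<ge> 3" "P = regpoly c r m th" "k < m"
     and e: "{a, b} = {regpoly_vtx c r m th k, regpoly_vtx c r m th (Suc k)}"
    using assms(1) unfolding poly_edge_def by blast
  then have mn: "m = n" using assms card_regpoly by auto
  note R = regpoly_corner[OF m(1) assms(3) m(4)[unfolded mn]]
  from e R(2) mn show "a \<noteq> b" by auto
  from e R mn m show "P = corner n a (b - a) \<or> P = corner n b (a - b)"
    by (auto simp: doubleton_eq_iff)
qed

lemma regpoly_vtx_periodic: "n > 0 \<Longrightarrow> regpoly_vtx c r n th (k + n) = regpoly_vtx c r n th k"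
  using Complex.DeMoivre[of "2 * pi / real n" n] by (simp add: regpoly_vtx_eq power_add)

lemma poly_edge_subset: "poly_edge P e \<Longrightarrow> e \<subseteq> P"
proof -
  assume "poly_edge P e"
  then obtain c r m th k where m: "r > 0" "m \<ge> 3" "P = regpoly c r m th" "k < m"
     and e: "e = {regpoly_vtx c r m th k, regpoly_vtx c r m th (Suc k)}"
    unfolding poly_edge_def by blast
  have "regpoly_vtx c r m th (Suc k) \<in> P"
  proof (cases "Suc k = m")
    case True
    then show ?thesis using regpoly_vtx_periodic[of m c r th 0] m by (force simp: regpoly_def)
  qed (use m in \<open>auto simp: regpoly_def\<close>)
  then show ?thesis using m e by (auto simp: regpoly_def)
qed

lemma regular_corner:
  assumes "is_regular_polygon P" "card P = n" "n = 3 \<or> n = 4" "a \<in> P"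
  obtains x where "x \<noteq> 0" "P = corner n a x" "poly_edge P {a, a + x}" "poly_edge P {a, a + x * rot n}"
proof -
  obtain c r m th where m: "r > 0" "m \<ge> 3" "P = regpoly c r m th"
    using assms(1) unfolding is_regular_polygon_def by blast
  then have mn: "m = n" using assms card_regpoly by auto
  obtain k where k: "k < n" "a = regpoly_vtx c r n th k" using assms m mn by (auto simp: regpoly_def)
  define x where "x = regpoly_vtx c r n th (Suc k) - regpoly_vtx c r n th k"
  note R = regpoly_corner[OF m(1) assms(3) k(1)]
  have E: "poly_edge P {regpoly_vtx c r n th j, regpoly_vtx c r n th (Suc j)}" if "j < n" for j
    unfolding poly_edge_def using that m mn by blast
  have 1: "poly_edge P {a, a + x}" using E[OF k(1)] k by (simp add: x_def)
  \<comment> \<open>Index of the preceding vertex, wrapping round from 0 to \<open>n - 1\<close>;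
    its edge into \<open>a\<close> is the second edge at \<open>a\<close>.\<close>
  define j where "j = (if k = 0 then n - 1 else k - 1)"
  have j: "j < n" "regpoly_vtx c r n th (Suc j) = a"
    using k assms(3) regpoly_vtx_periodic[of n c r th 0] by (auto simp: j_def)
  note R' = regpoly_corner[OF m(1) assms(3) j(1)]
  define y where "y = regpoly_vtx c r n th j - a"
  have 2: "poly_edge P {a, a + y}" using E[OF j(1)] j by (simp add: y_def insert_commute)
  have jk: "cis (2 * pi / real n) ^ k = cis (2 * pi / real n) ^ Suc j"
  proof (cases "k = 0")
    case True
    then have "Suc j = n" using k by (auto simp: j_def)
    then show ?thesis using True Complex.DeMoivre[of "2 * pi / real n" n] assms(3) by auto
  qed (auto simp: j_def)
  define ze where "ze = cis (2 * pi / real n)"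
  \<comment> \<open>Position of the preceding vertex relative to the centre, in terms of which both
    edge vectors at \<open>a\<close> are written.\<close>
  define W where "W = complex_of_real r * cis th * ze ^ j"
  have X: "x = W * (ze^2 - ze)" unfolding x_def regpoly_vtx_eq W_def
    unfolding ze_def[symmetric] using jk[folded ze_def] by (simp add: algebra_simps power2_eq_square)
  have Y: "y = W * (1 - ze)" unfolding y_def k(2) regpoly_vtx_eq W_def
    unfolding ze_def[symmetric] using jk[folded ze_def] by (simp add: algebra_simps power2_eq_square)
  have "(ze^2 - ze) * rot n = 1 - ze"
  proof (cases "n = 3")
    case True
    then have ze: "ze = Complex (-1/2) (sqrt 3 / 2)" by (simp add: ze_def cis_third nu_4 nu_sq complex_eq_iff)
    have r: "rot n = Complex (1/2) (sqrt 3 / 2)" using True by (simp add: rot_def nu_sq)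
    show ?thesis unfolding ze r by (simp add: complex_eq_iff power2_eq_square)
  next
    case False
    then have "ze = \<i>" "n = 4" using assms(3) cis_fourth nu_3 by (auto simp: ze_def)
    then show ?thesis using False by (simp add: rot_def nu_3 algebra_simps)
  qed
  then have "x * rot n = y" unfolding X Y by simp
  with 1 2 show ?thesis using R k m mn by (intro that[of x]) (auto simp: x_def)
qed

subsection \<open>Edge-to-edge tilings\<close>


lemma rot_neq_0: "rot n \<noteq> 0" by (simp add: rot_def nu_neq_0)

text \<open>Describes the tile on the right of the edge from \<open>u\<close> to
  \<open>u + x\<close>: it is on the left of the reversed edge, and its first edge at
  \<open>u\<close>, counterclockwise, is \<open>x / rot n\<close>.\<close>

lemma corner_flip': "corner n u (x / rot n) = corner n (u + x) (- x)"
  using corner_flip[of n u "x / rot n"] rot_neq_0 by simp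

text \<open>Only the next vertex counterclockwise can end the first edge: taking any other vertex of
  the tile instead would require a vertex where the tile has none.\<close>

lemma corner_inj:
  assumes "corner n u x = corner n u y" "x \<noteq> 0" "y \<noteq> 0" shows "x = y"
proof (cases "n = 3")
  case True
  have "u + y \<in> corner n u x" unfolding assms(1) using True by (simp add: corner_def)
  with assms(2,3) True have y: "y = x \<or> y = x * nu^2"
    by (simp add: corner_def)
  have y2: "u + y * nu^2 \<in> {u, u + x, u + x * nu^2}"
    using assms True by (auto simp: corner_def)
  have "y \<noteq> x * nu^2"
  proof
    assume e: "y = x * nu^2"
    have "u + x * (nu^2 * nu^2) \<in> {u, u + x, u + x * nu^2}" using y2 e by (simp add: mult.assoc)
    then have "nu^2 * nu^2 = 0 \<or> nu^2 * nu^2 = 1 \<or> nu^2 * nu^2 = nu^2" using assms by auto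
    then show False by (simp add: nu_sq complex_eq_iff)
  qed
  with y show ?thesis by auto
next
  case False
  have "u + y \<in> corner n u x" unfolding assms(1) using False by (simp add: corner_def)
  with assms(2,3) False have y: "y = x \<or> y = x * \<i> \<or> y = x * (1 + \<i>)"
    by (simp add: corner_def nu_3)
  have y2: "u + y * \<i> \<in> {u, u + x, u + x * \<i>, u + x * (1 + \<i>)}"
    using assms False by (auto simp: corner_def nu_3)
  have "y \<noteq> x * c" if "c = \<i> \<or> c = 1 + \<i>" for c
  proof
    assume e: "y = x * c"
    have "u + x * (c * \<i>) \<in> {u, u + x * 1, u + x * \<i>, u + x * (1 + \<i>)}" using y2 e by (simp add: mult.assoc)
    then have "c * \<i> = 0 \<or> c * \<i> = 1 \<or> c * \<i> = \<i> \<or> c * \<i> = 1 + \<i>" using assms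
      unfolding insert_iff add_left_cancel mult_left_cancel[OF assms(2)] by auto
    then show False using that by (auto simp: complex_eq_iff)
  qed
  with y show ?thesis by auto
qed

text \<open>The apex lies on the line joining the midpoints of two opposite sides, at relative
  height \<open>sqrt 3 / 2\<close>, below 1. So an equilateral triangle is common to any two tiles
  on the same side of an edge.\<close>

lemma triangle_in_square: "convex hull (corner 3 a x) \<subseteq> convex hull (corner 4 a x)"
proof -
  define C where "C = convex hull (corner 4 a x)"
  have C: "convex C" by (simp add: C_def convex_convex_hull)
  have m: "a \<in> C" "a + x \<in> C" "a + x * \<i> \<in> C" "a + x * (1 + \<i>) \<in> C"
    by (auto simp: C_def corner_def nu_3 intro!: hull_inc)
  let ?s = "sqrt 3 / 2"
  have s: "0 \<le> ?s" "?s \<le> 1" using real_sqrt_le_mono[of 3 4] by auto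
  have 1: "(1 / 2) *\<^sub>R a + (1/2) *\<^sub>R (a + x) \<in> C" "(1 / 2) *\<^sub>R (a + x * \<i>) + (1/2) *\<^sub>R (a + x * (1 + \<i>)) \<in> C"
    using convexD[OF C] m by simp_all
  have "(1 - ?s) *\<^sub>R ((1 / 2) *\<^sub>R a + (1/2) *\<^sub>R (a + x)) + ?s *\<^sub>R ((1 / 2) *\<^sub>R (a + x * \<i>) + (1/2) *\<^sub>R (a + x * (1 + \<i>))) \<in> C"
    using convexD[OF C 1, of "1 - ?s" ?s] s by simp
  also have "(1 - ?s) *\<^sub>R ((1 / 2) *\<^sub>R a + (1/2) *\<^sub>R (a + x)) + ?s *\<^sub>R ((1 / 2) *\<^sub>R (a + x * \<i>) + (1/2) *\<^sub>R (a + x * (1 + \<i>)))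
     = a + x * nu ^ 2"
    by (simp add: nu_sq complex_eq_iff field_simps)
  finally have "corner 3 a x \<subseteq> C" using m by (auto simp: corner_def)
  then have "convex hull (corner 3 a x) \<subseteq> C" using C by (rule hull_minimal)
  then show ?thesis by (simp add: C_def)
qed

text \<open>Three collinear points would make \<open>nu^2\<close> a real ratio.\<close>

lemma triangle_not_segment:
  assumes "x \<noteq> 0" "convex hull (corner 3 a x) \<subseteq> closed_segment p q" shows False
proof -
  have "a \<in> closed_segment p q" "a + x \<in> closed_segment p q" "a + x * nu ^ 2 \<in> closed_segment p q"
    using assms(2) by (auto simp: corner_def intro: hull_inc)
  then obtain r s t where "a = p + of_real r * (q - p)" "a + x = p + of_real s * (q - p)"
      "a + x * nu ^ 2 = p + of_real t * (q - p)"
    unfolding closed_segment_def by (auto simp: scaleR_conv_of_real algebra_simps)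
  then have "a + x - a = of_real s * (q - p) - of_real r * (q - p)"
    "a + x * nu ^ 2 - a = of_real t * (q - p) - of_real r * (q - p)" by (metis add_diff_cancel_left)+
  then have 1: "x = of_real (s - r) * (q - p)" "x * nu^2 = of_real (t - r) * (q - p)"
    by (simp_all add: left_diff_distrib)
  then have qp: "q \<noteq> p" "s \<noteq> r" using assms(1) by auto
  from 1 have "(of_real (s - r) * nu^2) * (q - p) = of_real (t - r) * (q - p)" by (simp add: mult_ac)
  then have "of_real (s - r) * nu^2 = of_real (t - r)" using qp by simp
  then have "Im (of_real (s - r) * nu^2) = 0" by (metis Im_complex_of_real)
  then show False using qp by (simp add: nu_sq)
qed

lemma e2e_tiles:
  assumes "e2e_regular_tiling T"
  shows e2e_regular: "P \<in> T \<Longrightarrow> is_regular_polygon P"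
    and e2e_cover: "(\<Union>P\<in>T. convex hull P) = UNIV"
    and e2e_locally_finite: "compact S \<Longrightarrow> finite {P \<in> T. convex hull P \<inter> S \<noteq> {}}"
  using assms by (simp_all add: e2e_regular_tiling_def)

lemma e2e_cases:
  assumes "e2e_regular_tiling T" "P \<in> T" "Q \<in> T" "P \<noteq> Q"
  obtains "convex hull P \<inter> convex hull Q = {}"
  | v where "v \<in> P" "v \<in> Q" "convex hull P \<inter> convex hull Q = {v}"
  | a b where "poly_edge P {a, b}" "poly_edge Q {a, b}" "convex hull P \<inter> convex hull Q = closed_segment a b"
proof -
  have "\<forall>P\<in>T. \<forall>Q\<in>T. P \<noteq> Q \<longrightarrow>
        interior (convex hull P) \<inter> interior (convex hull Q) = {} \<and>
        (convex hull P \<inter> convex hull Q = {} \<or>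
         (\<exists>v. v \<in> P \<and> v \<in> Q \<and> convex hull P \<inter> convex hull Q = {v}) \<or>
         (\<exists>a b. poly_edge P {a, b} \<and> poly_edge Q {a, b} \<and>
                convex hull P \<inter> convex hull Q = closed_segment a b))"
    using assms(1) unfolding e2e_regular_tiling_def by (elim conjE)
  from this[rule_format, OF assms(2-4)] show ?thesis using that by (elim conjE disjE exE) simp_all
qed

text \<open>Both hulls contain the equilateral triangle on the edge, which does not fit into the
  empty set, a point or a segment, the only intersections allowed for distinct tiles.\<close>

lemma e2e_same_side:
  assumes T: "e2e_regular_tiling T" and P: "corner m a x \<in> T" "corner n a x \<in> T" "x \<noteq> 0"
    and mn: "m = 3 \<or> m = 4" "n = 3 \<or> n = 4"
  shows "corner m a x = corner n a x"
proof (rule ccontr)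
  assume ne: "corner m a x \<noteq> corner n a x"
  then have s: "convex hull (corner 3 a x) \<subseteq> convex hull (corner m a x) \<inter> convex hull (corner n a x)"
    using mn triangle_in_square by auto
  moreover have in3: "a \<in> convex hull (corner 3 a x)" "a + x \<in> convex hull (corner 3 a x)"
    by (auto simp: corner_def intro: hull_inc)
  show False
  proof (rule e2e_cases[OF T P(1,2) ne])
    fix v assume "convex hull (corner m a x) \<inter> convex hull (corner n a x) = {v}"
    with s in3 have "a = v" "a + x = v" by auto
    with P(3) show False by auto
  next
    fix p q assume "convex hull (corner m a x) \<inter> convex hull (corner n a x) = closed_segment p q"
    with s P(3) triangle_not_segment show False by metis
  qed (use s in3 in auto)
qed

lemma regular_polygon_finite: "is_regular_polygon P \<Longrightarrow> finite P \<and> P \<noteq> {}"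
  unfolding is_regular_polygon_def using card_regpoly
  by (metis card.infinite card.empty not_numeral_le_zero)

text \<open>The union may be infinite; closedness comes from local finiteness, as a unit ball meets
  only finitely many hulls.\<close>

lemma closed_Union_tiles:
  assumes T: "e2e_regular_tiling T" and "S \<subseteq> T"
  shows "closed (\<Union>P\<in>S. convex hull P)"
proof -
  have "open (- (\<Union>P\<in>S. convex hull P))"
  proof (rule openI)
    fix x assume x: "x \<in> - (\<Union>P\<in>S. convex hull P)"
    define F where "F = {P \<in> S. convex hull P \<inter> cball x 1 \<noteq> {}}"
    have "finite {P \<in> T. convex hull P \<inter> cball x 1 \<noteq> {}}"
      using e2e_locally_finite[OF T compact_cball] .
    then have F: "finite F" by (rule rev_finite_subset) (use assms in \<open>auto simp: F_def\<close>)
    have "closed (convex hull P)" if "P \<in> F" for P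
    proof -
      have "finite P" using that e2e_regular[OF T] assms regular_polygon_finite unfolding F_def by blast
      then show ?thesis using finite_imp_compact_convex_hull compact_imp_closed by blast
    qed
    then have "closed (\<Union>P\<in>F. convex hull P)" using F by blast
    then have "open (ball x 1 - (\<Union>P\<in>F. convex hull P))" by blast
    moreover have "x \<in> ball x 1 - (\<Union>P\<in>F. convex hull P)" using x by (auto simp: F_def)
    moreover have "ball x 1 - (\<Union>P\<in>F. convex hull P) \<subseteq> - (\<Union>P\<in>S. convex hull P)"
      using ball_subset_cball[of x 1] unfolding F_def by blast
    ultimately show "\<exists>e>0. ball x e \<subseteq> - (\<Union>P\<in>S. convex hull P)"
      by (metis open_contains_ball subset_trans)
  qed
  then show ?thesis by (simp add: closed_def)
qed

text \<open>The propagation principle for tilings. If \<open>S\<close> were proper, the hulls of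
  \<open>S\<close> and of \<open>T - S\<close> would form two nonempty closed sets covering the
  connected plane; a common point yields a common vertex by the edge-to-edge condition.\<close>

lemma tile_connected:
  assumes T: "e2e_regular_tiling T" and S: "S \<subseteq> T" "S \<noteq> {}"
    and step: "\<And>P Q x. P \<in> S \<Longrightarrow> Q \<in> T \<Longrightarrow> x \<in> P \<Longrightarrow> x \<in> Q \<Longrightarrow> Q \<in> S"
  shows "S = T"
proof (rule ccontr)
  assume "S \<noteq> T"
  then have R: "T - S \<noteq> {}" using S by auto
  let ?C = "\<lambda>S. \<Union>P\<in>S. convex hull P"
  have ne: "?C S' \<noteq> {}" if S': "S' \<subseteq> T" "S' \<noteq> {}" for S'
  proof -
    obtain P where "P \<in> S'" using S'(2) by auto
    moreover from this have "P \<noteq> {}" using S'(1) e2e_regular[OF T] regular_polygon_finite by blast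
    ultimately show ?thesis by auto
  qed
  have U: "?C S \<union> ?C (T - S) = UNIV"
  proof -
    have "?C S \<union> ?C (T - S) = ?C T" using S by auto
    then show ?thesis using e2e_cover[OF T] by simp
  qed
  have "?C S \<inter> ?C (T - S) \<noteq> {}"
    using connected_closedD[of "UNIV :: complex set" "?C S" "?C (T - S)"] connected_UNIV
      closed_Union_tiles[OF T] ne[OF S] ne[OF _ R] U S by auto
  then obtain P Q z where PQ: "P \<in> S" "Q \<in> T - S" "z \<in> convex hull P \<inter> convex hull Q" by auto
  then have "P \<in> T" "Q \<in> T" "P \<noteq> Q" using S by auto
  from e2e_cases[OF T this] obtain x where "x \<in> P" "x \<in> Q"
    using PQ by cases (auto dest: poly_edge_subset)
  then show False using step PQ by auto
qed

section \<open>From face-cycles to edge directions\<close>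

definition star :: "complex set set \<Rightarrow> complex \<Rightarrow> complex set set" where
  "star T u = {P \<in> T. u \<in> P}"

text \<open>The reversed list is itself a rotation of \<open>L\<close>, so a face-cycle known up to
  shift and reversal can be re-indexed to read exactly \<open>L\<close>.\<close>

lemma vertex_type_list:
  assumes "has_vertex_type T u L" "rotate j (rev L) = L"
  obtains ts where "distinct ts" "set ts = star T u" "map card ts = L"
    "\<And>i. i < length ts \<Longrightarrow> \<exists>y. poly_edge (ts ! i) {u, y} \<and> poly_edge (ts ! (Suc i mod length ts)) {u, y}"
proof -
  obtain ts k where ts: "distinct ts" "set ts = {P\<in>T. u \<in> P}"
    and e: "\<forall>i < length ts. \<exists>e. u \<in> e \<and> poly_edge (ts ! i) e \<and> poly_edge (ts ! ((Suc i) mod length ts)) e"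
    and k: "map card ts = rotate k L \<or> map card ts = rotate k (rev L)"
    using assms unfolding has_vertex_type_def by blast
  define n where "n = length ts"
  have n: "length L = n" using k unfolding n_def by (metis length_map length_rev length_rotate)
  obtain m where m: "rotate m (map card ts) = L"
  proof (cases "map card ts = rotate k L")
    case True
    \<comment> \<open>\<open>n * k - k\<close> further shifts complete \<open>k\<close> full turns;
      the subtraction of naturals is harmless for \<open>n > 0\<close>.\<close>
    have "rotate (n * k - k) (rotate k L) = rotate (n * k) L"
    proof (cases "n = 0")
      case False
      then have "n * k - k + k = n * k" by (cases n) auto
      then show ?thesis by (simp add: rotate_rotate)
    qed (use n in auto)
    also have "\<dots> = L" using n rotate_id[of "n * k" L] by simp
    finally show ?thesis using True that by metis
  next
    case False
    then have r: "map card ts = rotate k (rev L)" using k by auto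
    have "rotate (j + (n * k - k)) (rotate k (rev L)) = rotate j (rotate (n * k) (rev L))"
    proof (cases "n = 0")
      case False
      then have "j + (n * k - k) + k = j + n * k" by (cases n) auto
      then show ?thesis unfolding rotate_rotate by (simp only:)
    qed (use n in auto)
    also have "\<dots> = L" using n rotate_id[of "n * k" "rev L"] assms(2) by simp
    finally show ?thesis using r that by metis
  qed
  define us where "us = rotate m ts"
  show ?thesis
  proof
    show "distinct us" "set us = star T u" using ts by (auto simp: us_def star_def)
    show "map card us = L" using m by (simp add: us_def rotate_map)
    fix i assume "i < length us"
    then have i: "i < n" by (simp add: us_def n_def)
    then have "n > 0" by auto
    define i' where "i' = (m + i) mod n"
    have i': "i' < n" using \<open>n > 0\<close> by (simp add: i'_def)
    have 1: "us ! i = ts ! i'" using i by (simp add: us_def nth_rotate i'_def n_def)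
    have "us ! (Suc i mod n) = ts ! ((m + Suc i mod n) mod n)"
      using \<open>n > 0\<close> by (simp add: us_def nth_rotate n_def)
    also have "(m + Suc i mod n) mod n = Suc i' mod n"
      by (simp add: i'_def mod_simps)
    finally have 2: "us ! (Suc i mod n) = ts ! (Suc i' mod n)" .
    obtain f where f: "u \<in> f" "poly_edge (ts ! i') f" "poly_edge (ts ! (Suc i' mod n)) f"
      using e i' by (auto simp: n_def)
    then obtain p q where "f = {p, q}" unfolding poly_edge_def by blast
    then obtain y where "f = {u, y}" using f(1) by (auto simp: insert_commute)
    then show "\<exists>y. poly_edge (us ! i) {u, y} \<and> poly_edge (us ! (Suc i mod length us)) {u, y}"
      using f 1 2 by (auto simp: us_def n_def)
  qed
qed

abbreviation (input) "LA \<equiv> [3,3,3,3,3,3::nat]"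
abbreviation (input) "LB \<equiv> [3,3,4,3,4::nat]"

locale tiling =
  fixes T :: "complex set set"
  assumes e2e: "e2e_regular_tiling T"
    and types: "\<forall>u\<in>tvertices T. has_vertex_type T u LA \<or> has_vertex_type T u LB"
begin

lemma tile_reg: "P \<in> T \<Longrightarrow> is_regular_polygon P"
  using e2e e2e_regular by blast

lemma tile_finite: "P \<in> T \<Longrightarrow> finite P" and tile_nonempty: "P \<in> T \<Longrightarrow> P \<noteq> {}"
  using tile_reg regular_polygon_finite by blast+

lemma in_tverticesI: "P \<in> T \<Longrightarrow> u \<in> P \<Longrightarrow> u \<in> tvertices T"
  by (auto simp: tvertices_def)

lemma vertex_list:
  assumes "u \<in> tvertices T"
  obtains ts L where "L = LA \<or> L = LB" "has_vertex_type T u L" "distinct ts" "set ts = star T u" "map card ts = L"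
    "\<And>i. i < length ts \<Longrightarrow> \<exists>y. poly_edge (ts ! i) {u, y} \<and> poly_edge (ts ! (Suc i mod length ts)) {u, y}"
proof -
  have A: "rotate 0 (rev LA) = LA" by simp
  have B: "rotate 3 (rev LB) = LB" by (simp add: numeral_3_eq_3)
  from assms types consider "has_vertex_type T u LA" | "has_vertex_type T u LB" by auto
  then show ?thesis
  proof cases
    case 1
    show ?thesis by (rule vertex_type_list[OF 1 A]) (rule that[OF disjI1[OF refl] 1])
  next
    case 2
    show ?thesis by (rule vertex_type_list[OF 2 B]) (rule that[OF disjI2[OF refl] 2])
  qed
qed

lemma card_tile: assumes "P \<in> T" shows "card P = 3 \<or> card P = 4"
proof -
  obtain u where u: "u \<in> P" using assms tile_nonempty by blast
  then obtain ts L where L: "L = LA \<or> L = LB" "set ts = star T u" "map card ts = L"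
    using vertex_list[OF in_tverticesI[OF assms u]] by metis
  have "P \<in> set ts" using L u assms by (auto simp: star_def)
  then have "card P \<in> set L" using L(3) by (metis image_eqI list.set_map)
  then show ?thesis using L(1) by auto
qed

text \<open>Lying on the same side would make the tiles equal, by
  \<open>e2e_same_side\<close>.\<close>

lemma edge_sides:
  assumes "P \<in> T" "Q \<in> T" "P \<noteq> Q" "poly_edge P {a, b}" "poly_edge Q {a, b}"
  shows "P = corner (card P) a (b - a) \<and> Q = corner (card Q) b (a - b) \<or>
         P = corner (card P) b (a - b) \<and> Q = corner (card Q) a (b - a)"
proof -
  note eP = edge_corner[OF assms(4) refl card_tile[OF assms(1)]]
  note eQ = edge_corner[OF assms(5) refl card_tile[OF assms(2)]]
  have "a - b \<noteq> 0" "b - a \<noteq> 0" using eP by auto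
  then show ?thesis using eP eQ e2e_same_side[OF e2e, of "card P" _ _ "card Q"] card_tile assms by metis
qed

text \<open>Pigeonhole: an edge has two sides, and each carries at most one tile.\<close>

lemma not_three_on_edge:
  assumes "P \<in> T" "Q \<in> T" "R \<in> T" "P \<noteq> Q" "Q \<noteq> R" "P \<noteq> R"
    "poly_edge P {a, b}" "poly_edge Q {a, b}" "poly_edge R {a, b}"
  shows False
proof -
  have "a \<noteq> b" using edge_corner[OF assms(7) refl card_tile[OF assms(1)]] by auto
  then have "a - b \<noteq> 0" "b - a \<noteq> 0" by auto
  then show False
    using edge_sides[of P Q a b] edge_sides[of Q R a b] edge_sides[of P R a b] assms card_tile
      e2e_same_side[OF e2e, of "card P" _ _ "card R"] e2e_same_side[OF e2e, of "card Q" _ _ "card R"]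
       e2e_same_side[OF e2e, of "card P" _ _ "card Q"]
    by metis
qed

text \<open>One step counterclockwise round \<open>u\<close>: \<open>P\<close> starts with the edge
  to \<open>u + x\<close>, so a different shared edge must be its other edge at \<open>u\<close>,
  and \<open>Q\<close> lies beyond it.\<close>

lemma ccw_step:
  assumes "P \<in> T" "Q \<in> T" "P \<noteq> Q" "x \<noteq> 0" "P = corner (card P) u x" "poly_edge P {u, y}" "poly_edge Q {u, y}" "y \<noteq> u + x"
  shows "y = u + x * rot (card P)" "Q = corner (card Q) u (y - u)"
proof -
  note eP = edge_corner[OF assms(6) refl card_tile[OF assms(1)]]
  have 1: "P \<noteq> corner (card P) u (y - u)"
  proof
    assume "P = corner (card P) u (y - u)"
    then have "x = y - u" using corner_inj[of "card P" u x "y - u"] assms(4,5) eP(1) by auto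
    then show False using assms(8) by auto
  qed
  then have 2: "P = corner (card P) y (u - y)" using eP by auto
  then have "P = corner (card P) u ((y - u) / rot (card P))"
    using corner_flip'[of "card P" u "y - u"] by simp
  then have "x = (y - u) / rot (card P)"
    using corner_inj[of "card P" u x "(y - u) / rot (card P)"] assms(4,5) eP(1) rot_neq_0 by auto
  then show "y = u + x * rot (card P)" using rot_neq_0 by simp
  show "Q = corner (card Q) u (y - u)" using edge_sides[OF assms(1-3,6,7)] 1 by blast
qed

text \<open>Mirror image of \<open>ccw_step\<close>: \<open>P\<close> is on the right of the edge to
  \<open>u + x\<close>, and the walk turns clockwise, dividing by \<open>rot\<close>.\<close>

lemma cw_step:
  assumes "P \<in> T" "Q \<in> T" "P \<noteq> Q" "x \<noteq> 0" "P = corner (card P) (u + x) (-x)" "poly_edge P {u, y}" "poly_edge Q {u, y}" "y \<noteq> u + x"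
  shows "y = u + x / rot (card P)" "Q = corner (card Q) y (u - y)"
proof -
  note eP = edge_corner[OF assms(6) refl card_tile[OF assms(1)]]
  have P: "P = corner (card P) u (x / rot (card P))" using corner_flip' assms(5) by metis
  have 1: "P \<noteq> corner (card P) y (u - y)"
  proof
    assume "P = corner (card P) y (u - y)"
    then have "P = corner (card P) u ((y - u) / rot (card P))"
      using corner_flip'[of "card P" u "y - u"] by simp
    then have "x / rot (card P) = (y - u) / rot (card P)" 
      using corner_inj[of "card P" u "x / rot (card P)" "(y - u) / rot (card P)"] P assms(4) eP(1) rot_neq_0 by auto
    then show False using assms(8) rot_neq_0 by simp
  qed
  then have 2: "P = corner (card P) u (y - u)" using eP by auto
  then have "x / rot (card P) = y - u"
    using corner_inj[of "card P" u "x / rot (card P)" "y - u"] P assms(4,5) eP(1) rot_neq_0 by auto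
  then show "y = u + x / rot (card P)" by simp
  show "Q = corner (card Q) y (u - y)" using edge_sides[OF assms(1-3,6,7)] 1 by blast
qed

text \<open>Turn from the edge shared by tiles 0 and 1 to the edge shared by tiles \<open>i\<close>
  and \<open>Suc i\<close>. The tiles passed are 1 to \<open>i\<close>, hence the index
  \<open>Suc j\<close>.\<close>

definition turn :: "nat list \<Rightarrow> nat \<Rightarrow> complex" where
  "turn L i = (\<Prod>j<i. rot (L ! Suc j))"

lemma turn_neq_0: "turn L i \<noteq> 0" using rot_neq_0 by (simp add: turn_def)

text \<open>Successive tiles around a vertex lie on opposite sides of their common edge, so the edge
  directions keep turning in the sense fixed by the first two tiles.\<close>
lemma vertex_directions:
  assumes ts: "distinct ts" "set ts = star T u" "map card ts = L" "length L \<ge> 3"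
    and e: "\<And>i. i < length ts \<Longrightarrow> \<exists>y. poly_edge (ts ! i) {u, y} \<and> poly_edge (ts ! (Suc i mod length ts)) {u, y}"
  obtains x where "x \<noteq> 0"
    "ts ! 0 = corner (L ! 0) (u + x) (- x)" "\<And>i. Suc i < length L \<Longrightarrow> ts ! Suc i = corner (L ! Suc i) u (x * turn L i)"
  | x where "x \<noteq> 0"
    "ts ! 0 = corner (L ! 0) u x"
    "\<And>i. Suc i < length L \<Longrightarrow> ts ! Suc i = corner (L ! Suc i) (u + x / turn L i) (- (x / turn L i))"
proof -
  have len: "length ts = length L" using ts(3) by auto
  have inT: "ts ! i \<in> T" if "i < length L" for i
    using that ts(2) len by (metis (no_types, lifting) mem_Collect_eq nth_mem star_def)
  have cd: "card (ts ! i) = L ! i" if "i < length L" for i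
    using that ts(3) len by (metis nth_map)
  have ne: "ts ! i \<noteq> ts ! j" if "i < length L" "j < length L" "i \<noteq> j" for i j
    using ts(1) that len by (simp add: nth_eq_iff_index_eq)
  have "\<forall>i. \<exists>y. Suc i < length L \<longrightarrow> poly_edge (ts ! i) {u, y} \<and> poly_edge (ts ! Suc i) {u, y}"
    using e len by (metis Suc_lessD mod_less)
  then obtain y where y: "\<And>i. Suc i < length L \<Longrightarrow> poly_edge (ts ! i) {u, y i} \<and> poly_edge (ts ! Suc i) {u, y i}"
    by metis
  \<comment> \<open>Otherwise three distinct tiles would share one edge. The walk round
    \<open>u\<close> therefore never turns back.\<close>
  have yne: "y (Suc i) \<noteq> y i" if "Suc (Suc i) < length L" for i
  proof
    assume "y (Suc i) = y i"
    then show False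
      using not_three_on_edge[of "ts ! i" "ts ! Suc i" "ts ! Suc (Suc i)" u "y i"] y[of i] y[of "Suc i"] that
        inT ne by auto
  qed
  define x where "x = y 0 - u"
  have l01: "0 < length L" "1 < length L" using ts(4) by auto
  have 01: "ts ! 0 \<in> T" "ts ! 1 \<in> T" "ts ! 0 \<noteq> ts ! 1" "poly_edge (ts ! 0) {u, y 0}" "poly_edge (ts ! 1) {u, y 0}"
    using inT[OF l01(1)] inT[OF l01(2)] ne[OF l01] y[of 0] l01 by auto
  have x0: "x \<noteq> 0" using edge_corner(1)[OF 01(4) refl card_tile[OF 01(1)]] by (auto simp: x_def)
  \<comment> \<open>Which of the first two tiles lies to the left of their common edge decides the
    sense of the face-cycle: clockwise in the first case, counterclockwise in the second.\<close>
  from edge_sides[OF 01] show ?thesis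
  proof
    assume A: "ts ! 0 = corner (card (ts ! 0)) u (y 0 - u) \<and> ts ! 1 = corner (card (ts ! 1)) (y 0) (u - y 0)"
    have "ts ! Suc i = corner (L ! Suc i) (u + x / turn L i) (- (x / turn L i)) \<and> y i = u + x / turn L i"
      if "Suc i < length L" for i
      using that
    proof (induction i)
      case 0
      then show ?case using A cd by (simp add: turn_def x_def)
    next
      case (Suc i)
      have "ts ! Suc i = corner (L ! Suc i) (u + x / turn L i) (- (x / turn L i))" "y i = u + x / turn L i"
        using Suc by auto
      then have "y (Suc i) = u + x / turn L i / rot (card (ts ! Suc i)) \<and> 
         ts ! Suc (Suc i) = corner (card (ts ! Suc (Suc i))) (y (Suc i)) (u - y (Suc i))"
      proof -
        have i: "Suc i < length L" "Suc (Suc i) < length L" "Suc i \<noteq> Suc (Suc i)" using Suc.prems by auto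
        have c: "ts ! Suc i = corner (card (ts ! Suc i)) (u + x / turn L i) (- (x / turn L i))"
          using cd[OF i(1)] \<open>ts ! Suc i = _\<close> by simp
        have nz: "x / turn L i \<noteq> 0" using x0 turn_neq_0 by simp
        have n: "y (Suc i) \<noteq> u + x / turn L i" using yne[OF i(2)] \<open>y i = _\<close> by simp
        show ?thesis
          using cw_step[OF inT[OF i(1)] inT[OF i(2)] ne[OF i] nz c y[OF i(2), THEN conjunct1] y[OF i(2), THEN conjunct2] n]
          by blast
      qed
      then show ?case using Suc.prems cd by (simp add: turn_def)
    qed
    moreover have "ts ! 0 = corner (L ! 0) u x"
      using conjunct1[OF A] unfolding cd[OF l01(1)] x_def .
    ultimately show ?thesis using that(2)[of x] x0 by blast
  next
    assume A: "ts ! 0 = corner (card (ts ! 0)) (y 0) (u - y 0) \<and> ts ! 1 = corner (card (ts ! 1)) u (y 0 - u)"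
    have "ts ! Suc i = corner (L ! Suc i) u (x * turn L i) \<and> y i = u + x * turn L i"
      if "Suc i < length L" for i
      using that
    proof (induction i)
      case 0
      then show ?case using A cd by (simp add: turn_def x_def)
    next
      case (Suc i)
      have "ts ! Suc i = corner (L ! Suc i) u (x * turn L i)" "y i = u + x * turn L i"
        using Suc by auto
      then have "y (Suc i) = u + x * turn L i * rot (card (ts ! Suc i)) \<and> 
         ts ! Suc (Suc i) = corner (card (ts ! Suc (Suc i))) u (y (Suc i) - u)"
      proof -
        have i: "Suc i < length L" "Suc (Suc i) < length L" "Suc i \<noteq> Suc (Suc i)" using Suc.prems by auto
        have c: "ts ! Suc i = corner (card (ts ! Suc i)) u (x * turn L i)"
          using cd[OF i(1)] \<open>ts ! Suc i = _\<close> by simp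
        have nz: "x * turn L i \<noteq> 0" using x0 turn_neq_0 by simp
        have n: "y (Suc i) \<noteq> u + x * turn L i" using yne[OF i(2)] \<open>y i = _\<close> by simp
        show ?thesis
          using ccw_step[OF inT[OF i(1)] inT[OF i(2)] ne[OF i] nz c y[OF i(2), THEN conjunct1] y[OF i(2), THEN conjunct2] n]
          by blast
      qed
      then show ?case using Suc.prems cd by (simp add: turn_def mult_ac)
    qed
    moreover have "ts ! 0 = corner (L ! 0) (u + x) (- x)"
      using conjunct1[OF A] unfolding cd[OF l01(1)] x_def by (simp only: add_diff_eq add_diff_cancel_left' minus_diff_eq)
    ultimately show ?thesis using that(1)[of x] x0 by blast
  qed
qed

end

subsection \<open>The two kinds of vertices\<close>


lemma nu_high:
  "nu ^ 13 = nu" "nu ^ 14 = nu ^ 2" "nu ^ 15 = nu ^ 3" "nu ^ 16 = nu ^ 4" "nu ^ 17 = nu ^ 5" 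
  "nu ^ 18 = nu ^ 6" "nu ^ 19 = nu ^ 7" "nu ^ 20 = nu ^ 8" "nu ^ 21 = nu ^ 9" "nu ^ 22 = nu ^ 10"
  using power_add[of nu 12 1] power_add[of nu 12 2] power_add[of nu 12 3] power_add[of nu 12 4]
    power_add[of nu 12 5] power_add[of nu 12 6] power_add[of nu 12 7] power_add[of nu 12 8]
    power_add[of nu 12 9] power_add[of nu 12 10]
  by (simp_all add: nu_12)

lemma nu_power_12: "nu ^ (12 * k) = 1"
  by (simp add: power_mult nu_12)

lemma nu_div: "j \<le> 12 \<Longrightarrow> x / nu ^ j = x * nu ^ (12 - j)"
  using nu_neq_0 by (simp add: divide_eq_eq nu_12 mult.assoc flip: power_add)

lemma nu_mult: "x * nu ^ a * nu ^ b = x * nu ^ (a + b)" "x * nu ^ a * nu = x * nu ^ (a + 1)"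
  by (simp_all add: power_add)

lemma card_corner: assumes "x \<noteq> 0" "n = 3 \<or> n = 4" shows "card (corner n u x) = n"
proof (cases "n = 3")
  case True
  have "nu ^ 2 \<noteq> 1" by (simp add: nu_sq complex_eq_iff)
  then show ?thesis using True assms nu_neq_0 by (simp add: corner_def)
next
  case False
  have "1 + \<i> \<noteq> 0" "1 + \<i> \<noteq> 1" "1 + \<i> \<noteq> \<i>" "\<i> \<noteq> 1" by (simp_all add: complex_eq_iff)
  then show ?thesis using False assms by (simp add: corner_def nu_3)
qed

definition starA :: "complex \<Rightarrow> complex \<Rightarrow> complex set set" where
  "starA u d = {corner 3 u d, corner 3 u (d * nu^2), corner 3 u (d * nu^4), corner 3 u (d * nu^6),
     corner 3 u (d * nu^8), corner 3 u (d * nu^10)}"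

text \<open>Here d is the direction of the edge between the two consecutive triangles; the tiles around u
  start in the directions d, d cis 60, d cis 150, d cis 210 and d cis 300 (in degrees).\<close>
definition starB :: "complex \<Rightarrow> complex \<Rightarrow> complex set set" where
  "starB u d = {corner 3 u d, corner 3 u (d * nu^10), corner 4 u (d * nu^2), corner 3 u (d * nu^5),
     corner 4 u (d * nu^7)}"

lemma starA_rotate1: "starA u (d * nu ^ 2) = starA u d"
  by (simp add: starA_def nu_mult nu_12 insert_commute)

lemma starA_rotate: "starA u (d * nu ^ (2 * k)) = starA u d"
proof (induction k)
  case (Suc k)
  have "d * nu ^ (2 * Suc k) = d * nu ^ (2 * k) * nu ^ 2" by (simp add: nu_mult)
  then show ?case using Suc starA_rotate1 by metis
qed simp

context tiling begin

lemma star_A: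
  assumes "has_vertex_type T u LA"
  shows "card (star T u) = 6" "\<exists>d. d \<noteq> 0 \<and> star T u = starA u d"
proof -
  have A: "rotate 0 (rev LA) = LA" by simp
  have "card (star T u) = 6 \<and> (\<exists>d. d \<noteq> 0 \<and> star T u = starA u d)"
  proof (rule vertex_type_list[OF assms A])
    fix ts assume ts: "distinct ts" "set ts = star T u" "map card ts = LA"
      and e: "\<And>i. i < length ts \<Longrightarrow> \<exists>y. poly_edge (ts ! i) {u, y} \<and> poly_edge (ts ! (Suc i mod length ts)) {u, y}"
    obtain a b c d f g where abc: "ts = [a, b, c, d, f, g]" using ts(3) by (auto simp: map_eq_Cons_conv)
    have c6: "card (star T u) = 6" unfolding ts(2)[symmetric] using ts(1) by (simp add: abc)
    have s: "star T u = {a,b,c,d,f,g}" using ts(2) abc by auto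
    have tn: "turn LA 0 = 1" "turn LA 1 = nu^2" "turn LA 2 = nu^4" "turn LA 3 = nu^6" "turn LA 4 = nu^8"
      by (simp_all add: turn_def rot_def lessThan_Suc eval_nat_numeral(3) numeral_eq_Suc)
    have l6: "length LA \<ge> 3" by simp
    show "card (star T u) = 6 \<and> (\<exists>d. d \<noteq> 0 \<and> star T u = starA u d)"
    proof (rule vertex_directions[OF ts l6 e])
      fix x assume x: "x \<noteq> 0" "ts ! 0 = corner (LA ! 0) (u + x) (- x)"
        "\<And>i. Suc i < length LA \<Longrightarrow> ts ! Suc i = corner (LA ! Suc i) u (x * turn LA i)"
      \<comment> \<open>Tile 0 lies to the right of the reference edge, so its own direction is
        \<open>x / nu^2\<close>, which is \<open>x * nu^10\<close>.\<close>
      have "a = corner 3 u (x * nu^10)" using x(2) abc corner_flip'[of 3 u x] nu_div[of 2 x] by (simp add: rot_def)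
      moreover have "b = corner 3 u x" "c = corner 3 u (x * nu^2)" "d = corner 3 u (x * nu^4)"
        "f = corner 3 u (x * nu^6)" "g = corner 3 u (x * nu^8)"
        using x(3)[of 0] x(3)[of 1] x(3)[of 2] x(3)[of 3] x(3)[of 4] abc tn by simp_all
      ultimately have "star T u = starA u x" using s by (simp add: starA_def insert_commute)
      then show ?thesis using x(1) c6 by blast
    next
      fix x assume x: "x \<noteq> 0" "ts ! 0 = corner (LA ! 0) u x"
        "\<And>i. Suc i < length LA \<Longrightarrow> ts ! Suc i = corner (LA ! Suc i) (u + x / turn LA i) (- (x / turn LA i))"
      have "a = corner 3 u x" using x(2) abc by simp
      moreover have "b = corner 3 u (x * nu^10)" "c = corner 3 u (x * nu^8)" "d = corner 3 u (x * nu^6)"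
        "f = corner 3 u (x * nu^4)" "g = corner 3 u (x * nu^2)"
        using x(3)[of 0] x(3)[of 1] x(3)[of 2] x(3)[of 3] x(3)[of 4] abc tn
        by (simp_all flip: corner_flip') (simp_all add: rot_def nu_div nu_mult nu_high nu_12)
      ultimately have "star T u = starA u x" using s by (simp add: starA_def insert_commute)
      then show ?thesis using x(1) c6 by blast
    qed simp_all
  qed
  then show "card (star T u) = 6" "\<exists>d. d \<noteq> 0 \<and> star T u = starA u d" by auto
qed

text \<open>The reference edge of \<open>vertex_directions\<close> separates tiles 0 and 1, the two
  consecutive triangles. The configuration has this edge as mirror axis, so both senses of the
  face-cycle give the same \<open>starB\<close>.\<close>

lemma star_B:
  assumes "has_vertex_type T u LB"
  shows "card (star T u) = 5" "\<exists>d. d \<noteq> 0 \<and> star T u = starB u d"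
proof -
  have A: "rotate 3 (rev LB) = LB" by (simp add: numeral_3_eq_3)
  have "card (star T u) = 5 \<and> (\<exists>d. d \<noteq> 0 \<and> star T u = starB u d)"
  proof (rule vertex_type_list[OF assms A])
    fix ts assume ts: "distinct ts" "set ts = star T u" "map card ts = LB"
      and e: "\<And>i. i < length ts \<Longrightarrow> \<exists>y. poly_edge (ts ! i) {u, y} \<and> poly_edge (ts ! (Suc i mod length ts)) {u, y}"
    obtain a b c d f where abc: "ts = [a, b, c, d, f]" using ts(3) by (auto simp: map_eq_Cons_conv)
    have c5: "card (star T u) = 5" unfolding ts(2)[symmetric] using ts(1) by (simp add: abc)
    have s: "star T u = {a,b,c,d,f}" using ts(2) abc by auto
    have tn: "turn LB 0 = 1" "turn LB 1 = nu^2" "turn LB 2 = nu^5" "turn LB 3 = nu^7"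
      by (simp_all add: turn_def rot_def lessThan_Suc eval_nat_numeral(3) numeral_eq_Suc)
    have l5: "length LB \<ge> 3" by simp
    show "card (star T u) = 5 \<and> (\<exists>d. d \<noteq> 0 \<and> star T u = starB u d)"
    proof (rule vertex_directions[OF ts l5 e])
      fix x assume x: "x \<noteq> 0" "ts ! 0 = corner (LB ! 0) (u + x) (- x)"
        "\<And>i. Suc i < length LB \<Longrightarrow> ts ! Suc i = corner (LB ! Suc i) u (x * turn LB i)"
      have "a = corner 3 u (x * nu^10)" using x(2) abc corner_flip'[of 3 u x] nu_div[of 2 x] by (simp add: rot_def)
      moreover have "b = corner 3 u x" "c = corner 4 u (x * nu^2)" "d = corner 3 u (x * nu^5)"
        "f = corner 4 u (x * nu^7)"
        using x(3)[of 0] x(3)[of 1] x(3)[of 2] x(3)[of 3] abc tn by simp_all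
      ultimately have "star T u = starB u x" using s by (simp add: starB_def insert_commute)
      then show ?thesis using x(1) c5 by blast
    next
      fix x assume x: "x \<noteq> 0" "ts ! 0 = corner (LB ! 0) u x"
        "\<And>i. Suc i < length LB \<Longrightarrow> ts ! Suc i = corner (LB ! Suc i) (u + x / turn LB i) (- (x / turn LB i))"
      have "a = corner 3 u x" using x(2) abc by simp
      moreover have "b = corner 3 u (x * nu^10)" "c = corner 4 u (x * nu^7)" "d = corner 3 u (x * nu^5)"
        "f = corner 4 u (x * nu^2)"
        using x(3)[of 0] x(3)[of 1] x(3)[of 2] x(3)[of 3] abc tn
        by (simp_all flip: corner_flip') (simp_all add: rot_def nu_div nu_mult nu_high nu_12)
      ultimately have "star T u = starB u x" using s by (simp add: starB_def insert_commute)
      then show ?thesis using x(1) c5 by blast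
    qed simp_all
  qed
  then show "card (star T u) = 5" "\<exists>d. d \<noteq> 0 \<and> star T u = starB u d" by auto
qed

text \<open>For an A vertex \<open>d\<close> may be any of the six edge vectors (see
  \<open>vA_rotate\<close>); for a B vertex it is the distinguished edge between the two consecutive
  triangles.\<close>

definition vA :: "complex \<Rightarrow> complex \<Rightarrow> bool" where
  "vA u d \<longleftrightarrow> d \<noteq> 0 \<and> has_vertex_type T u LA \<and> star T u = starA u d"

definition vB :: "complex \<Rightarrow> complex \<Rightarrow> bool" where
  "vB u d \<longleftrightarrow> d \<noteq> 0 \<and> has_vertex_type T u LB \<and> star T u = starB u d"

lemma vertex_cases:
  assumes "u \<in> tvertices T" obtains d where "vA u d" | d where "vB u d"
  using assms types star_A(2) star_B(2) unfolding vA_def vB_def by metis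

lemma vA_not_vB: "vA u d \<Longrightarrow> vB u e \<Longrightarrow> False"
  using star_A(1) star_B(1) unfolding vA_def vB_def by force

lemma vA_card: "vA u d \<Longrightarrow> card (star T u) = 6" and vB_card: "vB u d \<Longrightarrow> card (star T u) = 5"
  using star_A(1) star_B(1) unfolding vA_def vB_def by blast+

lemma vA_vertex: "vA u d \<Longrightarrow> u \<in> tvertices T" and vB_vertex: "vB u d \<Longrightarrow> u \<in> tvertices T"
  by (auto simp: vA_def vB_def has_vertex_type_def)

lemma vA_card3: assumes "vA u d" "P \<in> T" "u \<in> P" shows "card P = 3"
proof -
  have "P \<in> starA u d" using assms unfolding vA_def star_def by blast
  then show ?thesis using assms(1) nu_neq_0 by (auto simp: starA_def vA_def card_corner)
qed

lemma vA_rotate: "vA u d \<Longrightarrow> vA u (d * nu ^ (2 * k))"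
  using nu_neq_0 starA_rotate unfolding vA_def by simp

lemma vB_tiles: "vB u d \<Longrightarrow> P \<in> starB u d \<Longrightarrow> P \<in> T" and vA_tiles: "vA u d \<Longrightarrow> P \<in> starA u d \<Longrightarrow> P \<in> T"
  unfolding vA_def vB_def star_def by blast+

text \<open>The only edge at a vertex of type B which is not on a square is the one between the two
  consecutive triangles.\<close>
lemma A_neighbour_direction:
  assumes B: "vB w d" and A: "vA v e" and P: "P \<in> T" "v \<in> P" "w \<in> P"
  shows "v = w + d"
proof -
  have d: "d \<noteq> 0" using B by (simp add: vB_def)
  have "v \<noteq> w" using vA_not_vB A B by blast
  have no_square: False if "v \<in> corner 4 w x" "x \<noteq> 0" "corner 4 w x \<in> starB w d" for x
    using vA_card3[OF A vB_tiles[OF B that(3)] that(1)] card_corner[of x 4 w] that(2) by simp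
  have sq: "corner 4 w (d * nu ^ 2) \<in> starB w d" "corner 4 w (d * nu ^ 7) \<in> starB w d"
    by (auto simp: starB_def)
  have n: "v \<notin> corner 4 w (d * nu ^ 2)" "v \<notin> corner 4 w (d * nu ^ 7)"
    using no_square[OF _ _ sq(1)] no_square[OF _ _ sq(2)] d nu_neq_0 by auto
  have "P \<in> starB w d" using B P unfolding vB_def star_def by blast
  with n P have "v \<in> corner 3 w d \<union> corner 3 w (d * nu^10) \<union> corner 3 w (d * nu^5)"
    unfolding starB_def by auto
  with n \<open>v \<noteq> w\<close> show ?thesis
    by (auto simp: corner_def nu_mult nu_12)
qed

lemma square_not_A: "vA v d \<Longrightarrow> v \<in> corner 4 w x \<Longrightarrow> corner 4 w x \<in> T \<Longrightarrow> x \<noteq> 0 \<Longrightarrow> False"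
  using vA_card3[of v d "corner 4 w x"] card_corner[of x 4 w] by simp

lemma in_corner: "u \<in> corner n u x" "u + x \<in> corner n u x" "u + x * nu^2 \<in> corner 3 u x" "u + x * nu^3 \<in> corner 4 u x"
  "u + x * (1 + nu^3) \<in> corner 4 u x"
  by (auto simp: corner_def)

text \<open>The next hexagon vertex clockwise lies on a square at \<open>v + d\<close>, hence is of
  type B; it also lies on a triangle with \<open>v\<close>, so its distinguished edge points to
  \<open>v\<close>.\<close>

lemma hexagon_step:
  assumes A: "vA v d" and B: "vB (v + d) (-d)"
  shows "vB (v + d * nu^10) (- (d * nu^10))"
proof -
  have d: "d \<noteq> 0" using A by (simp add: vA_def)
  define w where "w = v + d * nu^10"
  have w: "w = (v + d) + (-d) * nu^2" by (simp add: w_def nu_10 algebra_simps)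
  have S: "corner 4 (v + d) (-d * nu^2) \<in> T" by (rule vB_tiles[OF B]) (simp add: starB_def)
  have wS: "w \<in> corner 4 (v + d) (-d * nu^2)" unfolding w by (rule in_corner)
  have nz: "- d * nu^2 \<noteq> 0" using d nu_neq_0 by simp
  obtain e where e: "vB w e"
    using vertex_cases[OF in_tverticesI[OF S wS]] square_not_A[OF _ wS S nz] by blast
  have "corner 3 v (d * nu^10) \<in> T" by (rule vA_tiles[OF A]) (simp add: starA_def)
  then have "v = w + e" using A_neighbour_direction[OF e A] in_corner unfolding w_def by blast
  then have "e = - (d * nu^10)" by (simp add: w_def add.assoc) (simp add: add_eq_0_iff)
  then show ?thesis using e by (simp add: w_def)
qed

text \<open>Going round clockwise from a single B neighbour reaches all six.\<close>

lemma hexagon_all: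
  assumes A: "vA v d" and B: "vB w e" and P: "P \<in> T" "v \<in> P" "w \<in> P"
  shows "vB (v + d * nu^(2 * k)) (- (d * nu^(2 * k)))"
proof -
  have vw: "v \<noteq> w" using vA_not_vB A B by blast
  have "P \<in> starA v d" using A P unfolding vA_def star_def by blast
  with P(3) vw have wd: "w \<in> {v + d, v + d * nu^2, v + d * nu^4, v + d * nu^6, v + d * nu^8, v + d * nu^10}"
    by (auto simp: starA_def corner_def nu_mult nu_12)
  then obtain j where j: "w = v + d * nu ^ (2 * j)"
  proof -
    have "w = v + d * nu ^ (2 * 0) \<or> w = v + d * nu ^ (2 * 1) \<or> w = v + d * nu ^ (2 * 2) \<or> w = v + d * nu ^ (2 * 3)
      \<or> w = v + d * nu ^ (2 * 4) \<or> w = v + d * nu ^ (2 * 5)"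
      using wd by simp
    then show ?thesis using that by blast
  qed
  have "v = w + e" using A_neighbour_direction[OF B A P] .
  then have e: "e = - (d * nu ^ (2 * j))" using j by (simp add: add.assoc) (simp add: add_eq_0_iff)
  have all: "vB (v + d * nu^(2 * (j + 5 * m))) (- (d * nu^(2 * (j + 5 * m))))" for m
  proof (induction m)
    case 0 then show ?case using B j e by simp
  next
    case (Suc m)
    have "d * nu^(2 * (j + 5 * Suc m)) = d * nu ^ (2 * (j + 5 * m)) * nu^10"
      unfolding nu_mult by (simp add: algebra_simps)
    then show ?case using hexagon_step[OF vA_rotate[OF A] Suc] by (simp only:)
  qed
  \<comment> \<open>Each step multiplies by \<open>nu^10\<close>, the inverse of
    \<open>nu^2\<close>. Since \<open>j - (5 * k + j)\<close> is \<open>k\<close> modulo 6,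
    \<open>5 * k + j\<close> steps lead from position \<open>j\<close> to position
    \<open>k\<close>.\<close>
  have "2 * (j + 5 * (5 * k + j)) = 12 * (j + 4 * k) + 2 * k" by simp
  then have "nu ^ (2 * (j + 5 * (5 * k + j))) = nu ^ (2 * k)"
    by (simp only: power_add nu_power_12 mult_1)
  then show ?thesis using all[of "5 * k + j"] by simp
qed

end

text \<open>d * tau leads from the centre of a hexagon with edge vector d to the centre of a neighbouring one:
  d to the boundary, d * nu across the square, d * nu^2 to the next centre.\<close>
definition tau :: complex where "tau = 1 + nu + nu^2"

lemma corner4_rotate: "corner 4 u x = corner 4 (u + x) (x * nu^3)"
proof -
  have "u + x + x * \<i> * \<i> = u" "u + x + x * \<i> * (1 + \<i>) = u + x * \<i>" "u + x * (1 + \<i>) = u + x + x * \<i>"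
    by (simp_all add: algebra_simps)
  then show ?thesis by (auto simp: corner_def nu_3)
qed

section \<open>Use of the two symmetry orbits\<close>

locale two_uniform = tiling +
  assumes two_orbits: "card (sym_vertex_orbits T) = 2"
    and exA: "\<exists>u. has_vertex_type T u LA" and exB: "\<exists>u. has_vertex_type T u LB"
begin

lemma sym_star:
  assumes "tiling_symmetry T f" shows "star T (f u) = (\<lambda>P. f ` P) ` star T u"
proof -
  have i: "inj f" using assms unfolding tiling_symmetry_def inj_def by (metis dist_eq_0_iff)
  have T: "(\<lambda>P. f ` P) ` T = T" using assms by (simp add: tiling_symmetry_def)
  show ?thesis
  proof
    show "star T (f u) \<subseteq> (\<lambda>P. f ` P) ` star T u"
    proof
      fix Q assume "Q \<in> star T (f u)"
      then obtain P where "P \<in> T" "Q = f ` P" "f u \<in> f ` P" using T unfolding star_def by blast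
      then show "Q \<in> (\<lambda>P. f ` P) ` star T u" using i by (auto simp: star_def inj_image_mem_iff)
    qed
    show "(\<lambda>P. f ` P) ` star T u \<subseteq> star T (f u)" using T by (auto simp: star_def)
  qed
qed

lemma sym_card_star:
  assumes "tiling_symmetry T f" shows "card (star T (f u)) = card (star T u)"
proof -
  have i: "inj f" using assms unfolding tiling_symmetry_def inj_def by (metis dist_eq_0_iff)
  then have "inj_on (\<lambda>P. f ` P) (star T u)" by (auto intro!: inj_onI simp: inj_image_eq_iff)
  then show ?thesis using sym_star[OF assms] by (simp add: card_image)
qed

lemma sym_tile: "tiling_symmetry T f \<Longrightarrow> P \<in> T \<Longrightarrow> f ` P \<in> T"
  by (auto simp: tiling_symmetry_def)

text \<open>The number of tiles at a vertex is constant on symmetry orbits, so the orbit of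
  \<open>w\<close> differs from those of \<open>u\<close> and \<open>v\<close>. With two orbits in
  all, \<open>u\<close> and \<open>v\<close> share the other one.\<close>

lemma card_star_neq_transitive:
  assumes "u \<in> tvertices T" "v \<in> tvertices T" "w \<in> tvertices T"
    "card (star T w) \<noteq> card (star T u)" "card (star T v) = card (star T u)"
  obtains f where "tiling_symmetry T f" "f u = v"
proof -
  define O' where "O' u = {f u | f. tiling_symmetry T f}" for u
  have in_orb: "O' x \<in> sym_vertex_orbits T" if "x \<in> tvertices T" for x
    using that by (auto simp: sym_vertex_orbits_def O'_def)
  have "tiling_symmetry T (\<lambda>x. x)" by (simp add: tiling_symmetry_def)
  then have self: "x \<in> O' x" for x unfolding O'_def by (auto intro!: exI[of _ "\<lambda>x. x"])
  have cs: "card (star T y) = card (star T x)" if "y \<in> O' x" for x y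
    using that sym_card_star by (auto simp: O'_def)
  have "O' w \<noteq> O' u" "O' w \<noteq> O' v" using cs[of w] self[of w] assms(4,5) by force+
  moreover obtain X Y where "sym_vertex_orbits T = {X, Y}" using two_orbits by (auto simp: card_2_iff)
  ultimately have "O' u = O' v" using in_orb[OF assms(1)] in_orb[OF assms(2)] in_orb[OF assms(3)] by auto
  then have "v \<in> O' u" using self[of v] by simp
  then show ?thesis using that by (auto simp: O'_def)
qed

text \<open>Otherwise the tiles having an A vertex would be closed under sharing a vertex, hence be
  all tiles by \<open>tile_connected\<close>, including those at a B vertex.\<close>

lemma mixed_tile:
  obtains (mixed) P v w d e where "P \<in> T" "v \<in> P" "w \<in> P" "vA v d" "vB w e"
proof (rule ccontr)
  assume nt: "\<not> thesis"
  have no: "False" if "P \<in> T" "v \<in> P" "w \<in> P" "vA v d" "vB w e" for P v w d e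
    using nt mixed that by blast
  define S where "S = {P \<in> T. \<exists>v d. v \<in> P \<and> vA v d}"
  obtain a where "has_vertex_type T a LA" using exA by auto
  then obtain d where a: "vA a d" using star_A(2) unfolding vA_def by blast
  then have "corner 3 a d \<in> T" using vA_tiles[OF a] by (simp add: starA_def)
  then have "corner 3 a d \<in> S" using a in_corner(1) unfolding S_def by blast
  then have "S \<noteq> {}" by blast
  have "S = T"
  proof (rule tile_connected[OF e2e _ \<open>S \<noteq> {}\<close>])
    show "S \<subseteq> T" by (auto simp: S_def)
    fix P Q x assume x: "P \<in> S" "Q \<in> T" "x \<in> P" "x \<in> Q"
    then obtain v e where v: "P \<in> T" "v \<in> P" "vA v e" by (auto simp: S_def)
    obtain d where "vA x d"
      using vertex_cases[OF in_tverticesI[OF v(1) x(3)]] no[OF v(1,2) x(3) v(3)] by metis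
    then show "Q \<in> S" using x unfolding S_def by blast
  qed
  obtain b where "has_vertex_type T b LB" using exB by auto
  then obtain d where b: "vB b d" using star_B(2) unfolding vB_def by blast
  then have "corner 3 b d \<in> T" using vB_tiles[OF b] by (auto simp: starB_def)
  then have "corner 3 b d \<in> S" using \<open>S = T\<close> by simp
  then show False using no[OF _ _ in_corner(1)[of b 3 d] _ b] unfolding S_def by blast
qed

lemma sym_vA: assumes "tiling_symmetry T f" "vA v d" obtains e where "vA (f v) e"
proof -
  have "corner 3 v d \<in> T" using vA_tiles[OF assms(2)] by (auto simp: starA_def)
  then have "f v \<in> tvertices T" using sym_tile[OF assms(1)] in_corner in_tverticesI by (metis imageI)
  then show ?thesis
  proof (cases rule: vertex_cases)
    case (1 e)
    then show ?thesis using that by blast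
  next
    case (2 e)
    then have False using sym_card_star[OF assms(1), of v] vA_card vB_card assms(2) by simp
    then show ?thesis ..
  qed
qed

lemma sym_vB: assumes "tiling_symmetry T f" "vB v d" obtains e where "vB (f v) e"
proof -
  have "corner 3 v d \<in> T" using vB_tiles[OF assms(2)] by (auto simp: starB_def)
  then have "f v \<in> tvertices T" using sym_tile[OF assms(1)] in_corner in_tverticesI by (metis imageI)
  then show ?thesis
  proof (cases rule: vertex_cases)
    case (2 e)
    then show ?thesis using that by blast
  next
    case (1 e)
    then have False using sym_card_star[OF assms(1), of v] vA_card vB_card assms(2) by simp
    then show ?thesis ..
  qed
qed

text \<open>A symmetry carries the B vertex of the mixed tile to \<open>w\<close>;
  \<open>A_neighbour_direction\<close> then locates the image of its A vertex.\<close>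

lemma B_has_A: assumes "vB w e" obtains d where "vA (w + e) d"
proof -
  obtain P v0 w0 d0 e0 where P: "P \<in> T" "v0 \<in> P" "w0 \<in> P" "vA v0 d0" "vB w0 e0" by (rule mixed_tile)
  have "card (star T w) = card (star T w0)" "card (star T v0) \<noteq> card (star T w0)"
    using vA_card vB_card P(4,5) assms by simp_all
  then obtain f where f: "tiling_symmetry T f" "f w0 = w"
    using card_star_neq_transitive[of w0 w v0] vA_vertex[OF P(4)] vB_vertex[OF P(5)] vB_vertex[OF assms] by metis
  obtain d where d: "vA (f v0) d" using sym_vA[OF f(1) P(4)] .
  have "f v0 = w + e" using A_neighbour_direction[OF assms d sym_tile[OF f(1) P(1)]] P f by blast
  then show ?thesis using d that by simp
qed

text \<open>The mixed tile, moved to \<open>v\<close> by a symmetry, supplies one B neighbour;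
  \<open>hexagon_all\<close> does the rest.\<close>

lemma hexagon: assumes "vA v d" shows "vB (v + d * nu^(2 * k)) (- (d * nu^(2 * k)))"
proof -
  obtain P v0 w0 d0 e0 where P: "P \<in> T" "v0 \<in> P" "w0 \<in> P" "vA v0 d0" "vB w0 e0" by (rule mixed_tile)
  have "card (star T v) = card (star T v0)" "card (star T w0) \<noteq> card (star T v0)"
    using vA_card vB_card P(4,5) assms by simp_all
  then obtain f where f: "tiling_symmetry T f" "f v0 = v"
    using card_star_neq_transitive[of v0 v w0] vA_vertex[OF P(4)] vB_vertex[OF P(5)] vA_vertex[OF assms] by metis
  obtain e where e: "vB (f w0) e" using sym_vB[OF f(1) P(5)] .
  show ?thesis using hexagon_all[OF assms e sym_tile[OF f(1) P(1)]] P f by blast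
qed

text \<open>From the hexagon vertex \<open>w\<close> the side \<open>d * nu\<close> of a square
  leads to a B vertex \<open>y\<close>. The point is that the distinguished edge of \<open>y\<close>
  continues away from \<open>v\<close>, in direction \<open>d * nu^2\<close>, to the next
  centre.\<close>

lemma next_hexagon:
  assumes A: "vA v d" shows "vA (v + d * tau) d"
proof -
  have d: "d \<noteq> 0" using A by (simp add: vA_def)
  define w where "w = v + d"
  have B: "vB w (-d)" using hexagon[OF A, of 0] by (simp add: w_def)
  define Q where "Q = corner 4 w (d * nu)"
  have Q: "Q = corner 4 w (-d * nu^7)" "Q \<in> T"
  proof -
    show "Q = corner 4 w (-d * nu^7)" by (simp add: Q_def nu_7)
    then show "Q \<in> T" using vB_tiles[OF B] by (simp add: starB_def)
  qed
  define y where "y = w + d * nu"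
  have yQ: "y \<in> Q" unfolding Q_def y_def by (rule in_corner)
  obtain e where e: "vB y e"
    using vertex_cases[OF in_tverticesI[OF Q(2) yQ]] square_not_A[OF _ yQ[unfolded Q_def] Q(2)[unfolded Q_def]] d nu_neq_0
    by auto
  have e0: "e \<noteq> 0" using e by (simp add: vB_def)
  have Qy: "Q = corner 4 y (d * nu^4)"
  proof -
    have "d * nu * nu^3 = d * nu^4" using nu_mult(1)[of d 1 3] by simp
    then show ?thesis unfolding Q_def y_def using corner4_rotate by metis
  qed
  have "Q \<in> starB y e" using e Q(2) yQ unfolding vB_def star_def by blast
  moreover have "card Q = 4" using card_corner[of "d * nu^4" 4 y] Qy d nu_neq_0 by simp
  ultimately have "Q = corner 4 y (e * nu^2) \<or> Q = corner 4 y (e * nu^7)"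
    using card_corner[of _ 3 y] e0 nu_neq_0 by (auto simp: starB_def)
  then have e12: "d * nu^4 = e * nu^2 \<or> d * nu^4 = e * nu^7"
    using corner_inj[of 4 y "d * nu^4"] Qy d e0 nu_neq_0 by auto
  have "e = d * nu^2"
  proof (rule ccontr)
    \<comment> \<open>The other position of \<open>Q\<close> among the squares at \<open>y\<close>
      would place the A neighbour of \<open>y\<close> on the second square at
      \<open>w\<close>.\<close>
    assume "e \<noteq> d * nu^2"
    moreover have "d * nu^4 = (d * nu^2) * nu^2" by (simp add: nu_mult)
    ultimately have "d * nu^4 = e * nu^7" using e12 nu_neq_0 by (metis mult_right_cancel power_not_zero)
    then have "d * nu^4 * nu^5 = e * nu^7 * nu^5" by simp
    then have e9: "e = d * nu^9" by (simp add: nu_mult nu_12)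
    obtain f where f: "vA (y + e) f" using B_has_A[OF e] .
    have "y + e = w + (-d) * nu^2 * nu^3"
      by (simp add: y_def e9 nu_9 nu_mult nu_5 algebra_simps)
    then have z: "y + e \<in> corner 4 w (-d * nu^2)" using in_corner by metis
    have "corner 4 w (-d * nu^2) \<in> T" using vB_tiles[OF B] by (simp add: starB_def)
    then show False using square_not_A[OF f z] d nu_neq_0 by simp
  qed
  then have e: "vB y (d * nu^2)" using e by simp
  then obtain f where f: "vA (y + d * nu^2) f" using B_has_A by blast
  have v': "y + d * nu^2 = v + d * tau" by (simp add: y_def w_def tau_def algebra_simps)
  \<comment> \<open>The triangle shared by \<open>y\<close> and the new centre makes
    \<open>y\<close> one of the six neighbours of that centre. Its vector \<open>f\<close> is thus
    \<open>d\<close> up to a sixth root of unity, and \<open>d\<close> itself serves there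
    too.\<close>
  have c: "corner 3 y (d * nu^2) \<in> T" using vB_tiles[OF e] by (simp add: starB_def)
  then have "corner 3 y (d * nu^2) \<in> starA (y + d * nu^2) f"
    using f in_corner unfolding vA_def star_def by blast
  moreover have "y \<in> corner 3 y (d * nu^2)" by (rule in_corner)
  ultimately obtain P where P: "P \<in> starA (y + d * nu^2) f" "y \<in> P" by blast
  define v' where "v' = y + d * nu^2"
  have "y \<noteq> v'" using d nu_neq_0 by (simp add: v'_def)
  then have "y \<in> {v' + f, v' + f * nu^2, v' + f * nu^4, v' + f * nu^6, v' + f * nu^8, v' + f * nu^10}"
    using P unfolding v'_def[symmetric] by (auto simp: starA_def corner_def nu_mult nu_12)
  moreover have "y = v' + d * nu^8" by (simp add: v'_def nu_8)
  ultimately have "d * nu^8 \<in> {f * nu^0, f * nu^2, f * nu^4, f * nu^6, f * nu^8, f * nu^10}" by auto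
  then have "d * nu^8 * nu^4 \<in> {f * nu^0 * nu^4, f * nu^2 * nu^4, f * nu^4 * nu^4, f * nu^6 * nu^4, f * nu^8 * nu^4, f * nu^10 * nu^4}"
    by (elim insertE) auto
  then have "d \<in> {f * nu^(2*2), f * nu^(2*3), f * nu^(2*4), f * nu^(2*5), f * nu^(2*0), f * nu^(2*1)}"
    unfolding nu_mult by (simp add: nu_12 nu_high)
  then obtain k where "d = f * nu^(2*k)" by blast
  then show ?thesis using vA_rotate[OF f] v' by metis
qed

end

subsection \<open>The lattice of hexagons\<close>


text \<open>The generators lead to the neighbouring centres. They are closed under negation, because
  \<open>nu^6 = -1\<close>, so adding generators already produces a group.\<close>

inductive_set lattice :: "complex \<Rightarrow> complex set" for d where
  zero: "0 \<in> lattice d"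
| step: "x \<in> lattice d \<Longrightarrow> x + d * tau * nu ^ (2 * k) \<in> lattice d"

lemma lattice_add: assumes "x \<in> lattice d" "y \<in> lattice d" shows "x + y \<in> lattice d"
  using assms(2)
proof induction
  case (step y k)
  then show ?case using lattice.step[of "x + y" d k] by (simp add: add.assoc)
qed (use assms in simp)

lemma lattice_uminus: assumes "x \<in> lattice d" shows "- x \<in> lattice d"
  using assms
proof induction
  case (step x k)
  have "- (x + d * tau * nu ^ (2 * k)) = - x + d * tau * nu ^ (2 * (k + 3))"
    by (simp add: power_add nu_6)
  then show ?case using lattice.step[OF step(2), of "k + 3"] by metis
qed (simp add: lattice.zero)

text \<open>The exponent runs over all naturals although only six boundary points occur; this avoids
  reductions modulo 6.\<close>

definition hexagon_points :: "complex \<Rightarrow> complex \<Rightarrow> complex set" where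
  "hexagon_points v d = insert v (range (\<lambda>k. v + d * nu ^ (2 * k)))"

lemma hexagon_points_rotate: "hexagon_points v (d * nu ^ (2 * j)) = hexagon_points v d"
proof -
  have "range (\<lambda>k. v + d * nu ^ (2 * j) * nu ^ (2 * k)) = range (\<lambda>k. v + d * nu ^ (2 * k))"
  proof (intro set_eqI iffI)
    fix x assume "x \<in> range (\<lambda>k. v + d * nu ^ (2 * j) * nu ^ (2 * k))"
    then obtain k where "x = v + d * nu ^ (2 * (j + k))" by (auto simp: nu_mult)
    then show "x \<in> range (\<lambda>k. v + d * nu ^ (2 * k))" by blast
  next
    fix x assume "x \<in> range (\<lambda>k. v + d * nu ^ (2 * k))"
    then obtain k where "x = v + d * nu ^ (2 * k)" by auto
    \<comment> \<open>Exponents of \<open>nu^2\<close> count modulo 6, so \<open>5 * j\<close> acts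
      as \<open>-j\<close>.\<close>
    also have "\<dots> = v + d * nu ^ (2 * j) * nu ^ (2 * (k + 5 * j))"
    proof -
      have "2 * j + 2 * (k + 5 * j) = 12 * j + 2 * k" by simp
      then show ?thesis unfolding nu_mult by (simp add: power_add nu_power_12)
    qed
    finally show "x \<in> range (\<lambda>k. v + d * nu ^ (2 * j) * nu ^ (2 * k))" by blast
  qed
  then show ?thesis by (simp add: hexagon_points_def)
qed

lemma hexagon_pointsI: "v \<in> hexagon_points v d" "v + d * nu ^ (2 * k) \<in> hexagon_points v d"
  by (auto simp: hexagon_points_def)

text \<open>The far vertices of the tiles at a vertex of one hexagon belong to the two hexagons across
  the adjacent squares.\<close>
lemma starB_points:
  assumes P: "P \<in> starB (v + d) (-d)" and y: "y \<in> P"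
  shows "y \<in> hexagon_points v d \<union> hexagon_points (v + d * tau) d \<union> hexagon_points (v + d * tau * nu^10) d"
proof -
  \<comment> \<open>Each vertex of the five tiles is \<open>v + d * (1 - c)\<close>. The identities
    show its centre, at offset 0, \<open>tau\<close> or \<open>tau * nu^10\<close>, and its position
    on that hexagon.\<close>
  have e: "-1 + 1 = (0::complex)" "1 - nu^2 = nu^(2*5)" "1 - nu^10 = nu^(2*1)"
    "1 - nu^5 = tau * nu^10 + nu^(2*2)" "1 - nu^2 * (1 + nu^3) = tau * nu^10 + nu^(2*3)"
    "1 - nu^7 = tau + nu^(2*4)" "1 - nu^7 * (1 + nu^3) = tau + nu^(2*3)" "1 - nu^12 = 0"
    by (simp_all add: tau_def nu_red nu_3 nu_sq) (simp_all add: nu_def complex_eq_iff field_simps)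
  have f: "v + d + - d * c = v + d * (1 - c)" for c by (simp add: algebra_simps)
  have "y \<in> {v + d, v + d + - d * 1, v + d + - d * nu^2, v + d + - d * nu^10, v + d + - d * nu^12,
     v + d + - d * nu^5, v + d + - d * (nu^2 * (1 + nu^3)), v + d + - d * nu^7, v + d + - d * (nu^7 * (1 + nu^3))}"
    using P y by (auto simp: starB_def corner_def nu_mult mult.assoc[of d] simp flip: power_add)
  then have "y \<in> {v + d * nu^(2*0), v, v + d * nu^(2*5), v + d * nu^(2*1),
     v + d * tau * nu^10 + d * nu^(2*2), v + d * tau * nu^10 + d * nu^(2*3), v + d * tau + d * nu^(2*4), v + d * tau + d * nu^(2*3)}"
    unfolding f e by (simp add: distrib_left add.assoc mult.assoc) blast
  then show ?thesis by (elim insertE) (simp_all only: UnI1 UnI2 hexagon_pointsI empty_iff)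
qed

lemma starA_points:
  assumes P: "P \<in> starA v d" and y: "y \<in> P" shows "y \<in> hexagon_points v d"
proof -
  have "y \<in> {v, v + d * nu^(2*0), v + d * nu^(2*1), v + d * nu^(2*2), v + d * nu^(2*3), v + d * nu^(2*4),
    v + d * nu^(2*5)}"
    using P y by (auto simp: starA_def corner_def nu_mult nu_12)
  then show ?thesis by (elim insertE) (simp_all only: hexagon_pointsI empty_iff)
qed

text \<open>The symmetry hypothesis enters from here on through \<open>hexagon\<close> and
  \<open>next_hexagon\<close>; one centre and one edge vector are fixed as origin and unit.\<close>

locale hexagon_tiling = tiling +
  fixes v0 d :: complex
  assumes d0: "d \<noteq> 0"
    and v0: "vA v0 d"
    and hexagon: "\<And>v d k. vA v d \<Longrightarrow> vB (v + d * nu^(2 * k)) (- (d * nu^(2 * k)))"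
    and next_hexagon: "\<And>v d. vA v d \<Longrightarrow> vA (v + d * tau) d"
begin

lemma next_hexagon': "vA v e \<Longrightarrow> vA (v + e * tau * nu ^ (2 * k)) e"
proof -
  assume v: "vA v e"
  have "vA (v + e * nu ^ (2 * k) * tau) (e * nu ^ (2 * k))"
    using next_hexagon[OF vA_rotate[OF v]] .
  moreover have "e * nu ^ (2 * k) * tau = e * tau * nu ^ (2 * k)" by simp
  ultimately have "vA (v + e * tau * nu ^ (2 * k)) (e * nu ^ (2 * k))" by metis
  then show ?thesis using starA_rotate v unfolding vA_def by metis
qed

lemma lattice_vA: "x \<in> lattice d \<Longrightarrow> vA (v0 + x) d"
proof (induction rule: lattice.induct)
  case (step x k)
  then show ?case using next_hexagon'[of "v0 + x" d k] by (simp add: add.assoc)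
qed (simp add: v0)

text \<open>The step of the propagation in \<open>vertex_in_hexagon\<close>: from a boundary vertex,
  tiles reach only its own hexagon and the two across the adjacent squares.\<close>

lemma tile_points:
  assumes x: "x \<in> lattice d" and P: "P \<in> T" "p \<in> P" "p \<in> hexagon_points (v0 + x) d" and y: "y \<in> P"
  shows "\<exists>x'\<in>lattice d. y \<in> hexagon_points (v0 + x') d"
proof -
  define v where "v = v0 + x"
  have A: "vA v d" using lattice_vA[OF x] by (simp add: v_def)
  show ?thesis
  proof (cases "p = v")
    case True
    then have "P \<in> starA v d" using A P unfolding vA_def star_def by blast
    then show ?thesis using starA_points y x v_def by blast
  next
    case False
    then obtain k where k: "p = v + d * nu ^ (2 * k)" using P(3) by (auto simp: hexagon_points_def v_def)
    define e where "e = d * nu ^ (2 * k)"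
    have "P \<in> starB (v + e) (-e)" using hexagon[OF A, of k] P k unfolding e_def vB_def star_def by blast
    from starB_points[OF this y]
    have "y \<in> hexagon_points v d \<union> hexagon_points (v + d * tau * nu ^ (2 * k)) d
        \<union> hexagon_points (v + d * tau * nu ^ (2 * (k + 5))) d"
      unfolding e_def hexagon_points_rotate
      by (simp add: mult_ac power_add)
    moreover have "v + d * tau * nu ^ (2 * j) = v0 + (x + d * tau * nu ^ (2 * j))" for j by (simp add: v_def)
    ultimately show ?thesis using x lattice.step v_def by (metis UnE)
  qed
qed

lemma vertex_in_hexagon:
  assumes "y \<in> tvertices T" obtains x where "x \<in> lattice d" "y \<in> hexagon_points (v0 + x) d"
proof -
  define S where "S = {P \<in> T. \<exists>x\<in>lattice d. P \<inter> hexagon_points (v0 + x) d \<noteq> {}}"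
  have "corner 3 v0 d \<in> T" using vA_tiles[OF v0] by (simp add: starA_def)
  moreover have "v0 \<in> corner 3 v0 d \<inter> hexagon_points (v0 + 0) d" using in_corner hexagon_pointsI by simp
  ultimately have ne: "S \<noteq> {}" using lattice.zero unfolding S_def by blast
  have "S = T"
  proof (rule tile_connected[OF e2e _ ne])
    show "S \<subseteq> T" by (auto simp: S_def)
    fix P Q y assume PQ: "P \<in> S" "Q \<in> T" "y \<in> P" "y \<in> Q"
    then obtain x p where "x \<in> lattice d" "P \<in> T" "p \<in> P" "p \<in> hexagon_points (v0 + x) d"
      unfolding S_def by blast
    from tile_points[OF this PQ(3)] show "Q \<in> S" using PQ unfolding S_def by blast
  qed
  obtain P where P: "P \<in> T" "y \<in> P" using assms by (auto simp: tvertices_def)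
  then have "P \<in> S" using \<open>S = T\<close> by simp
  then obtain x p where "x \<in> lattice d" "P \<in> T" "p \<in> P" "p \<in> hexagon_points (v0 + x) d"
      unfolding S_def by blast
  from tile_points[OF this P(2)] show ?thesis using that by blast
qed

lemma vertex_coordinates:
  assumes "y \<in> tvertices T"
  obtains x where "x \<in> lattice d" "y = v0 + x"
  | x k where "x \<in> lattice d" "y = v0 + x + d * nu ^ (2 * k)"
proof -
  obtain x where "x \<in> lattice d" "y \<in> hexagon_points (v0 + x) d" by (rule vertex_in_hexagon[OF assms])
  then show ?thesis using that by (auto simp: hexagon_points_def)
qed

lemma lattice_vB: "x \<in> lattice d \<Longrightarrow> vB (v0 + x + d * nu ^ (2 * k)) (- (d * nu ^ (2 * k)))"
  using hexagon[OF lattice_vA] .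

section \<open>Lattice translations and half-turns preserve the tiling\<close>

lemma image_corner: "(\<lambda>z. c + s * z) ` corner n u x = corner n (c + s * u) (s * x)"
  by (simp add: corner_def algebra_simps)

lemma image_starA: "(\<lambda>z. c + s * z) ` P \<in> starA (c + s * u) (s * x)" if "P \<in> starA u x"
  using that unfolding starA_def by (elim insertE emptyE) (simp_all only: image_corner mult.assoc insert_iff simp_thms)

lemma image_starB: "(\<lambda>z. c + s * z) ` P \<in> starB (c + s * u) (s * x)" if "P \<in> starB u x"
  using that unfolding starB_def by (elim insertE emptyE) (simp_all only: image_corner mult.assoc insert_iff simp_thms)

text \<open>The map z -> c + z with c in the lattice (s = 1), or z -> 2 v0 + c - z (s = -1).\<close>
definition move :: "complex \<Rightarrow> complex \<Rightarrow> complex \<Rightarrow> complex" where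
  "move s c z = v0 - s * v0 + c + s * z"

text \<open>The coordinates of a vertex determine its star. The move carries them to coordinates of
  another vertex, and the explicit stars correspond.\<close>

lemma move_tile:
  assumes s: "s = 1 \<or> s = -1" and c: "c \<in> lattice d" and P: "P \<in> T"
  shows "move s c ` P \<in> T"
proof -
  obtain y where y: "y \<in> P" using tile_nonempty[OF P] by auto
  have m: "move s c = (\<lambda>z. (v0 - s * v0 + c) + s * z)" by (simp add: move_def fun_eq_iff)
  have sx: "c + s * x \<in> lattice d" if "x \<in> lattice d" for x
    using s lattice_add[OF c that] lattice_add[OF c lattice_uminus[OF that]] by auto
  show ?thesis
  proof (rule vertex_coordinates[OF in_tverticesI[OF P y]])
    fix x assume x: "x \<in> lattice d" "y = v0 + x"
    have "P \<in> starA y d" using lattice_vA[OF x(1)] x(2) P y unfolding vA_def star_def by blast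
    then have "move s c ` P \<in> starA (v0 - s * v0 + c + s * y) (s * d)" unfolding m by (rule image_starA)
    also have "v0 - s * v0 + c + s * y = v0 + (c + s * x)" by (simp add: x algebra_simps)
    \<comment> \<open>For \<open>s = -1\<close>, the vector \<open>-d = d * nu^6\<close> describes
      the same star as \<open>d\<close>.\<close>
    also have "starA (v0 + (c + s * x)) (s * d) = starA (v0 + (c + s * x)) d"
      using s starA_rotate[of _ d 3] nu_6 by auto
    finally show ?thesis using lattice_vA[OF sx[OF x(1)]] vA_tiles by blast
  next
    fix x k assume x: "x \<in> lattice d" "y = v0 + x + d * nu ^ (2 * k)"
    have "P \<in> starB y (- (d * nu ^ (2 * k)))" using lattice_vB[OF x(1), of k] x(2) P y unfolding vB_def star_def by blast
    then have 1: "move s c ` P \<in> starB (v0 - s * v0 + c + s * y) (s * - (d * nu ^ (2 * k)))" unfolding m by (rule image_starB)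
    obtain j where j: "s * nu ^ (2 * k) = nu ^ (2 * j)"
    proof (cases "s = 1")
      case False
      then have "s * nu ^ (2 * k) = nu ^ (2 * (k + 3))" using s by (auto simp: power_add nu_6)
      then show ?thesis using that by blast
    qed (use that in simp)
    have 2: "s * - (d * nu ^ (2 * k)) = - (d * nu ^ (2 * j))" unfolding j[symmetric] by simp
    have 3: "v0 - s * v0 + c + s * y = v0 + (c + s * x) + d * nu ^ (2 * j)"
      unfolding j[symmetric] by (simp add: x algebra_simps)
    show ?thesis using vB_tiles[OF lattice_vB[OF sx[OF x(1)], of j]] 1 unfolding 2 3 by blast
  qed
qed

text \<open>In the explicit stars every direction is \<open>d\<close> times a unit factor, so all
  tiles have the same edge length.\<close>

lemma tile_corner:
  assumes P: "P \<in> T" "u \<in> P"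
  obtains x where "cmod x = cmod d" "P = corner (card P) u x"
proof -
  have A: "\<exists>x. cmod x = cmod d \<and> P = corner (card P) u x" if "P \<in> starA u e" "cmod e = cmod d" for e
  proof -
    have "\<exists>x. cmod x = cmod d \<and> P = corner 3 u x" using that unfolding starA_def
      by (elim insertE emptyE; intro exI conjI) (auto simp: norm_mult)
    then obtain x where x: "cmod x = cmod d" "P = corner 3 u x" by blast
    then have "x \<noteq> 0" using d0 by auto
    then show ?thesis using x card_corner[of x 3 u] by auto
  qed
  have B: "\<exists>x. cmod x = cmod d \<and> P = corner (card P) u x" if "P \<in> starB u e" "cmod e = cmod d" for e
  proof -
    have "\<exists>x n. cmod x = cmod d \<and> P = corner n u x \<and> (n = 3 \<or> n = 4)" using that unfolding starB_def
      by (elim insertE emptyE; intro exI conjI) (auto simp: norm_mult)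
    then obtain x n where x: "cmod x = cmod d" "P = corner n u x" "n = 3 \<or> n = 4" by blast
    then have "x \<noteq> 0" using d0 by auto
    then show ?thesis using x card_corner[of x n u] by auto
  qed
  have st: "P \<in> star T u" using P by (simp add: star_def)
  have "\<exists>x. cmod x = cmod d \<and> P = corner (card P) u x"
  proof (rule vertex_coordinates[OF in_tverticesI[OF P]])
    fix x assume "x \<in> lattice d" "u = v0 + x"
    then have "P \<in> starA u d" using lattice_vA st unfolding vA_def by blast
    then show ?thesis using A by blast
  next
    fix x k assume "x \<in> lattice d" "u = v0 + x + d * nu ^ (2 * k)"
    then have "P \<in> starB u (- (d * nu ^ (2 * k)))" using lattice_vB st unfolding vB_def by blast
    then show ?thesis using B by (simp add: norm_mult)
  qed
  then show ?thesis using that by blast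
qed

end

subsection \<open>Automorphisms are isometries\<close>


definition direct_iso :: "(complex \<Rightarrow> complex) \<Rightarrow> bool" where
  "direct_iso f \<longleftrightarrow> (\<exists>s c. cmod s = 1 \<and> f = (\<lambda>z. c + s * z))"

definition indirect_iso :: "(complex \<Rightarrow> complex) \<Rightarrow> bool" where
  "indirect_iso f \<longleftrightarrow> (\<exists>s c. cmod s = 1 \<and> f = (\<lambda>z. c + s * cnj z))"

lemma iso_dist: "direct_iso f \<or> indirect_iso f \<Longrightarrow> cmod (f y - f x) = cmod (y - x)"
proof -
  have "cmod (s * cnj y - s * cnj x) = cmod s * cmod (y - x)" "cmod (s * y - s * x) = cmod s * cmod (y - x)" for s
    by (metis complex_cnj_diff complex_mod_cnj norm_mult right_diff_distrib, metis norm_mult right_diff_distrib)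
  then show "direct_iso f \<or> indirect_iso f \<Longrightarrow> cmod (f y - f x) = cmod (y - x)"
    by (auto simp: direct_iso_def indirect_iso_def)
qed

lemma iso_affine: assumes "direct_iso f \<or> indirect_iso f" obtains L c where "linear L" "f = (\<lambda>z. c + L z)"
  using assms
proof
  assume "direct_iso f"
  then obtain s c where "f = (\<lambda>z. c + s * z)" by (auto simp: direct_iso_def)
  moreover have "linear (\<lambda>z. s * z)" by (simp add: linear_iff algebra_simps)
  ultimately show ?thesis using that by blast
next
  assume "indirect_iso f"
  then obtain s c where "f = (\<lambda>z. c + s * cnj z)" by (auto simp: indirect_iso_def)
  moreover have "linear (\<lambda>z. s * cnj z)" by (simp add: linear_iff algebra_simps)
  ultimately show ?thesis using that by blast
qed

lemma iso_continuous: "direct_iso f \<or> indirect_iso f \<Longrightarrow> continuous_on S f"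
  by (auto simp: direct_iso_def indirect_iso_def intro!: continuous_intros)

lemma iso_hull: assumes "direct_iso f \<or> indirect_iso f" shows "convex hull (f ` P) = f ` (convex hull P)"
proof -
  obtain L c where L: "linear L" "f = (\<lambda>z. c + L z)" using iso_affine[OF assms] .
  have i: "f ` A = (\<lambda>z. c + z) ` L ` A" for A by (auto simp: L)
  show ?thesis unfolding i by (simp add: convex_hull_translation convex_hull_linear_image[OF L(1)])
qed

lemma direct_corner: assumes "direct_iso f" shows "f ` corner n a (b - a) = corner n (f a) (f b - f a)"
proof -
  obtain s c where f: "f = (\<lambda>z. c + s * z)" using assms by (auto simp: direct_iso_def)
  then show ?thesis by (simp add: corner_def algebra_simps)
qed

text \<open>Reversing orientation turns the left of an edge into the right of its image, which is
  the left of the reversed image.\<close>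

lemma indirect_corner: assumes "indirect_iso f" shows "f ` corner n a (b - a) = corner n (f b) (f a - f b)"
proof -
  obtain s c where f: "f = (\<lambda>z. c + s * cnj z)" using assms by (auto simp: indirect_iso_def)
  have n2: "cnj (nu^2) = 1 - nu^2" by (simp add: nu_sq complex_eq_iff del: complex_cnj_power)
  define y where "y = s * cnj (b - a)"
  have fx: "f (a + (b - a) * w) = f a + y * cnj w" for w
    by (simp add: f y_def algebra_simps)
  have fb: "f b = f a + y" by (simp add: f y_def algebra_simps)
  show ?thesis
  proof (cases "n = 3")
    case True
    have 1: "f a + y * (1 - nu^2) = f a + y + (f a - (f a + y)) * nu^2" by (simp add: algebra_simps)
    have "f ` corner n a (b - a) = {f a, f b, f (a + (b - a) * nu^2)}"
      using True by (simp add: corner_def)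
    also have "\<dots> = corner n (f b) (f a - f b)"
      unfolding fx n2 1 using True by (simp add: corner_def fb insert_commute)
    finally show ?thesis .
  next
    case False
    have 1: "f a + y * cnj \<i> = f a + y + (f a - (f a + y)) * (1 + \<i>)" 
      "f a + y * cnj (1 + \<i>) = f a + y + (f a - (f a + y)) * \<i>" by (simp_all add: algebra_simps)
    have "f ` corner n a (b - a) = {f a, f b, f (a + (b - a) * \<i>), f (a + (b - a) * (1 + \<i>))}"
      using False by (simp add: corner_def nu_3)
    also have "\<dots> = corner n (f b) (f a - f b)"
      unfolding fx 1 using False by (simp add: corner_def nu_3 fb insert_commute)
    finally show ?thesis .
  qed
qed

text \<open>Dividing by \<open>x\<close> moves the edge to the real axis; the imaginary part then
  measures the height above it, and only the ends of the edge have height 0.\<close>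

lemma corner_halfplane:
  assumes "x \<noteq> 0" "w \<in> corner n a x"
  shows "Im ((w - a) / x) \<ge> 0" "Im ((w - a) / x) = 0 \<longleftrightarrow> w = a \<or> w = a + x"
proof -
  have "(w = a \<or> w = a + x) \<and> Im ((w - a) / x) = 0 \<or> \<not> (w = a \<or> w = a + x) \<and> Im ((w - a) / x) > 0"
  proof (cases "n = 3")
    case True
    then have "w = a \<or> w = a + x \<or> w = a + x * nu^2" using assms(2) by (auto simp: corner_def)
    moreover have "nu^2 \<noteq> 1" by (simp add: nu_sq complex_eq_iff)
    moreover have "Im (nu^2) > 0" by (simp add: nu_sq)
    ultimately show ?thesis using assms(1) nu_neq_0 by (elim disjE) simp_all
  next
    case False
    then have "w = a \<or> w = a + x \<or> w = a + x * \<i> \<or> w = a + x * (1 + \<i>)" using assms(2) by (auto simp: corner_def nu_3)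
    moreover have "1 + \<i> \<noteq> 0" by (simp add: complex_eq_iff)
    ultimately show ?thesis using assms(1) by (elim disjE) simp_all
  qed
  then show "Im ((w - a) / x) \<ge> 0" "Im ((w - a) / x) = 0 \<longleftrightarrow> w = a \<or> w = a + x" by auto
qed

text \<open>A point of the first edge has height 0. As a convex combination of the nonnegative
  heights of \<open>c\<close> and \<open>e\<close>, this forces either both of them onto the edge
  line or \<open>z\<close> to be one of them.\<close>

lemma corner_edges_meet:
  assumes x: "x \<noteq> 0" and c: "c \<in> corner n a x" "e \<in> corner n a x" "c \<noteq> e"
    and z: "z \<in> closed_segment a (a + x)" "z \<in> closed_segment c e"
  shows "{a, a + x} = {c, e} \<or> z \<in> corner n a x"
proof -
  define h where "h w = Im ((w - a) / x)" for w
  obtain t where t: "z = a + of_real t * x" using z(1) by (auto simp: closed_segment_def scaleR_conv_of_real algebra_simps)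
  obtain s where s: "0 \<le> s" "s \<le> 1" "z = (1 - s) *\<^sub>R c + s *\<^sub>R e" using z(2) by (auto simp: closed_segment_def)
  have "h z = 0" using x by (simp add: h_def t)
  have "(z - a) / x = (1 - s) *\<^sub>R ((c - a) / x) + s *\<^sub>R ((e - a) / x)"
    using x unfolding s(3) scaleR_conv_of_real by (simp add: field_simps)
  then have sum0: "(1 - s) * h c + s * h e = 0" using \<open>h z = 0\<close> by (simp add: h_def)
  have pos: "h c \<ge> 0" "h e \<ge> 0" using corner_halfplane[OF x] c by (auto simp: h_def)
  then have nn: "(1 - s) * h c \<ge> 0" "s * h e \<ge> 0" using s by auto
  then have "(1 - s) * h c = 0" "s * h e = 0" using sum0 by linarith+
  then consider "s = 1" | "s = 0" | "h c = 0" "h e = 0" by auto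
  then show ?thesis
  proof cases
    case 3
    then show ?thesis using corner_halfplane(2)[OF x] c unfolding h_def by (metis insert_commute)
  qed (use s c in auto)
qed

context tiling begin

text \<open>Sharpens \<open>tile_connected\<close>: two tiles with a common vertex are joined by a
  chain of edge-adjacent tiles, namely the face-cycle there.\<close>

lemma edge_connected:
  assumes S: "S \<subseteq> T" "S \<noteq> {}"
    and step: "\<And>P Q e. P \<in> S \<Longrightarrow> Q \<in> T \<Longrightarrow> poly_edge P e \<Longrightarrow> poly_edge Q e \<Longrightarrow> Q \<in> S"
  shows "S = T"
proof (rule tile_connected[OF e2e S])
  fix P Q x assume x: "P \<in> S" "Q \<in> T" "x \<in> P" "x \<in> Q"
  show "Q \<in> S"
  proof (rule vertex_list[OF in_tverticesI[OF x(2,4)]])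
    fix ts L assume ts: "set ts = star T x"
      and e: "\<And>i. i < length ts \<Longrightarrow> \<exists>y. poly_edge (ts ! i) {x, y} \<and> poly_edge (ts ! (Suc i mod length ts)) {x, y}"
    have "P \<in> set ts" "Q \<in> set ts" using ts x S by (auto simp: star_def)
    then obtain i j where ij: "i < length ts" "ts ! i = P" "j < length ts" "ts ! j = Q"
      by (metis in_set_conv_nth)
    let ?n = "length ts"
    have "ts ! ((i + k) mod ?n) \<in> S" for k
    proof (induction k)
      case (Suc k)
      define m where "m = (i + k) mod ?n"
      have n0: "?n > 0" using ij(1) by linarith
      then have m: "m < ?n" unfolding m_def by simp
      have "Suc m mod ?n = (i + Suc k) mod ?n" by (simp add: m_def mod_simps)
      moreover have "Suc m mod ?n < ?n" using n0 by simp
      then have "ts ! (Suc m mod ?n) \<in> T" using ts unfolding star_def by (metis (no_types, lifting) mem_Collect_eq nth_mem)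
      ultimately show ?case using step e[OF m] Suc m_def by metis
    qed (use ij x in simp)
    \<comment> \<open>\<open>j + ?n - i\<close> steps lead from position \<open>i\<close> to
      position \<open>j\<close> modulo the length; \<open>i < ?n\<close> keeps the subtraction
      honest.\<close>
    from this[of "j + ?n - i"] show ?thesis using ij by simp
  qed
qed

end

context hexagon_tiling begin

lemma edge_length: assumes "R \<in> T" "poly_edge R {a, b}" shows "cmod (b - a) = cmod d"
proof -
  note c = card_tile[OF assms(1)]
  have ab: "a \<in> R" "b \<in> R" using poly_edge_subset[OF assms(2)] by auto
  obtain x where x: "cmod x = cmod d" "R = corner (card R) a x" using tile_corner[OF assms(1) ab(1)] .
  obtain y where y: "cmod y = cmod d" "R = corner (card R) b y" using tile_corner[OF assms(1) ab(2)] .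
  have nz: "x \<noteq> 0" "y \<noteq> 0" using x y d0 by auto
  note E = edge_corner[OF assms(2) refl c]
  show ?thesis
    using E(2)
  proof
    assume "R = corner (card R) a (b - a)"
    then have "x = b - a" using corner_inj[of "card R" a x "b - a"] x nz E(1) by auto
    then show ?thesis using x by simp
  next
    assume "R = corner (card R) b (a - b)"
    then have "y = a - b" using corner_inj[of "card R" b y "a - b"] y nz E(1) by auto
    then show ?thesis using y by (simp add: norm_minus_commute)
  qed
qed

text \<open>Two distinct vertices of a tile that do not span an edge span the diagonal of a square,
  which is longer by a factor \<open>sqrt 2\<close>. So edges are recognised by distance.\<close>

lemma length_edge:
  assumes "R \<in> T" "a \<in> R" "b \<in> R" "cmod (b - a) = cmod d"
  shows "poly_edge R {a, b}"
proof -
  obtain x where x: "x \<noteq> 0" "R = corner (card R) a x" "poly_edge R {a, a + x}" "poly_edge R {a, a + x * rot (card R)}"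
    using regular_corner[OF tile_reg[OF assms(1)] refl card_tile[OF assms(1)] assms(2)] .
  have lx: "cmod x = cmod d" using edge_length[OF assms(1) x(3)] by simp
  have ba: "b \<noteq> a" using assms(4) d0 by auto
  have "b = a + x \<or> b = a + x * rot (card R)"
  proof (cases "card R = 3")
    case True
    then have "b \<in> corner 3 a x" using assms(3) x(2) by simp
    then show ?thesis using True ba by (auto simp: corner_def rot_def)
  next
    case False
    then have c4: "card R = 4" using card_tile[OF assms(1)] by auto
    then have "b \<in> corner 4 a x" using assms(3) x(2) by simp
    moreover have "b \<noteq> a + x * (1 + \<i>)"
    proof
      assume "b = a + x * (1 + \<i>)"
      then have "cmod x * cmod (1 + \<i>) = cmod x" using assms(4) lx unfolding norm_mult[symmetric] by simp
      then have "cmod (1 + \<i>) = 1" using x(1) by simp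
      then show False by (simp add: cmod_def)
    qed
    ultimately show ?thesis using c4 ba by (auto simp: corner_def rot_def nu_3)
  qed
  then show ?thesis using x by auto
qed

lemma tedges_eq: "tedges T = {{a, b} | a b. \<exists>R\<in>T. a \<in> R \<and> b \<in> R \<and> cmod (b - a) = cmod d}"
proof (intro set_eqI iffI)
  fix e assume "e \<in> tedges T"
  then obtain R where R: "R \<in> T" "poly_edge R e" by (auto simp: tedges_def)
  then obtain a b where ab: "e = {a, b}" unfolding poly_edge_def by blast
  then have "a \<in> R" "b \<in> R" using poly_edge_subset[OF R(2)] by auto
  then show "e \<in> {{a, b} | a b. \<exists>R\<in>T. a \<in> R \<and> b \<in> R \<and> cmod (b - a) = cmod d}"
    using edge_length R ab by blast
qed (auto simp: tedges_def intro: length_edge)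

lemma edge_meet:
  assumes "R \<in> T" "poly_edge R {a, b}" "poly_edge R {c, e}" "z \<in> closed_segment a b" "z \<in> closed_segment c e"
  shows "{a, b} = {c, e} \<or> z \<in> R"
proof -
  note E = edge_corner[OF assms(2) refl card_tile[OF assms(1)]]
  have ce: "c \<in> R" "e \<in> R" "c \<noteq> e"
    using poly_edge_subset[OF assms(3)] edge_corner(1)[OF assms(3) refl card_tile[OF assms(1)]] by auto
  show ?thesis using E(2)
  proof
    assume R: "R = corner (card R) a (b - a)"
    then show ?thesis using corner_edges_meet[of "b - a" c "card R" a e z] E(1) ce assms by auto
  next
    assume R: "R = corner (card R) b (a - b)"
    then show ?thesis using corner_edges_meet[of "a - b" c "card R" b e z] E(1) ce assms
      by (auto simp: closed_segment_commute insert_commute)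
  qed
qed

lemma fixed_point_fixes_cell:
  assumes f: "direct_iso f \<or> indirect_iso f" and T: "\<And>P. P \<in> T \<Longrightarrow> f ` P \<in> T" and z: "f z = z"
  shows "(\<exists>v\<in>tvertices T. f v = v) \<or> (\<exists>e\<in>tedges T. f ` e = e) \<or> (\<exists>P\<in>T. f ` P = P)"
proof -
  obtain P where P: "P \<in> T" "z \<in> convex hull P" using e2e_cover[OF e2e] by blast
  show ?thesis
  proof (cases "f ` P = P")
    case False
    have zf: "z \<in> convex hull (f ` P)" using iso_hull[OF f, of P] P(2) z by (metis imageI)
    show ?thesis
    proof (rule e2e_cases[OF e2e P(1) T[OF P(1)]])
      show "P \<noteq> f ` P" using False by auto
      assume "convex hull P \<inter> convex hull (f ` P) = {}"
      then show ?thesis using P zf by blast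
    next
      fix v assume "v \<in> P" "convex hull P \<inter> convex hull (f ` P) = {v}"
      moreover from this have "z \<in> {v}" using P zf by blast
      ultimately have "z \<in> tvertices T" using P in_tverticesI by blast
      then show ?thesis using z by blast
    next
      fix a b assume ab: "poly_edge P {a, b}" "poly_edge (f ` P) {a, b}"
        "convex hull P \<inter> convex hull (f ` P) = closed_segment a b"
      have zab: "z \<in> closed_segment a b" using ab(3) P zf by blast
      have in_P: "a \<in> P" "b \<in> P" using poly_edge_subset[OF ab(1)] by auto
      have "z \<in> f ` (convex hull {a, b})" using zab z unfolding segment_convex_hull by (metis imageI)
      then have zfab: "z \<in> closed_segment (f a) (f b)" using iso_hull[OF f, of "{a, b}"] by (simp add: segment_convex_hull)
      have "cmod (f b - f a) = cmod d" using iso_dist[OF f] edge_length[OF P(1) ab(1)] by simp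
      then have "poly_edge (f ` P) {f a, f b}" using length_edge[OF T[OF P(1)]] in_P by blast
      from edge_meet[OF T[OF P(1)] ab(2) this zab zfab] show ?thesis
      proof
        assume "{a, b} = {f a, f b}"
        moreover have "f ` {a, b} = {f a, f b}" by simp
        ultimately have "f ` {a, b} = {a, b}" by (simp only:)
        moreover have "{a, b} \<in> tedges T" using P ab(1) by (auto simp: tedges_def)
        ultimately show ?thesis by blast
      next
        assume "z \<in> f ` P"
        then show ?thesis using in_tverticesI[OF T[OF P(1)]] z by blast
      qed
    qed
  qed (use P in blast)
qed

section \<open>Extending a map automorphism to an isometry\<close>

lemma agree_on_tile:
  assumes aut: "inj_on g (tvertices T)" "\<And>a b R. R \<in> T \<Longrightarrow> a \<in> R \<Longrightarrow> b \<in> R \<Longrightarrow> cmod (b - a) = cmod d \<Longrightarrow> cmod (g b - g a) = cmod d"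
    and f: "direct_iso f \<or> indirect_iso f"
    and Q: "Q \<in> T" "Q = corner n a x" "x \<noteq> 0" "n = 3 \<or> n = 4"
    and im: "g ` Q = f ` Q" and ab: "g a = f a" "g (a + x) = f (a + x)" "cmod x = cmod d"
    and w: "w \<in> Q"
  shows "g w = f w"
proof -
  have QV: "Q \<subseteq> tvertices T" using Q(1) by (auto simp: tvertices_def)
  have gi: "g p = g q \<longleftrightarrow> p = q" if "p \<in> Q" "q \<in> Q" for p q
    using inj_on_eq_iff[OF aut(1)] QV that by (meson subsetD)
  have n2: "nu^2 \<noteq> 1" by (simp add: nu_sq complex_eq_iff)
  have aQ: "a \<in> Q" "a + x \<in> Q" using Q(2) in_corner by auto
  show ?thesis
  proof (cases "n = 3")
    case True
    define c where "c = a + x * nu^2"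
    have Qe: "Q = {a, a + x, c}" using Q(2) True by (simp add: corner_def c_def)
    have "c \<noteq> a" "c \<noteq> a + x" using Q(3) n2 nu_neq_0 by (auto simp: c_def)
    then have "g c \<noteq> g a" "g c \<noteq> g (a + x)" using gi Qe by auto
    moreover have "g c \<in> f ` Q" using im Qe by blast
    ultimately have "g c = f c" using Qe ab by auto
    then show ?thesis using w Qe ab by auto
  next
    case False
    define c e where "c = a + x * \<i>" and "e = a + x * (1 + \<i>)"
    have Qe: "Q = {a, a + x, c, e}" using Q(2) False by (simp add: corner_def c_def e_def nu_3)
    have "1 + \<i> \<noteq> 0" "1 + \<i> \<noteq> 1" "1 + \<i> \<noteq> \<i>" "\<i> \<noteq> 1" by (simp_all add: complex_eq_iff)
    then have ne: "c \<noteq> a" "c \<noteq> a + x" "e \<noteq> a" "e \<noteq> a + x" "e \<noteq> c"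
      using Q(3) by (auto simp: c_def e_def)
    have "g c \<noteq> f e"
    proof
      assume "g c = f e"
      moreover have "cmod (g c - g a) = cmod d"
        using aut(2)[OF Q(1), of a c] Qe ab(3) by (simp add: c_def norm_mult)
      ultimately have "cmod (e - a) = cmod x" using iso_dist[OF f, of e a] ab by simp
      then have "cmod x * cmod (1 + \<i>) = cmod x" by (simp add: e_def norm_mult)
      then have "cmod (1 + \<i>) = 1" using Q(3) by simp
      then show False by (simp add: cmod_def)
    qed
    moreover have "g c \<in> f ` Q" using im Qe by blast
    moreover have "g c \<noteq> g a" "g c \<noteq> g (a + x)" using gi Qe ne by auto
    ultimately have c: "g c = f c" using Qe ab by auto
    have "g e \<noteq> g a" "g e \<noteq> g (a + x)" "g e \<noteq> g c" using gi Qe ne by auto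
    moreover have "g e \<in> f ` Q" using im Qe by blast
    ultimately have "g e = f e" using Qe ab c by auto
    then show ?thesis using w Qe ab c by auto
  qed
qed

lemma aut_props:
  assumes "map_aut (tiling_map T) g"
  shows "bij_betw g (tvertices T) (tvertices T)" "P \<in> T \<Longrightarrow> g ` P \<in> T"
    "R \<in> T \<Longrightarrow> a \<in> R \<Longrightarrow> b \<in> R \<Longrightarrow> cmod (b - a) = cmod d \<Longrightarrow> cmod (g b - g a) = cmod d"
proof -
  have A: "bij_betw g (tvertices T) (tvertices T)" "(\<lambda>e. g ` e) ` tedges T = tedges T" "(\<lambda>e. g ` e) ` T = T"
    using assms by (auto simp: map_aut_def tiling_map_def)
  show "bij_betw g (tvertices T) (tvertices T)" "P \<in> T \<Longrightarrow> g ` P \<in> T" using A by auto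
  assume "R \<in> T" "a \<in> R" "b \<in> R" "cmod (b - a) = cmod d"
  then have "{a, b} \<in> tedges T" unfolding tedges_eq by blast
  then have "{g a, g b} \<in> tedges T" using imageI[of "{a, b}" "tedges T" "\<lambda>e. g ` e"] unfolding A(2) by simp
  then obtain p q where "{g a, g b} = {p, q}" "cmod (q - p) = cmod d" unfolding tedges_eq by blast
  then show "cmod (g b - g a) = cmod d" by (auto simp: doubleton_eq_iff norm_minus_commute)
qed

text \<open>Both \<open>g\<close> and \<open>f\<close> send \<open>Q\<close> to the tile across the
  image of the shared edge, opposite to the common image of \<open>P\<close>;
  \<open>agree_on_tile\<close> then compares them vertex by vertex.\<close>

lemma aut_isometry_step:
  assumes g: "map_aut (tiling_map T) g" and f: "direct_iso f \<or> indirect_iso f"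
    and PQ: "P \<in> T" "Q \<in> T" "poly_edge P {a, b}" "poly_edge Q {a, b}" and fg: "\<forall>z\<in>P. g z = f z"
  shows "\<forall>z\<in>Q. g z = f z"
proof (cases "P = Q")
  case False
  have inj: "inj_on g (tvertices T)" using aut_props(1)[OF g] by (rule bij_betw_imp_inj_on)
  have sub: "R \<subseteq> tvertices T" if "R \<in> T" for R using that by (auto simp: tvertices_def)
  have crd: "card (g ` R) = card R" if "R \<in> T" for R using inj_on_subset[OF inj sub[OF that]] by (rule card_image)
  have ab: "a \<in> P" "b \<in> P" "a \<in> Q" "b \<in> Q" using poly_edge_subset PQ by auto
  have l: "cmod (b - a) = cmod d" using edge_length PQ by blast
  then have ne: "a \<noteq> b" using d0 by auto
  have gP: "g ` P = f ` P" using fg by auto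
  have gab: "g a = f a" "g b = f b" using fg ab by auto
  have neq: "g ` P \<noteq> g ` Q" using inj_on_image_eq_iff[OF inj sub sub] PQ False by blast
  have gl: "cmod (g b - g a) = cmod d" using aut_props(3)[OF g PQ(1)] ab l by blast
  have gne: "g b - g a \<noteq> 0" "g a - g b \<noteq> 0" using gl d0 by auto
  have "poly_edge (g ` P) {g a, g b}" "poly_edge (g ` Q) {g a, g b}"
    using length_edge[OF aut_props(2)[OF g]] PQ ab gl by blast+
  note sides = edge_sides[OF aut_props(2)[OF g PQ(1)] aut_props(2)[OF g PQ(2)] neq this, unfolded crd[OF PQ(1)] crd[OF PQ(2)]]
  have same: "g ` P = g ` Q" if "g ` P = corner (card P) p x" "g ` Q = corner (card Q) p x" "x \<noteq> 0" for p x
    using e2e_same_side[OF e2e, of "card P" p x "card Q"] that aut_props(2)[OF g] PQ card_tile by metis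
  \<comment> \<open>Stated for an oriented edge, so that both positions of \<open>P\<close> relative
    to \<open>{a, b}\<close> are covered by exchanging the ends.\<close>
  have key: "g ` Q = f ` Q" if PQ': "P = corner (card P) p (q - p)" "Q = corner (card Q) q (p - q)" "{p, q} = {a, b}" for p q
  proof -
    have pq: "g p = f p" "g q = f q" "g q - g p \<noteq> 0" "g p - g q \<noteq> 0" using gab gne that(3) by (auto simp: doubleton_eq_iff)
    have sd: "g ` P = corner (card P) (g p) (g q - g p) \<and> g ` Q = corner (card Q) (g q) (g p - g q) \<or>
       g ` P = corner (card P) (g q) (g p - g q) \<and> g ` Q = corner (card Q) (g p) (g q - g p)"
      using sides that(3) by (auto simp: doubleton_eq_iff)
    from f show ?thesis
    proof
      assume d: "direct_iso f"
      have 1: "g ` P = corner (card P) (g p) (g q - g p)"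
        using trans[OF arg_cong[OF PQ'(1), where f = "image f"] direct_corner[OF d]] gP pq by simp
      have "g ` Q \<noteq> corner (card Q) (g p) (g q - g p)" using same[OF 1 _ pq(3)] neq by metis
      then have "g ` Q = corner (card Q) (g q) (g p - g q)" using sd by auto
      then show ?thesis
        using trans[OF arg_cong[OF PQ'(2), where f = "image f"] direct_corner[OF d]] pq by simp
    next
      assume d: "indirect_iso f"
      have 1: "g ` P = corner (card P) (g q) (g p - g q)"
        using trans[OF arg_cong[OF PQ'(1), where f = "image f"] indirect_corner[OF d]] gP pq by simp
      have "g ` Q \<noteq> corner (card Q) (g q) (g p - g q)" using same[OF 1 _ pq(4)] neq by metis
      then have "g ` Q = corner (card Q) (g p) (g q - g p)" using sd by auto
      then show ?thesis
        using trans[OF arg_cong[OF PQ'(2), where f = "image f"] indirect_corner[OF d]] pq by simp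
    qed
  qed
  from edge_sides[OF PQ(1,2) False PQ(3,4)] show ?thesis
  proof (elim disjE conjE)
    assume P: "P = corner (card P) a (b - a)" and Q: "Q = corner (card Q) b (a - b)"
    show ?thesis
      using agree_on_tile[OF inj aut_props(3)[OF g] f PQ(2) Q _ card_tile[OF PQ(2)] key[OF P Q refl]] ne gab l
      by (simp add: norm_minus_commute)
  next
    assume P: "P = corner (card P) b (a - b)" and Q: "Q = corner (card Q) a (b - a)"
    show ?thesis
      using agree_on_tile[OF inj aut_props(3)[OF g] f PQ(2) Q _ card_tile[OF PQ(2)] key[OF P Q insert_commute]] ne gab l
      by simp
  qed
qed (use fg in simp)

text \<open>The image of one triangle fixes a candidate isometry, and its orientation decides
  between direct and indirect; \<open>edge_connected\<close> spreads the agreement.\<close>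

lemma aut_isometry:
  assumes g: "map_aut (tiling_map T) g"
  obtains f where "direct_iso f \<or> indirect_iso f" "\<And>z. z \<in> tvertices T \<Longrightarrow> g z = f z" "\<And>P. P \<in> T \<Longrightarrow> f ` P \<in> T"
proof -
  have inj: "inj_on g (tvertices T)" using aut_props(1)[OF g] by (rule bij_betw_imp_inj_on)
  define P where "P = corner 3 v0 d"
  have PT: "P \<in> T" using vA_tiles[OF v0] by (simp add: starA_def P_def)
  have cP: "card P = 3" using d0 by (simp add: P_def card_corner)
  have sub: "P \<subseteq> tvertices T" using PT by (auto simp: tvertices_def)
  have cgP: "card (g ` P) = 3" using card_image[OF inj_on_subset[OF inj sub]] cP by simp
  define a b c where "a = g v0" and "b = g (v0 + d)" and "c = g (v0 + d * nu^2)"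
  have gP: "g ` P = {a, b, c}" by (simp add: P_def corner_def a_def b_def c_def)
  have l: "cmod (b - a) = cmod d"
    using aut_props(3)[OF g PT, of v0 "v0 + d"] by (simp add: a_def b_def P_def corner_def)
  have gPT: "g ` P \<in> T" using aut_props(2)[OF g PT] .
  have "poly_edge (g ` P) {a, b}" using length_edge[OF gPT _ _ l] gP by blast
  note E = edge_corner[OF this cgP disjI1[OF refl]]
  have dist: "c \<noteq> a" "c \<noteq> b" using cgP unfolding gP by (auto simp: card_insert_if split: if_splits)
  have n2: "cnj (nu^2) = 1 - nu^2" by (simp add: nu_sq complex_eq_iff del: complex_cnj_power)
  have "\<exists>f. (direct_iso f \<or> indirect_iso f) \<and> (\<forall>z\<in>P. g z = f z)"
    using E(2)
  proof (elim disjE)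
    assume "g ` P = corner 3 a (b - a)"
    then have "{a, b, c} = {a, b, a + (b - a) * nu^2}" using gP by (simp add: corner_def)
    then have "c = a + (b - a) * nu^2" using dist by blast
    moreover define s where "s = (b - a) / d"
    define f where "f = (\<lambda>z. (a - s * v0) + s * z)"
    have "cmod s = 1" using l d0 by (simp add: s_def norm_divide)
    then have "direct_iso f" unfolding direct_iso_def f_def by blast
    moreover have "f v0 = a" by (simp add: f_def)
    moreover have "f (v0 + d * w) = a + (b - a) * w" for w using d0 by (simp add: f_def s_def field_simps)
    from this[of 1] this[of "nu^2"] have "f (v0 + d) = b" "f (v0 + d * nu^2) = a + (b - a) * nu^2" by simp_all
    ultimately have "\<forall>z\<in>P. g z = f z" "direct_iso f" by (simp_all add: P_def corner_def a_def b_def c_def)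
    then show ?thesis by blast
  next
    assume "g ` P = corner 3 b (a - b)"
    then have "{a, b, c} = {b, a, b + (a - b) * nu^2}" using gP by (simp add: corner_def)
    then have "c = b + (a - b) * nu^2" using dist by blast
    then have c: "c = a + (b - a) * (1 - nu^2)" by (simp add: algebra_simps)
    define s where "s = (b - a) / cnj d"
    define f where "f = (\<lambda>z. (a - s * cnj v0) + s * cnj z)"
    have "cmod s = 1" using l d0 by (simp add: s_def norm_divide)
    then have "indirect_iso f" unfolding indirect_iso_def f_def by blast
    moreover have "f v0 = a" by (simp add: f_def)
    moreover have fw: "f (v0 + d * w) = a + (b - a) * cnj w" for w using d0 by (simp add: f_def s_def field_simps)
    have "f (v0 + d) = b" using fw[of 1] by simp
    moreover have "f (v0 + d * nu^2) = a + (b - a) * (1 - nu^2)" using fw[of "nu^2"] unfolding n2 .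
    ultimately have "\<forall>z\<in>P. g z = f z" "indirect_iso f" using c by (simp_all add: P_def corner_def a_def b_def c_def)
    then show ?thesis by blast
  qed
  then obtain f where f: "direct_iso f \<or> indirect_iso f" "\<forall>z\<in>P. g z = f z" by blast
  have all: "{P \<in> T. \<forall>z\<in>P. g z = f z} = T"
  proof (rule edge_connected)
    have "P \<in> {P \<in> T. \<forall>z\<in>P. g z = f z}" using f(2) PT by simp
    then show "{P \<in> T. \<forall>z\<in>P. g z = f z} \<noteq> {}" by (metis empty_iff)
    fix P Q e assume PQ: "P \<in> {P \<in> T. \<forall>z\<in>P. g z = f z}" "Q \<in> T" "poly_edge P e" "poly_edge Q e"
    obtain a b where "e = {a, b}" using PQ(3) unfolding poly_edge_def by blast
    then show "Q \<in> {P \<in> T. \<forall>z\<in>P. g z = f z}" using aut_isometry_step[OF g f(1)] PQ by blast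
  qed auto
  have "f ` P \<in> T" if "P \<in> T" for P
  proof -
    have "\<forall>z\<in>P. g z = f z" using all that by blast
    then have "f ` P = g ` P" by (metis image_cong)
    then show ?thesis using aut_props(2)[OF g that] by simp
  qed
  moreover have "g z = f z" if "z \<in> tvertices T" for z using all that by (auto simp: tvertices_def)
  ultimately show ?thesis using that f(1) by blast
qed

end

subsection \<open>Free actions with torus quotient\<close>


text \<open>A group of homeomorphisms whose nontrivial elements displace every point by at least
  \<open>eps\<close>. This uniform bound is what makes \<open>q\<close> a covering.\<close>

locale torus_action =
  fixes F :: "(complex \<Rightarrow> complex) set" and q :: "complex \<Rightarrow> complex \<times> complex" and eps :: real
  assumes cont: "\<And>f. f \<in> F \<Longrightarrow> continuous_on UNIV f"
    and id_in: "(\<lambda>z. z) \<in> F"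
    and comp_in: "\<And>f g. f \<in> F \<Longrightarrow> g \<in> F \<Longrightarrow> (\<lambda>z. f (g z)) \<in> F"
    and inv_in: "\<And>f. f \<in> F \<Longrightarrow> \<exists>g\<in>F. (\<forall>z. g (f z) = z) \<and> (\<forall>z. f (g z) = z)"
    and eps: "eps > 0" "\<And>f z. f \<in> F \<Longrightarrow> f \<noteq> (\<lambda>z. z) \<Longrightarrow> eps \<le> dist (f z) z"
    and q: "quotient_map euclidean (top_of_set torus) q"
    and fibres: "\<And>x y. q x = q y \<longleftrightarrow> (\<exists>f\<in>F. y = f x)"
begin

lemma q_continuous: "continuous_on UNIV q"
  using quotient_imp_continuous_map[OF q] by (simp add: continuous_map_in_subtopology)

lemma q_range: "q ` UNIV = torus" "q z \<in> torus"
  using q by (auto simp: quotient_map_def)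

lemma image_open: assumes "f \<in> F" "open U" shows "open (f ` U)"
proof -
  obtain g where g: "g \<in> F" "\<forall>z. g (f z) = z" "\<forall>z. f (g z) = z" using inv_in[OF assms(1)] by blast
  have "f ` U = g -` U" using g by (auto simp: image_iff) metis
  then show ?thesis using continuous_open_vimage[OF assms(2), of g] cont[OF g(1)] by (simp add: continuous_on_eq_continuous_at)
qed

lemma preimage_image: "{x. q x \<in> q ` U} = (\<Union>f\<in>F. f ` U)"
proof (intro set_eqI iffI)
  fix x assume "x \<in> {x. q x \<in> q ` U}"
  then obtain u where "u \<in> U" "q u = q x" by auto
  then show "x \<in> (\<Union>f\<in>F. f ` U)" using fibres by blast
next
  fix x assume "x \<in> (\<Union>f\<in>F. f ` U)"
  then obtain u where "u \<in> U" "q u = q x" using fibres by blast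
  then have "q x \<in> q ` U" by (metis imageI)
  then show "x \<in> {x. q x \<in> q ` U}" by simp
qed

lemma q_open: assumes "open U" shows "openin (top_of_set torus) (q ` U)"
proof -
  have "open {x. q x \<in> q ` U}" unfolding preimage_image using image_open assms by blast
  moreover have "q ` U \<subseteq> torus" using q_range by auto
  ultimately show ?thesis using q by (auto simp: quotient_map_def)
qed

lemma inj_F: "f \<in> F \<Longrightarrow> inj f"
  using inv_in by (metis injI)

lemma q_covering: "covering_space UNIV q torus"
  unfolding covering_space_def
proof (intro conjI ballI)
  fix x assume "x \<in> torus"
  then obtain z where z: "x = q z" using q_range(1) by auto
  define U where "U = ball z (eps / 2)"
  \<comment> \<open>Two points of a ball of radius \<open>eps / 2\<close> are closer than
    \<open>eps\<close>, so distinct group elements give disjoint images of the ball.\<close>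
  have disj: "f = g" if "f \<in> F" "g \<in> F" "u \<in> U" "v \<in> U" "f u = g v" for f g u v
  proof -
    obtain g' where g': "g' \<in> F" "\<forall>z. g' (g z) = z" "\<forall>z. g (g' z) = z" using inv_in[OF \<open>g \<in> F\<close>] by blast
    have "g' (f u) = v" using that(5) g' by simp
    then have "dist (g' (f u)) u < eps" using that(3,4) dist_triangle_half_r[of z v eps u]
      by (auto simp: U_def dist_commute)
    then have "(\<lambda>z. g' (f z)) = (\<lambda>z. z)" using eps(2)[OF comp_in[OF g'(1) that(1)], of u] by fastforce
    then have "g (g' (f w)) = g w" for w by metis
    then show "f = g" using g' by auto
  qed
  show "\<exists>T. x \<in> T \<and> openin (top_of_set torus) T \<and> (\<exists>v. \<Union>v = UNIV \<inter> q -` T \<and>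
        (\<forall>u\<in>v. openin (top_of_set UNIV) u) \<and> pairwise disjnt v \<and> (\<forall>u\<in>v. \<exists>r. homeomorphism u T q r))"
  proof (intro exI[of _ "q ` U"] exI[of _ "(\<lambda>f. f ` U) ` F"] conjI)
    have "z \<in> U" using eps(1) by (simp add: U_def)
    then show "x \<in> q ` U" using z by simp
    show "openin (top_of_set torus) (q ` U)" by (rule q_open) (simp add: U_def)
    show "\<Union> ((\<lambda>f. f ` U) ` F) = UNIV \<inter> q -` q ` U" unfolding preimage_image[symmetric] by auto
    show "\<forall>u\<in>(\<lambda>f. f ` U) ` F. openin (top_of_set UNIV) u" using image_open by (auto simp: U_def)
    show "pairwise disjnt ((\<lambda>f. f ` U) ` F)" using disj by (auto simp: pairwise_def disjnt_def) blast+
    show "\<forall>u\<in>(\<lambda>f. f ` U) ` F. \<exists>r. homeomorphism u (q ` U) q r"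
    proof (clarify)
      fix f assume f: "f \<in> F"
      have of: "open (f ` U)" by (rule image_open[OF f]) (simp add: U_def)
      have qf: "q (f u) = q u" for u using fibres f by metis
      have "inj_on q (f ` U)"
      proof (rule inj_onI, clarify)
        fix u v assume uv: "u \<in> U" "v \<in> U" "q (f u) = q (f v)"
        then obtain g where g: "g \<in> F" "v = g u" using qf fibres by metis
        then have "g = (\<lambda>z. z)" using disj[OF g(1) id_in uv(1,2)] by simp
        then show "f u = f v" using g by simp
      qed
      moreover have "q ` f ` U = q ` U" using qf by (auto simp: image_image)
      moreover have "openin (top_of_set (q ` U)) (q ` V)" if "openin (top_of_set (f ` U)) V" for V
      proof -
        have "open V" "V \<subseteq> f ` U" using that of openin_open_eq by auto
        then show ?thesis using openin_subset_trans[OF q_open[OF \<open>open V\<close>], of "q ` U"] q_range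
          \<open>q ` f ` U = q ` U\<close> by blast
      qed
      moreover have "continuous_on (f ` U) q" using continuous_on_subset[OF q_continuous] by simp
      ultimately show "\<exists>r. homeomorphism (f ` U) (q ` U) q r"
        using homeomorphism_injective_open_map[of "f ` U" q "q ` U"] by metis
    qed
  qed
qed (use q_continuous q_range in auto)

section \<open>Comparison with the standard covering of the torus\<close>

lemma cis_eqD: "cis x = cis y \<Longrightarrow> \<exists>n::int. x = y + 2 * pi * n"
  using sin_cos_eq_iff[of x y] by (simp add: complex_eq_iff)

definition ex :: "complex \<Rightarrow> complex \<times> complex" where "ex w = (cis (Re w), cis (Im w))"

text \<open>Coordinates in a fibre of \<open>ex\<close> differ by multiples of
  \<open>2 * pi\<close>; the crude bound 1 is enough for discreteness.\<close>

lemma ex_eqD: assumes "ex w = ex w'" "w \<noteq> w'" shows "1 \<le> cmod (w - w')"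
proof -
  obtain m n :: int where mn: "Re w = Re w' + 2 * pi * m" "Im w = Im w' + 2 * pi * n"
    using assms(1) cis_eqD unfolding ex_def by (metis prod.inject)
  have big: "1 \<le> \<bar>2 * pi * real_of_int j\<bar>" if "j \<noteq> 0" for j
  proof -
    have "1 \<le> \<bar>real_of_int j\<bar>" using that by linarith
    then have "1 * 1 \<le> (2 * pi) * \<bar>real_of_int j\<bar>" using pi_gt3 by (intro mult_mono) auto
    then show ?thesis by (simp add: abs_mult)
  qed
  have "m \<noteq> 0 \<or> n \<noteq> 0" using mn assms(2) by (auto simp: complex_eq_iff)
  then show ?thesis
  proof
    assume "m \<noteq> 0"
    then have "1 \<le> \<bar>Re (w - w')\<bar>" using mn big by simp
    then show ?thesis using abs_Re_le_cmod[of "w - w'"] by linarith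
  next
    assume "n \<noteq> 0"
    then have "1 \<le> \<bar>Im (w - w')\<bar>" using mn big by simp
    then show ?thesis using abs_Im_le_cmod[of "w - w'"] by linarith
  qed
qed

text \<open>The plane is contractible, so \<open>p\<close> has a continuous logarithm, whose real
  part vanishes because \<open>p\<close> has modulus 1.\<close>

lemma circle_lift:
  assumes "continuous_on UNIV p" "\<And>z. cmod (p z) = 1"
  obtains g where "continuous_on UNIV g" "\<And>z::complex. p z = cis (g z)"
proof -
  have "contractible (UNIV :: complex set)" by (simp add: convex_imp_contractible)
  moreover have "p z \<noteq> 0" for z using assms(2)[of z] by auto
  ultimately obtain g where g: "continuous_on UNIV g" "\<And>z. p z = exp (g z)"
    using continuous_logarithm_on_contractible[OF assms(1)] by (metis UNIV_I)
  have "p z = cis (Im (g z))" for z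
  proof -
    have "exp (Re (g z)) = 1" using assms(2)[of z] g(2) by simp
    then show ?thesis using g(2) exp_eq_polar[of "g z"] by simp
  qed
  moreover have "continuous_on UNIV (\<lambda>z. Im (g z))" using g by (intro continuous_intros)
  ultimately show ?thesis using that by blast
qed

text \<open>Both the action quotient q and the standard covering are universal coverings of the torus;
  lifting each through the other conjugates the action into the group of translations.\<close>
lemma commute:
  assumes "f \<in> F" "g \<in> F" shows "f (g z) = g (f z)"
proof -
  have qc: "continuous_on UNIV (\<lambda>z. fst (q z))" "continuous_on UNIV (\<lambda>z. snd (q z))"
    using q_continuous by (auto intro: continuous_intros)
  have q1: "cmod (fst (q z)) = 1" "cmod (snd (q z)) = 1" for z
    using q_range(2)[of z] by (auto simp: torus_def)
  obtain k1 where k1: "continuous_on UNIV k1" "\<And>z. fst (q z) = cis (k1 z)"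
    using circle_lift[OF qc(1) q1(1)] by metis
  obtain k2 where k2: "continuous_on UNIV k2" "\<And>z. snd (q z) = cis (k2 z)"
    using circle_lift[OF qc(2) q1(2)] by metis
  define k where "k z = Complex (k1 z) (k2 z)" for z
  have kc: "continuous_on UNIV k" unfolding k_def using k1 k2 by (intro continuous_intros)
  have ek: "ex (k z) = q z" for z using k1(2)[of z] k2(2)[of z] by (simp add: ex_def k_def prod_eq_iff)
  have exc: "continuous_on UNIV ex" unfolding ex_def by (intro continuous_intros)
  have ext: "ex \<in> UNIV \<rightarrow> torus" by (auto simp: ex_def torus_def)
  have "simply_connected (UNIV :: complex set)" by (simp add: convex_imp_simply_connected)
  moreover have "locally path_connected (UNIV :: complex set)" by (simp add: locally_path_connected_UNIV)
  ultimately obtain h where h: "continuous_on UNIV h" "\<And>w. q (h w) = ex w"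
    using covering_space_lift[OF q_covering _ _ exc ext] by (metis UNIV_I)
  have qhk: "q (h (k z)) = q z" for z using h(2) ek by simp
  then obtain u where u: "u \<in> F" "h (k 0) = u 0" using fibres by metis
  have qu: "q (u z) = q z" for z using fibres u(1) by metis
  have hkc: "continuous_on UNIV (\<lambda>z. h (k z))"
    using continuous_on_compose2[OF h(1) kc] by simp
  \<comment> \<open>\<open>h\<close> after \<open>k\<close> and \<open>u\<close> both lift
    \<open>q\<close> through \<open>q\<close> and agree at 0, so they are equal. As \<open>u\<close>
    is injective, so is \<open>k\<close>.\<close>
  have hk: "h (k z) = u z" for z
  proof (rule covering_space_lift_unique[OF q_covering, where a = 0 and T = UNIV and f = q and x = z
        and ?g1.0 = "\<lambda>z. h (k z)" and ?g2.0 = u])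
    show "h (k 0) = u 0" by (rule u(2))
    show "continuous_on UNIV q" by (rule q_continuous)
    show "continuous_on UNIV (\<lambda>z. h (k z))" by (rule hkc)
    show "continuous_on UNIV u" by (rule cont[OF u(1)])
    show "q x = q (h (k x))" "q x = q (u x)" for x by (simp_all only: qhk qu)
    show "q \<in> UNIV \<rightarrow> torus" using q_range(2) by blast
  qed (simp_all add: connected_UNIV)
  have k_inj: "x = y" if "k x = k y" for x y
  proof -
    have "u x = u y" unfolding hk[symmetric] that ..
    then show ?thesis using inj_F[OF u(1)] by (rule injD[rotated])
  qed
  \<comment> \<open>The difference \<open>k (f z) - k z\<close> varies continuously inside the
    discrete fibre of \<open>ex\<close> over \<open>ex 0\<close>, hence is constant:
    \<open>k\<close> turns \<open>f\<close> into a translation.\<close>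
  have const: "\<exists>c. \<forall>z. k (f z) = k z + c" if f: "f \<in> F" for f
  proof -
    have e: "ex (k (f z)) = ex (k z)" for z unfolding ek using fibres f by metis
    have ex_shift: "ex (a - b) = ex 0" if "ex a = ex b" for a b
      using that by (simp add: ex_def flip: cis_divide)
    define D where "D z = k (f z) - k z" for z
    have eD: "ex (D z) = ex 0" for z unfolding D_def using ex_shift[OF e] .
    have "D constant_on UNIV"
    proof (rule continuous_discrete_range_constant)
      show "continuous_on UNIV D" unfolding D_def
        using continuous_on_compose2[OF kc cont[OF f]] kc by (intro continuous_intros) auto
      show "\<exists>e>0. \<forall>y. y \<in> UNIV \<and> D y \<noteq> D x \<longrightarrow> e \<le> norm (D y - D x)" for x
        using ex_eqD eD by (intro exI[of _ 1]) auto
    qed (rule connected_UNIV)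
    then obtain c where "\<And>z. D z = c" by (auto simp: constant_on_def)
    then have "k (f z) = k z + c" for z by (simp add: D_def algebra_simps)
    then show ?thesis by blast
  qed
  obtain c c' where "\<And>z. k (f z) = k z + c" "\<And>z. k (g z) = k z + c'" using const assms by metis
  then have "k (f (g z)) = k (g (f z))" by (simp add: add_ac)
  then show ?thesis by (rule k_inj)
qed

lemma compact_torus: "compact torus"
proof -
  have "torus = sphere 0 1 \<times> sphere 0 1" by (auto simp: torus_def)
  then show ?thesis using compact_Times[of "sphere (0::complex) 1" "sphere (0::complex) 1"] by (simp only: compact_sphere)
qed

text \<open>An invariant continuous function descends to the compact torus.\<close>

lemma invariant_bounded:
  fixes D :: "complex \<Rightarrow> real"
  assumes "continuous_on UNIV D" "\<And>f z. f \<in> F \<Longrightarrow> D (f z) = D z"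
  obtains B where "\<And>z. \<bar>D z\<bar> \<le> B"
proof -
  have "continuous_map euclidean euclidean D" using assms(1) by simp
  moreover have "D x = D y" if "q x = q y" for x y using that fibres assms(2) by metis
  ultimately obtain E where E: "continuous_map (top_of_set torus) euclidean E" "\<And>x. E (q x) = D x"
    using quotient_map_lift_exists[OF q, of euclidean D] by (metis UNIV_I topspace_euclidean)
  then have "compact (E ` torus)" using compact_torus by (simp add: compact_continuous_image)
  then obtain B where "\<forall>x\<in>E ` torus. norm x \<le> B" using compact_imp_bounded bounded_iff by metis
  then have "\<bar>D z\<bar> \<le> B" for z using E(2)[of z] q_range(2)[of z] by force
  then show ?thesis using that by blast
qed

lemma no_indirect:
  assumes iso: "\<And>f. f \<in> F \<Longrightarrow> direct_iso f \<or> indirect_iso f"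
    and transl: "\<And>f. f \<in> F \<Longrightarrow> direct_iso f \<Longrightarrow> \<exists>b. f = (\<lambda>z. z + b)"
    and f: "f \<in> F" "indirect_iso f"
  shows False
proof -
  obtain s c where s: "cmod s = 1" and fs: "f = (\<lambda>z. c + s * cnj z)" using f(2) by (auto simp: indirect_iso_def)
  \<comment> \<open>A unit vector along the axis of \<open>f\<close>: reflection in a line of
    direction \<open>r\<close> has linear part \<open>r * r * cnj z\<close>.\<close>
  define r where "r = csqrt s"
  have r2: "r * r = s" using power2_csqrt[of s] by (simp add: r_def power2_eq_square)
  have r1: "cmod r = 1" using s by (simp add: r_def)
  then have r0: "r \<noteq> 0" by auto
  have rc: "r * cnj r = 1" using complex_norm_square[of r] r1 by simp
  then have ri: "1 / r = cnj r" using r0 by (simp add: field_simps)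
  \<comment> \<open>Offset of the axis: it is the line \<open>Im (z * cnj r) = h\<close>, and
    \<open>D\<close> is the distance to it.\<close>
  define h where "h = Im (c * cnj r) / 2"
  define D where "D z = \<bar>Im (z * cnj r) - h\<bar>" for z
  have Df: "D (f z) = D z" for z
  proof -
    have "f z * cnj r = c * cnj r + (r * cnj r) * (r * cnj z)" by (simp add: fs algebra_simps flip: r2)
    then have "f z * cnj r = c * cnj r + cnj (z * cnj r)" using rc by (simp add: mult.commute)
    then have "Im (f z * cnj r) = Im (c * cnj r) - Im (z * cnj r)"
      by (simp only: plus_complex.sel cnj.sel diff_conv_add_uminus)
    then have "Im (f z * cnj r) = 2 * h - Im (z * cnj r)" by (simp add: h_def)
    then show ?thesis by (simp add: D_def)
  qed
  have Dt: "D (z + b) = D z" if "(\<lambda>z. z + b) \<in> F" for z b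
  proof -
    have "f (0 + b) = f 0 + b" using commute[OF f(1) that] .
    \<comment> \<open>Commuting with \<open>f\<close> means that \<open>b\<close> is fixed by the
      linear part of \<open>f\<close>, so \<open>b\<close> is parallel to the axis.\<close>
    then have b: "s * cnj b = b" by (simp add: fs)
    have "b * cnj r = r * cnj b * (r * cnj r)" using b by (simp add: r2[symmetric] mult_ac)
    then have "b * cnj r = cnj (b * cnj r)" using rc by (simp add: mult.commute)
    then have "Im (b * cnj r) = 0" by (metis Im_complex_of_real Reals_cnj_iff complex_is_Real_iff)
    then show ?thesis by (simp add: D_def distrib_right)
  qed
  have inv: "D (g z) = D z" if g: "g \<in> F" for g z
    using iso[OF g]
  proof
    assume "direct_iso g"
    then obtain b where "g = (\<lambda>z. z + b)" using transl[OF g] by blast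
    then show ?thesis using Dt g by auto
  next
    assume "indirect_iso g"
    then obtain s' c' where s': "cmod s' = 1" "g = (\<lambda>z. c' + s' * cnj z)" by (auto simp: indirect_iso_def)
    obtain f' where f': "\<forall>z. f (f' z) = z" using inv_in[OF f(1)] by blast
    \<comment> \<open>Composing with \<open>f\<close> makes \<open>g\<close> direct, hence a
      translation, which reduces this case to the previous ones.\<close>
    have gf: "(\<lambda>z. g (f z)) \<in> F" using comp_in[OF g f(1)] .
    have "(\<lambda>z. g (f z)) = (\<lambda>z. (c' + s' * cnj c) + (s' * cnj s) * z)" by (simp add: s'(2) fs algebra_simps)
    moreover have "cmod (s' * cnj s) = 1" using s s' by (simp add: norm_mult)
    ultimately have "direct_iso (\<lambda>z. g (f z))" unfolding direct_iso_def by blast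
    then obtain b where b: "(\<lambda>z. g (f z)) = (\<lambda>z. z + b)" using transl[OF gf] by blast
    have "D (g z) = D (g (f (f' z)))" using f' by simp
    also have "\<dots> = D (f' z + b)" using b by metis
    also have "\<dots> = D (f' z)" using Dt gf b by metis
    also have "\<dots> = D (f (f' z))" by (rule Df[symmetric])
    finally show ?thesis using f' by simp
  qed
  have "continuous_on UNIV D" unfolding D_def by (intro continuous_intros)
  then obtain B where B: "\<And>z. \<bar>D z\<bar> \<le> B" using invariant_bounded[of D] inv by blast
  define z where "z = r * (\<i> * of_real (\<bar>h\<bar> + \<bar>B\<bar> + 1))"
  have "z * cnj r = \<i> * of_real (\<bar>h\<bar> + \<bar>B\<bar> + 1)" using rc by (simp add: z_def mult_ac)
  then have "D z = \<bar>\<bar>h\<bar> + \<bar>B\<bar> + 1 - h\<bar>" by (simp add: D_def)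
  then show False using B[of z] by linarith
qed

end

subsection \<open>The deck group\<close>


context hexagon_tiling begin

lemma base_points: "v0 \<in> tvertices T" "v0 + d \<in> tvertices T" "v0 + d * nu^2 \<in> tvertices T"
proof -
  have "corner 3 v0 d \<in> T" using vA_tiles[OF v0] by (simp add: starA_def)
  then show "v0 \<in> tvertices T" "v0 + d \<in> tvertices T" "v0 + d * nu^2 \<in> tvertices T"
    using in_tverticesI in_corner by blast+
qed

lemma direct_not_identity:
  assumes "direct_iso f" "f \<noteq> (\<lambda>z. z)" obtains z where "f z = z" | b where "b \<noteq> 0" "f = (\<lambda>z. z + b)"
proof -
  obtain s c where f: "f = (\<lambda>z. c + s * z)" using assms(1) by (auto simp: direct_iso_def)
  show ?thesis
  proof (cases "s = 1")
    case True
    then have "f = (\<lambda>z. z + c)" using f by (simp add: add.commute)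
    moreover from this have "c \<noteq> 0" using assms(2) by auto
    ultimately show ?thesis using that(2) by blast
  next
    case False
    then have "c + s * (c / (1 - s)) = c / (1 - s)" by (simp add: field_simps)
    then show ?thesis using that(1) f by blast
  qed
qed

text \<open>Three non-collinear vertices are fixed; an indirect isometry doing so would give
  \<open>cnj (nu^2) = nu^2\<close>.\<close>

lemma identity_on_vertices:
  assumes "direct_iso f \<or> indirect_iso f" "\<And>z. z \<in> tvertices T \<Longrightarrow> f z = z"
  shows "f = (\<lambda>z. z)"
proof -
  have e: "f v0 = v0" "f (v0 + d) = v0 + d" "f (v0 + d * nu^2) = v0 + d * nu^2" using assms(2) base_points by auto
  from assms(1) show ?thesis
  proof
    assume "direct_iso f"
    then obtain s c where f: "f = (\<lambda>z. c + s * z)" by (auto simp: direct_iso_def)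
    have "c + s * v0 = v0" "c + s * (v0 + d) = v0 + d" using e f by auto
    then have "v0 + s * d = v0 + d" by (metis add.assoc distrib_left)
    then have s: "s = 1" using d0 by simp
    then have "c = 0" using \<open>c + s * v0 = v0\<close> by simp
    then show ?thesis using f s by simp
  next
    assume "indirect_iso f"
    then obtain s c where f: "f = (\<lambda>z. c + s * cnj z)" by (auto simp: indirect_iso_def)
    have 1: "c + s * cnj v0 = v0" "c + s * (cnj v0 + cnj d) = v0 + d"
      "c + s * (cnj v0 + cnj d * cnj (nu^2)) = v0 + d * nu^2" using e unfolding f complex_cnj_add complex_cnj_mult by auto
    then have "v0 + s * cnj d = v0 + d" "v0 + s * (cnj d * cnj (nu^2)) = v0 + d * nu^2"
      by (metis add.assoc distrib_left)+
    then have "s * cnj d = d" "s * (cnj d * cnj (nu^2)) = d * nu^2" by (simp_all only: add_left_cancel)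
    then have "d * cnj (nu^2) = d * nu^2" by (metis mult.assoc)
    then have "cnj (nu^2) = nu^2" using d0 by (simp del: complex_cnj_power)
    then show ?thesis by (simp add: nu_sq complex_eq_iff del: complex_cnj_power)
  qed
qed

lemma isolated_vertex: obtains eps where "eps > 0" "\<And>y. y \<in> tvertices T \<Longrightarrow> y \<noteq> v0 \<Longrightarrow> eps \<le> dist v0 y"
proof -
  define N where "N = {P \<in> T. convex hull P \<inter> cball v0 1 \<noteq> {}}"
  have "finite N" unfolding N_def using e2e_locally_finite[OF e2e compact_cball] .
  then have "finite (\<Union> N)" using tile_finite by (auto simp: N_def)
  then obtain e where e: "e > 0" "\<forall>x\<in>\<Union> N. x \<noteq> v0 \<longrightarrow> e \<le> dist v0 x" using finite_set_avoid by blast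
  show ?thesis
  \<comment> \<open>Local finiteness controls vertices within distance 1; all others are at distance
    more than 1.\<close>
  proof (rule that[of "min e 1"])
    fix y assume y: "y \<in> tvertices T" "y \<noteq> v0"
    then obtain P where P: "P \<in> T" "y \<in> P" by (auto simp: tvertices_def)
    show "min e 1 \<le> dist v0 y"
    proof (cases "dist v0 y \<le> 1")
      case True
      then have "y \<in> convex hull P \<inter> cball v0 1" using P by (simp add: hull_inc)
      then have "P \<in> N" using P by (auto simp: N_def)
      then show ?thesis using e y P by force
    qed simp
  qed (use e in simp)
qed

end

locale torus_quotient_tiling = hexagon_tiling +
  fixes G :: "(complex \<Rightarrow> complex) set"
  assumes G: "torus_quotient T G"
begin

text \<open>Elements of \<open>G\<close> are the identity off the vertex set, so they do not act
  geometrically on the plane; \<open>deck\<close> collects their extensions to isometries.\<close>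

definition deck :: "(complex \<Rightarrow> complex) set" where
  "deck = {f. (direct_iso f \<or> indirect_iso f) \<and> (\<exists>g\<in>G. \<forall>z\<in>tvertices T. f z = g z)}"

lemma G_sub: "aut_subgroup T G" and G_free: "acts_freely T G" and G_torus: "quotient_is_torus T G"
  using G by (auto simp: torus_quotient_def)

lemma G_aut: "g \<in> G \<Longrightarrow> map_aut (tiling_map T) g" "g \<in> G \<Longrightarrow> x \<notin> tvertices T \<Longrightarrow> g x = x"
    and G_id: "id \<in> G" and G_comp: "g \<in> G \<Longrightarrow> h \<in> G \<Longrightarrow> g \<circ> h \<in> G"
    and G_inv: "g \<in> G \<Longrightarrow> \<exists>h\<in>G. h \<circ> g = id"
  using G_sub by (simp_all add: aut_subgroup_def)

lemma G_vertex: "g \<in> G \<Longrightarrow> z \<in> tvertices T \<Longrightarrow> g z \<in> tvertices T"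
  using aut_props(1)[OF G_aut(1)] bij_betwE by blast

lemma deck_iso: "f \<in> deck \<Longrightarrow> direct_iso f \<or> indirect_iso f" by (simp add: deck_def)

lemma deck_of_G: assumes "g \<in> G" obtains f where "f \<in> deck" "\<And>z. z \<in> tvertices T \<Longrightarrow> f z = g z"
proof -
  obtain f where f: "direct_iso f \<or> indirect_iso f" "\<And>z. z \<in> tvertices T \<Longrightarrow> g z = f z"
    using aut_isometry[OF G_aut(1)[OF assms]] by metis
  have "f \<in> deck" unfolding deck_def
  proof (intro CollectI conjI bexI)
    show "\<forall>z\<in>tvertices T. f z = g z" using f(2) by simp
  qed (use f(1) assms in simp_all)
  then show ?thesis using that f(2) by simp
qed

lemma deck_tile: assumes "f \<in> deck" "P \<in> T" shows "f ` P \<in> T"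
proof -
  obtain g where g: "g \<in> G" "\<forall>z\<in>tvertices T. f z = g z" using assms by (auto simp: deck_def)
  have "f ` P = g ` P" using g(2) in_tverticesI[OF assms(2)] by (intro image_cong) auto
  then show ?thesis using aut_props(2)[OF G_aut(1)[OF g(1)] assms(2)] by simp
qed

lemma deck_id: "(\<lambda>z. z) \<in> deck"
proof -
  have "direct_iso (\<lambda>z. z)" unfolding direct_iso_def by (intro exI[of _ 1] exI[of _ 0]) simp
  then show ?thesis using G_id by (auto simp: deck_def intro!: bexI[of _ id])
qed

lemma iso_comp:
  assumes "direct_iso f \<or> indirect_iso f" "direct_iso g \<or> indirect_iso g"
  shows "direct_iso (\<lambda>z. f (g z)) \<or> indirect_iso (\<lambda>z. f (g z))"
proof -
  have 1: "direct_iso (\<lambda>z. c + s * (c' + s' * z))" if "cmod s = 1" "cmod s' = 1" for c s c' s'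
    unfolding direct_iso_def using that by (intro exI[of _ "s * s'"] exI[of _ "c + s * c'"]) (simp add: norm_mult algebra_simps)
  have 2: "indirect_iso (\<lambda>z. c + s * (c' + s' * cnj z))" if "cmod s = 1" "cmod s' = 1" for c s c' s'
    unfolding indirect_iso_def using that by (intro exI[of _ "s * s'"] exI[of _ "c + s * c'"]) (simp add: norm_mult algebra_simps)
  have 3: "indirect_iso (\<lambda>z. c + s * cnj (c' + s' * z))" if "cmod s = 1" "cmod s' = 1" for c s c' s'
    unfolding indirect_iso_def using that by (intro exI[of _ "s * cnj s'"] exI[of _ "c + s * cnj c'"]) (simp add: norm_mult algebra_simps)
  have 4: "direct_iso (\<lambda>z. c + s * cnj (c' + s' * cnj z))" if "cmod s = 1" "cmod s' = 1" for c s c' s'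
    unfolding direct_iso_def using that by (intro exI[of _ "s * cnj s'"] exI[of _ "c + s * cnj c'"]) (simp add: norm_mult algebra_simps)
  obtain s c s' c' where s: "cmod s = 1" "cmod s' = 1" and f: "f = (\<lambda>z. c + s * z) \<or> f = (\<lambda>z. c + s * cnj z)"
    and g: "g = (\<lambda>z. c' + s' * z) \<or> g = (\<lambda>z. c' + s' * cnj z)"
    using assms unfolding direct_iso_def indirect_iso_def by metis
  show ?thesis using f g 1[OF s] 2[OF s] 3[OF s] 4[OF s] by (elim disjE) auto
qed

lemma deck_comp: assumes "f \<in> deck" "g \<in> deck" shows "(\<lambda>z. f (g z)) \<in> deck"
proof -
  obtain f' g' where "f' \<in> G" "\<forall>z\<in>tvertices T. f z = f' z" "g' \<in> G" "\<forall>z\<in>tvertices T. g z = g' z"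
    using assms by (auto simp: deck_def)
  then have "f' \<circ> g' \<in> G" "\<forall>z\<in>tvertices T. f (g z) = (f' \<circ> g') z" using G_comp G_vertex by auto
  then show ?thesis using iso_comp[OF deck_iso[OF assms(1)] deck_iso[OF assms(2)]] unfolding deck_def by blast
qed

lemma deck_unique: assumes "f \<in> deck" "\<And>z. z \<in> tvertices T \<Longrightarrow> f z = z" shows "f = (\<lambda>z. z)"
  using identity_on_vertices[OF deck_iso[OF assms(1)] assms(2)] .

lemma deck_inv: assumes "f \<in> deck" shows "\<exists>g\<in>deck. (\<forall>z. g (f z) = z) \<and> (\<forall>z. f (g z) = z)"
proof -
  obtain f' where f': "f' \<in> G" "\<forall>z\<in>tvertices T. f z = f' z" using assms by (auto simp: deck_def)
  obtain g' where g': "g' \<in> G" "g' \<circ> f' = id" using G_inv[OF f'(1)] by blast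
  obtain h' where h': "h' \<in> G" "h' \<circ> g' = id" using G_inv[OF g'(1)] by blast
  \<comment> \<open>Only left inverses are given; a left inverse of the left inverse is the original
    element, so the inverse is two-sided.\<close>
  have "h' = f'" using g'(2) h'(2) by (metis comp_assoc comp_id id_comp)
  obtain g where g: "g \<in> deck" "\<And>z. z \<in> tvertices T \<Longrightarrow> g z = g' z" using deck_of_G[OF g'(1)] by metis
  have "(\<lambda>z. g (f z)) = (\<lambda>z. z)"
    using deck_unique[OF deck_comp[OF g(1) assms]] g f' g'(2) G_vertex by (metis comp_apply id_apply)
  moreover have "(\<lambda>z. f (g z)) = (\<lambda>z. z)"
    using deck_unique[OF deck_comp[OF assms g(1)]] g f' g'(1) h'(2) \<open>h' = f'\<close> G_vertex by (metis comp_apply id_apply)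
  ultimately show ?thesis using g(1) by metis
qed

lemma deck_free: assumes "f \<in> deck" "f z = z" shows "f = (\<lambda>z. z)"
proof -
  obtain g where g: "g \<in> G" "\<forall>z\<in>tvertices T. f z = g z" using assms by (auto simp: deck_def)
  have "(\<exists>v\<in>tvertices T. f v = v) \<or> (\<exists>e\<in>tedges T. f ` e = e) \<or> (\<exists>P\<in>T. f ` P = P)"
    using fixed_point_fixes_cell[OF deck_iso[OF assms(1)] deck_tile[OF assms(1)] assms(2)] .
  moreover have "f ` e = g ` e" if "e \<in> tedges T" for e
    using that g(2) in_tverticesI unfolding tedges_eq by auto
  moreover have "f ` P = g ` P" if "P \<in> T" for P
    using that g(2) in_tverticesI by (intro image_cong) auto
  ultimately have "(\<exists>v\<in>tvertices T. g v = v) \<or> (\<exists>e\<in>tedges T. g ` e = e) \<or> (\<exists>P\<in>T. g ` P = P)"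
    using g(2) by metis
  then have "g = id" using G_free g(1) unfolding acts_freely_def by blast
  then show ?thesis using deck_unique[OF assms(1)] g(2) by simp
qed

lemma deck_direct: assumes "f \<in> deck" "direct_iso f" shows "\<exists>b. f = (\<lambda>z. z + b)"
proof (cases "f = (\<lambda>z. z)")
  case True
  then show ?thesis by (intro exI[of _ 0]) simp
next
  case False
  then show ?thesis using direct_not_identity[OF assms(2) False] deck_free[OF assms(1)] by metis
qed

text \<open>A translation moves \<open>v0\<close> to another vertex, so by at least the isolation
  distance. The square of an indirect \<open>f\<close> is a nontrivial translation, and the triangle
  inequality leaves half of that distance for \<open>f\<close>.\<close>

lemma deck_displacement:
  obtains eps where "eps > 0" "\<And>f z. f \<in> deck \<Longrightarrow> f \<noteq> (\<lambda>z. z) \<Longrightarrow> eps \<le> dist (f z) z"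
proof -
  obtain e where e: "e > 0" "\<And>y. y \<in> tvertices T \<Longrightarrow> y \<noteq> v0 \<Longrightarrow> e \<le> dist v0 y" using isolated_vertex by metis
  have tr: "e \<le> cmod b" if f: "(\<lambda>z. z + b) \<in> deck" "b \<noteq> 0" for b
  proof -
    have "v0 + b \<in> tvertices T" using f G_vertex base_points unfolding deck_def by force
    then show ?thesis using e(2)[of "v0 + b"] f(2) by (simp add: dist_norm)
  qed
  have "e / 2 \<le> dist (f z) z" if f: "f \<in> deck" "f \<noteq> (\<lambda>z. z)" for f z
    using deck_iso[OF f(1)]
  proof
    assume "direct_iso f"
    then obtain b where b: "f = (\<lambda>z. z + b)" using deck_direct f by blast
    then have "b \<noteq> 0" using f(2) by auto
    then show ?thesis using tr[of b] f(1) b e(1) by (simp add: dist_norm)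
  next
    assume i: "indirect_iso f"
    then obtain s c where s: "cmod s = 1" "f = (\<lambda>z. c + s * cnj z)" by (auto simp: indirect_iso_def)
    have ff: "(\<lambda>z. f (f z)) \<in> deck" using deck_comp f by blast
    have "(\<lambda>z. f (f z)) = (\<lambda>z. (c + s * cnj c) + (s * cnj s) * z)" by (simp add: s(2) algebra_simps)
    then have dff: "direct_iso (\<lambda>z. f (f z))" using s(1) unfolding direct_iso_def by (metis complex_mod_cnj mult_1 norm_mult)
    obtain b where b: "(\<lambda>z. f (f z)) = (\<lambda>z. z + b)" using deck_direct[OF ff dff] by blast
    have "b \<noteq> 0"
    proof
      assume "b = 0"
      then have ffz: "f (f z) = z" for z using fun_cong[OF b, of z] by simp
      \<comment> \<open>If \<open>f\<close> were an involution, the midpoint of \<open>z\<close> and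
        \<open>f z\<close> would be fixed.\<close>
      have "f ((z + f z) / 2) = (f z + f (f z)) / 2" by (simp add: s(2) field_simps)
      then have "f ((z + f z) / 2) = (z + f z) / 2" using ffz by (simp add: add.commute)
      then show False using deck_free f by blast
    qed
    then have "e \<le> cmod b" using tr ff b by simp
    also have "cmod b = cmod (f (f z) - z)" using fun_cong[OF b, of z] by simp
    also have "\<dots> \<le> cmod (f (f z) - f z) + cmod (f z - z)" using norm_triangle_ineq[of "f (f z) - f z" "f z - z"] by simp
    also have "cmod (f (f z) - f z) = cmod (f z - z)" using iso_dist i by blast
    finally show ?thesis by (simp add: dist_norm)
  qed
  then show ?thesis using that[of "e / 2"] e(1) by simp
qed

text \<open>Affine maps agreeing on the vertices of a tile agree on its hull, so the tilewise
  extensions in \<open>quot_rel\<close> are restrictions of one isometry.\<close>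

lemma quot_rel_deck: "quot_rel T G x y \<longleftrightarrow> (\<exists>f\<in>deck. y = f x)"
proof
  assume "quot_rel T G x y"
  then obtain g P L b where g: "g \<in> G" and P: "P \<in> T" "x \<in> convex hull P" and L: "linear L" "\<forall>v\<in>P. g v = L v + b" "y = L x + b"
    unfolding quot_rel_def by blast
  obtain f where f: "f \<in> deck" "\<And>z. z \<in> tvertices T \<Longrightarrow> f z = g z" using deck_of_G[OF g] by metis
  obtain L' c where f': "linear L'" "f = (\<lambda>z. c + L' z)" using iso_affine[OF deck_iso[OF f(1)]] .
  define S where "S = {z. L z + b = c + L' z}"
  have "convex S"
  proof (rule convexI)
    fix z w u v assume zw: "z \<in> S" "w \<in> S" "0 \<le> u" "0 \<le> v" "u + v = (1::real)"
    have "L (u *\<^sub>R z + v *\<^sub>R w) + b = u *\<^sub>R (L z + b) + v *\<^sub>R (L w + b)"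
      using zw(5) by (simp add: linear_add[OF L(1)] linear_scale[OF L(1)] algebra_simps flip: scaleR_add_left)
    also have "\<dots> = u *\<^sub>R (c + L' z) + v *\<^sub>R (c + L' w)" using zw by (simp add: S_def)
    also have "\<dots> = c + L' (u *\<^sub>R z + v *\<^sub>R w)"
      using zw(5) by (simp add: linear_add[OF f'(1)] linear_scale[OF f'(1)] algebra_simps flip: scaleR_add_left)
    finally show "u *\<^sub>R z + v *\<^sub>R w \<in> S" by (simp add: S_def)
  qed
  moreover have "P \<subseteq> S" using L(2) f(2) in_tverticesI[OF P(1)] f'(2) by (auto simp: S_def)
  ultimately have "convex hull P \<subseteq> S" by (simp add: hull_minimal)
  then have "y = f x" using P(2) L(3) f'(2) by (auto simp: S_def)
  then show "\<exists>f\<in>deck. y = f x" using f(1) by blast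
next
  assume "\<exists>f\<in>deck. y = f x"
  then obtain f where f: "f \<in> deck" "y = f x" by blast
  then obtain g where g: "g \<in> G" "\<forall>z\<in>tvertices T. f z = g z" by (auto simp: deck_def)
  obtain L' c where f': "linear L'" "f = (\<lambda>z. c + L' z)" using iso_affine[OF deck_iso[OF f(1)]] .
  obtain P where P: "P \<in> T" "x \<in> convex hull P" using e2e_cover[OF e2e] by blast
  have "\<forall>v\<in>P. g v = L' v + c" using g(2) in_tverticesI[OF P(1)] f'(2) by (metis add.commute)
  moreover have "y = L' x + c" using f f' by (simp add: add.commute)
  ultimately show "quot_rel T G x y" unfolding quot_rel_def using g(1) P f'(1) by blast
qed

lemma deck_translation: assumes "f \<in> deck" shows "\<exists>b. f = (\<lambda>z. z + b)"
proof -
  obtain eps where eps: "eps > 0" "\<And>f z. f \<in> deck \<Longrightarrow> f \<noteq> (\<lambda>z. z) \<Longrightarrow> eps \<le> dist (f z) z" using deck_displacement by metis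
  obtain q where q: "quotient_map euclidean (top_of_set torus) q" "\<And>x y. q x = q y \<longleftrightarrow> quot_rel T G x y"
    using G_torus unfolding quotient_is_torus_def by blast
  interpret torus_action deck q eps
    by unfold_locales
      (use iso_continuous deck_iso deck_id deck_comp deck_inv eps q quot_rel_deck in \<open>simp_all\<close>)
  show ?thesis using no_indirect[OF deck_iso deck_direct] deck_iso[OF assms] deck_direct[OF assms] assms by blast
qed

definition shifts :: "complex set" where "shifts = {b. (\<lambda>z. z + b) \<in> deck}"

lemma orb_eq: assumes "v \<in> tvertices T" shows "orb G v = (\<lambda>b. v + b) ` shifts"
proof (intro set_eqI iffI)
  fix x assume "x \<in> orb G v"
  then obtain g where g: "g \<in> G" "x = g v" by (auto simp: orb_def)
  obtain f where f: "f \<in> deck" "\<And>z. z \<in> tvertices T \<Longrightarrow> f z = g z" using deck_of_G[OF g(1)] by metis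
  obtain b where b: "f = (\<lambda>z. z + b)" using deck_translation[OF f(1)] by blast
  then have "b \<in> shifts" using f(1) by (simp add: shifts_def)
  moreover have "x = v + b" using g f(2)[OF assms] b by simp
  ultimately show "x \<in> (\<lambda>b. v + b) ` shifts" by blast
next
  fix x assume "x \<in> (\<lambda>b. v + b) ` shifts"
  then obtain b where "(\<lambda>z. z + b) \<in> deck" "x = v + b" by (auto simp: shifts_def)
  then show "x \<in> orb G v" using assms by (auto simp: orb_def deck_def)
qed

lemma shifts_uminus: "b \<in> shifts \<Longrightarrow> - b \<in> shifts"
proof -
  assume "b \<in> shifts"
  then have "(\<lambda>z. z + b) \<in> deck" by (simp add: shifts_def)
  from deck_inv[OF this] obtain g where g: "g \<in> deck" "\<forall>z. g (z + b) = z" by blast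
  have "g z = z + - b" for z using g(2)[rule_format, of "z - b"] by simp
  then have "g = (\<lambda>z. z + - b)" by blast
  then show "- b \<in> shifts" using g(1) by (simp add: shifts_def)
qed

end

subsection \<open>Orbits on the quotient\<close>


text \<open>A map automorphism is a total function, arbitrary off the vertices; so \<open>h\<close>
  is asked to undo \<open>g\<close> at \<open>u\<close> only.\<close>

lemma map_aut_orbit_eq:
  assumes g: "map_aut M g" "map_aut M h" "u \<in> fst M" "h (g u) = u"
  shows "{\<sigma> (g u) | \<sigma>. map_aut M \<sigma>} = {\<sigma> u | \<sigma>. map_aut M \<sigma>}"
proof -
  have comp: "map_aut M (\<sigma> \<circ> \<tau>)" if "map_aut M \<sigma>" "map_aut M \<tau>" for \<sigma> \<tau>
  proof -
    obtain V E F where M: "M = (V, E, F)" by (cases M)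
    have "(\<lambda>e. (\<sigma> \<circ> \<tau>) ` e) ` S = (\<lambda>e. \<sigma> ` e) ` (\<lambda>e. \<tau> ` e) ` S" for S by (simp add: image_image image_comp)
    then show ?thesis using that bij_betw_trans[of \<tau> V V \<sigma> V] by (simp add: M map_aut_def)
  qed
  show ?thesis
  proof (intro set_eqI iffI)
    fix x assume "x \<in> {\<sigma> (g u) | \<sigma>. map_aut M \<sigma>}"
    then obtain \<sigma> where "map_aut M \<sigma>" "x = (\<sigma> \<circ> g) u" by auto
    then show "x \<in> {\<sigma> u | \<sigma>. map_aut M \<sigma>}" using comp g by blast
  next
    fix x assume "x \<in> {\<sigma> u | \<sigma>. map_aut M \<sigma>}"
    then obtain \<sigma> where "map_aut M \<sigma>" "x = (\<sigma> \<circ> h) (g u)" using g(4) by auto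
    then show "x \<in> {\<sigma> (g u) | \<sigma>. map_aut M \<sigma>}" using comp g by blast
  qed
qed

context torus_quotient_tiling begin

abbreviation "X \<equiv> quotient_map_K T G"

lemma move_inverse: "s = 1 \<or> s = -1 \<Longrightarrow> move s (- s * c) (move s c z) = z" "s = 1 \<or> s = -1 \<Longrightarrow> move s c (move s (- s * c) z) = z"
  by (auto simp: move_def)

lemma move_lattice: "s = 1 \<or> s = -1 \<Longrightarrow> c \<in> lattice d \<Longrightarrow> - s * c \<in> lattice d"
  using lattice_uminus by auto

lemma move_vertex: "s = 1 \<or> s = -1 \<Longrightarrow> c \<in> lattice d \<Longrightarrow> z \<in> tvertices T \<Longrightarrow> move s c z \<in> tvertices T"
  using move_tile unfolding tvertices_def by blast

lemma move_dist: "s = 1 \<or> s = -1 \<Longrightarrow> cmod (move s c b - move s c a) = cmod (b - a)"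
  by (auto simp: move_def norm_minus_commute)

lemma move_edge: assumes "s = 1 \<or> s = -1" "c \<in> lattice d" "e \<in> tedges T" shows "move s c ` e \<in> tedges T"
proof -
  obtain a b R where "e = {a, b}" "R \<in> T" "a \<in> R" "b \<in> R" "cmod (b - a) = cmod d"
    using assms(3) unfolding tedges_eq by blast
  moreover from this have "move s c ` R \<in> T" "move s c a \<in> move s c ` R" "move s c b \<in> move s c ` R"
    "cmod (move s c b - move s c a) = cmod d" "move s c ` e = {move s c a, move s c b}"
    using move_tile[OF assms(1,2)] move_dist[OF assms(1)] by simp_all
  ultimately show ?thesis unfolding tedges_eq
    by (intro CollectI exI[of _ "move s c a"] exI[of _ "move s c b"] conjI bexI[of _ "move s c ` R"]) simp_all
qed

text \<open>Conjugation by the move turns the translation by \<open>b\<close> into the one by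
  \<open>s * b\<close>, and \<open>shifts\<close> is closed under negation. This lets the move
  descend to the quotient.\<close>

lemma move_orb:
  assumes s: "s = 1 \<or> s = -1" and c: "c \<in> lattice d" and v: "v \<in> tvertices T"
  shows "move s c ` orb G v = orb G (move s c v)"
proof -
  have "move s c ` orb G v = (\<lambda>b. move s c v + s * b) ` shifts"
    unfolding orb_eq[OF v] image_image by (simp add: move_def algebra_simps)
  also have "\<dots> = (\<lambda>b. move s c v + b) ` (\<lambda>b. s * b) ` shifts" by (simp add: image_image)
  also have "(\<lambda>b. s * b) ` shifts = shifts"
    using s shifts_uminus by (auto simp: image_iff) (metis minus_minus shifts_uminus)
  finally show ?thesis using orb_eq[OF move_vertex[OF s c v]] by simp
qed

lemma move_aut:
  assumes s: "s = 1 \<or> s = -1" and c: "c \<in> lattice d"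
  shows "map_aut X ((`) (move s c))"
proof -
  let ?m = "move s c" and ?n = "move s (- s * c)"
  note c' = move_lattice[OF s c]
  have inj: "inj ?m" using move_inverse(1)[OF s] by (metis injI)
  have onto: "(\<lambda>e. ?m ` e) ` S = S" if S: "\<And>e. e \<in> S \<Longrightarrow> ?m ` e \<in> S" "\<And>e. e \<in> S \<Longrightarrow> ?n ` e \<in> S" for S
  proof -
    have "?m ` ?n ` e = e" for e using move_inverse(2)[OF s] by (simp add: image_image)
    then show ?thesis using S by (auto simp: image_iff) metis
  qed
  have V: "?m ` tvertices T = tvertices T"
    using move_vertex[OF s c] move_vertex[OF s c'] move_inverse(2)[OF s] by (auto simp: image_iff) metis
  have E: "(\<lambda>e. ?m ` e) ` tedges T = tedges T" using onto move_edge[OF s c] move_edge[OF s c'] by blast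
  have F: "(\<lambda>e. ?m ` e) ` T = T" using onto move_tile[OF s c] move_tile[OF s c'] by blast
  have sub: "S \<subseteq> tvertices T" if "S \<in> T \<or> S \<in> tedges T" for S
    using that in_tverticesI unfolding tedges_eq by blast
  have orb_image: "((`) ?m) ` (orb G ` S) = orb G ` ?m ` S" if "S \<subseteq> tvertices T" for S
    unfolding image_image by (rule image_cong) (use that move_orb[OF s c] in auto)
  have families: "(\<lambda>e. ((`) ?m) ` e) ` (\<lambda>e. orb G ` e) ` S = (\<lambda>e. orb G ` e) ` (\<lambda>e. ?m ` e) ` S"
    if "\<And>e. e \<in> S \<Longrightarrow> e \<subseteq> tvertices T" for S
    using orb_image that by (simp add: image_image cong: image_cong)
  have "inj_on ((`) ?m) (orb G ` tvertices T)" using inj by (auto intro!: inj_onI simp: inj_image_eq_iff)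
  moreover have "((`) ?m) ` (orb G ` tvertices T) = orb G ` tvertices T" using orb_image[of "tvertices T"] V by simp
  moreover have "(\<lambda>e. ((`) ?m) ` e) ` (\<lambda>e. orb G ` e) ` tedges T = (\<lambda>e. orb G ` e) ` tedges T"
    using families[of "tedges T"] sub E by simp
  moreover have "(\<lambda>e. ((`) ?m) ` e) ` (\<lambda>e. orb G ` e) ` T = (\<lambda>e. orb G ` e) ` T"
    using families[of T] sub F by simp
  ultimately show ?thesis by (simp add: map_aut_def quotient_map_K_def bij_betw_def)
qed

definition X_orbit :: "complex \<Rightarrow> complex set set" where
  "X_orbit v = {\<sigma> (orb G v) | \<sigma>. map_aut X \<sigma>}"

lemma X_orbit_move:
  assumes s: "s = 1 \<or> s = -1" and c: "c \<in> lattice d" and v: "v \<in> tvertices T"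
  shows "X_orbit (move s c v) = X_orbit v"
proof -
  have "move s (- s * c) ` move s c ` orb G v = orb G v" using move_inverse(1)[OF s] by (simp add: image_image)
  moreover have "orb G v \<in> fst X" using v by (simp add: quotient_map_K_def)
  ultimately show ?thesis
    using map_aut_orbit_eq[OF move_aut[OF s c] move_aut[OF s move_lattice[OF s c]], of "orb G v"]
    unfolding X_orbit_def move_orb[OF s c v, symmetric] by simp
qed

text \<open>Since \<open>nu^6 = -1\<close>, the six positions on a hexagon form three antipodal
  pairs, which the half-turn about the centre exchanges.\<close>

lemma sixth_roots: "\<exists>s j. (s = 1 \<or> s = -1) \<and> j < 3 \<and> nu ^ (2 * k) = s * nu ^ (2 * j)"
proof (induction k)
  case 0 then show ?case by (intro exI[of _ 1] exI[of _ 0]) simp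
next
  case (Suc k)
  then obtain s j where sj: "s = 1 \<or> s = -1" "j < 3" "nu ^ (2 * k) = s * nu ^ (2 * j)" by blast
  have e: "nu ^ (2 * Suc k) = s * nu ^ (2 * Suc j)" using sj(3) by (simp add: power_add)
  show ?case
  proof (cases "j = 2")
    case True
    have "nu ^ (2 * Suc k) = (- s) * nu ^ (2 * 0)" using e True nu_6 by simp
    then show ?thesis using sj(1) by (intro exI[of _ "- s"] exI[of _ 0]) auto
  next
    case False
    then show ?thesis using e sj by (intro exI[of _ s] exI[of _ "Suc j"]) auto
  qed
qed

lemma four_orbits:
  assumes "y \<in> tvertices T"
  shows "X_orbit y \<in> {X_orbit v0, X_orbit (v0 + d), X_orbit (v0 + d * nu^2), X_orbit (v0 + d * nu^4)}"
  using assms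
proof (cases rule: vertex_coordinates)
  case (1 x)
  then have "y = move 1 x v0" by (simp add: move_def)
  then show ?thesis using X_orbit_move[OF _ 1(1) base_points(1), of 1] by simp
next
  case (2 x k)
  obtain s j where sj: "s = 1 \<or> s = -1" "j < 3" "nu ^ (2 * k) = s * nu ^ (2 * j)" using sixth_roots by blast
  have y: "y = move s x (v0 + d * nu ^ (2 * j))" unfolding 2(2) sj(3) by (simp add: move_def algebra_simps)
  have "v0 + d * nu ^ (2 * j) \<in> tvertices T"
    using vB_vertex[OF lattice_vB[OF lattice.zero, of j]] by simp
  then have "X_orbit y = X_orbit (v0 + d * nu ^ (2 * j))" using X_orbit_move[OF sj(1) 2(1)] y by simp
  moreover have "X_orbit (v0 + d * nu ^ (2 * j)) \<in> {X_orbit (v0 + d), X_orbit (v0 + d * nu^2), X_orbit (v0 + d * nu^4)}"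
  proof -
    have "j = 0 \<or> j = 1 \<or> j = 2" using sj(2) by auto
    then show ?thesis by (elim disjE) simp_all
  qed
  ultimately show ?thesis by (simp only: insert_iff simp_thms)
qed

lemma orbit_bound: "finite (aut_vertex_orbits X) \<and> card (aut_vertex_orbits X) \<le> 4"
proof -
  let ?S = "{X_orbit v0, X_orbit (v0 + d), X_orbit (v0 + d * nu^2), X_orbit (v0 + d * nu^4)}"
  have "aut_vertex_orbits X = X_orbit ` tvertices T"
    by (simp add: aut_vertex_orbits_def quotient_map_K_def X_orbit_def image_image)
  then have sub: "aut_vertex_orbits X \<subseteq> ?S"
    by (simp only:) (rule image_subsetI, rule four_orbits)
  have "card (aut_vertex_orbits X) \<le> card ?S" by (rule card_mono[OF _ sub]) simp
  \<comment> \<open>The four orbits may coincide; counting list entries gives the upper bound in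
    every case.\<close>
  also have "card ?S \<le> 4"
    using card_length[of "[X_orbit v0, X_orbit (v0 + d), X_orbit (v0 + d * nu^2), X_orbit (v0 + d * nu^4)]"] by simp
  finally show ?thesis using finite_subset[OF sub] by simp
qed

end

theorem theorem1:
  fixes T :: "complex set set" and G :: "(complex \<Rightarrow> complex) set"
  assumes "two_uniform_tiling T"
    and "\<forall>u\<in>tvertices T. has_vertex_type T u [3,3,3,3,3,3] \<or> has_vertex_type T u [3,3,4,3,4]"
    and "\<exists>u. has_vertex_type T u [3,3,3,3,3,3]"
    and "\<exists>u. has_vertex_type T u [3,3,4,3,4]"
    and "torus_quotient T G"
  shows "finite (aut_vertex_orbits (quotient_map_K T G)) \<and>
         card (aut_vertex_orbits (quotient_map_K T G)) \<le> 4"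
proof -
  interpret two_uniform T
    by unfold_locales (use assms in \<open>simp_all add: two_uniform_tiling_def\<close>)
  obtain v0 where v0: "has_vertex_type T v0 LA" using exA by blast
  then obtain d where d: "d \<noteq> 0" "star T v0 = starA v0 d" using star_A(2) by blast
  interpret torus_quotient_tiling T v0 d G
    by unfold_locales (use d v0 hexagon next_hexagon assms(5) in \<open>simp_all add: vA_def\<close>)
  show ?thesis by (rule orbit_bound)
qed

end
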